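(* Let $G$ be a finite simple graph with $m:=|E(G)|\ge 7\times 10^{10}$ and maximum degree $\Delta$. Then $$\mathrm{tes}(G)=\max\left\{\left\lceil\frac{m+2}{3}\right\rceil,\left\lceil\frac{\Delta+1}{2}\right\rceil\right\}.$$
   Context: Graphs are finite and simple. For a graph $G=(V,E)$ and a positive integer $s$, an edge irregular total $s$-weighting is a map $\hat w:E\cup V\to\{1,2,\ldots,s\}$ such that $\hat w(uv)+\hat w(u)+\hat w(v)\ne \hat w(u'v')+\hat w(u')+\hat w(v')$ whenever $uv\neq u'v'$ are two different edges of $G$. The total edge irregularity strength $\mathrm{tes}(G)$ is the minimum $s$ for which there exists an edge irregular total $s$-weighting of $G$. *)

theory Defs
  imports Complex_Main
begin

definition finite_simple_graph :: "'a set \<Rightarrow> 'a set set \<Rightarrow> bool" where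
  "finite_simple_graph V E \<longleftrightarrow> finite V \<and> E \<subseteq> {{u, v} | u v. u \<in> V \<and> v \<in> V \<and> u \<noteq> v}"

definition degree :: "'a set set \<Rightarrow> 'a \<Rightarrow> nat" where
  "degree E v = card {e \<in> E. v \<in> e}"

(* Unspecified for V = {}; a graph with at least one edge has a vertex. *)
definition max_degree :: "'a set \<Rightarrow> 'a set set \<Rightarrow> nat" where
  "max_degree V E = Max (degree E ` V)"

(* The domain of a total weighting is the disjoint union of V and E:
   w (Inl v) is the weight of the vertex v, w (Inr e) the weight of the edge e. *)
definition edge_irregular_total_weighting ::
    "'a set \<Rightarrow> 'a set set \<Rightarrow> nat \<Rightarrow> ('a + 'a set \<Rightarrow> nat) \<Rightarrow> bool" where
  "edge_irregular_total_weighting V E s w \<longleftrightarrow>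
     w ` (V <+> E) \<subseteq> {1..s} \<and>
     (\<forall>u v u' v'. {u, v} \<in> E \<longrightarrow> {u', v'} \<in> E \<longrightarrow> {u, v} \<noteq> {u', v'} \<longrightarrow>
        w (Inr {u, v}) + w (Inl u) + w (Inl v) \<noteq>
        w (Inr {u', v'}) + w (Inl u') + w (Inl v'))"

definition tes :: "'a set \<Rightarrow> 'a set set \<Rightarrow> nat" where
  "tes V E = (LEAST s. s > 0 \<and> (\<exists>w. edge_irregular_total_weighting V E s w))"

(* The set over which the minimum in tes is taken is nonempty, so LEAST is a genuine minimum. *)
lemma edge_irregular_total_weighting_exists:
  assumes "finite_simple_graph V E"
  shows "\<exists>s>0. \<exists>w. edge_irregular_total_weighting V E s w"
proof -
  have "E \<subseteq> Pow V" "finite V"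
    using assms by (auto simp: finite_simple_graph_def)
  then have "finite E"
    by (meson finite_Pow_iff finite_subset)
  then obtain f where f: "bij_betw f E {0..<card E}"
    using ex_bij_betw_finite_nat by blast
  define w :: "'a + 'a set \<Rightarrow> nat" where "w = case_sum (\<lambda>_. 1) (\<lambda>e. Suc (f e))"
  have "w (Inr e) \<in> {1..Suc (card E)}" if "e \<in> E" for e
    using bij_betwE[OF f] that by (auto simp: w_def less_imp_le)
  moreover have "w (Inr e) \<noteq> w (Inr e')" if "e \<in> E" "e' \<in> E" "e \<noteq> e'" for e e'
    using f that by (auto simp: w_def bij_betw_def inj_on_def)
  moreover have "w (Inl v) = 1" for v
    by (simp add: w_def)
  ultimately have "edge_irregular_total_weighting V E (Suc (card E)) w"
    unfolding edge_irregular_total_weighting_def by auto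
  then show ?thesis
    by blast
qed

end

theory Submission
  imports Defs
begin

text \<open>
  Write \<open>s\<close> for the claimed value minus one, so that all weights are shifted to \<open>0..s\<close>. It suffices to find
  vertex weights such that, for \<open>1 \<le> i \<le> 2 s\<close>, the number \<open>N i\<close> of edges whose end weights sum to less
  than \<open>i\<close> satisfies \<open>i \<le> N i \<le> s + i\<close>: sorting the edges by that sum, the position of an edge can then be
  used as its total weight.

  If some vertex has degree at least \<open>1.504 s\<close>, it gets weight 0 and all but \<open>s + 1\<close> of the other vertices
  get weight \<open>s\<close>; the exceptional vertices are neighbours of it that span few edges. If there are three
  vertices each two of which meet at least \<open>1.67 s\<close> edges leaving the pair, the same works with a pair in
  place of the single vertex.

  Otherwise the vertices of degree more than \<open>m / 40000\<close> are split as evenly as possible into a part of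
  weight 0 and a part of weight \<open>s\<close>, and the remaining vertices choose one of 13 equidistant weights at
  random. The expected counts satisfy the inequalities with room to spare, and a second moment bound
  shows that some choice comes close enough to the expectation.
\<close>

section \<open>Weightings from counts of edge sums\<close>

text \<open>The constants mark where the methods meet. Random levels control only vertices of small
  degree, and edges inside the set of larger vertices escape all control. With the cutoff
  \<open>m / 40000\<close> that set has little more than 40000 vertices and spans at most about 8.2
  * 10^8 edges; this must stay below 0.0118 of all edges, hence 7 * 10^10. A core met by
  \<open>2 * s + 1 - t\<close> edges may need auxiliary vertices whose weight exceeds
  \<open>s / 2\<close> but not \<open>s + 1 - t\<close>. So \<open>t\<close> stays below
  \<open>s / 2\<close>, and a single core vertex needs degree above 3/2 of \<open>s\<close>. For a
  pair, an auxiliary vertex can carry two edges to the core, so \<open>2 * t\<close> has to fit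
  below \<open>s - t\<close>, and the cut must exceed 5/3 of \<open>s\<close>. The values 1.504 and
  1.67 lie just above these limits. The obstacle to an even split is a part dominated by one or two
  vertices. One such vertex is excluded by the degree bound. Two come with a third that is at least
  as heavy, and the triple helps: if the pair with the smallest cut is the core, few edges avoid all
  three vertices, so exceptional vertices spanning few edges exist.\<close>

lemma sorted_position_exists:
  fixes f :: "'b \<Rightarrow> 'c::linorder"
  assumes "finite A"
  shows "\<exists>pos. bij_betw pos A {..<card A} \<and> (\<forall>x\<in>A. \<forall>y\<in>A. f x < f y \<longrightarrow> pos x < (pos y :: nat))"
  using assms
proof (induction "card A" arbitrary: A)
  case 0
  then show ?case by (auto simp: bij_betw_def)
next
  case (Suc n)
  from Suc have "A \<noteq> {}" by auto
  have "Max (f ` A) \<in> f ` A" using \<open>A \<noteq> {}\<close> Suc by (intro Max_in) auto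
  then obtain z where z: "z \<in> A" "f z = Max (f ` A)" by auto
  have zmax: "f x \<le> f z" if "x \<in> A" for x using that Suc z by auto
  have c: "n = card (A - {z})" using Suc z by simp
  obtain pos where pos: "bij_betw pos (A - {z}) {..<card (A - {z})}"
    "\<forall>x\<in>A - {z}. \<forall>y\<in>A - {z}. f x < f y \<longrightarrow> pos x < (pos y :: nat)"
    using Suc.hyps(1)[OF c] Suc.prems by auto
  let ?p = "pos(z := n)"
  have "bij_betw ?p (A - {z}) {..<n}"
    using pos(1) c by (subst bij_betw_cong[where g = pos]) auto
  then have "bij_betw ?p ((A - {z}) \<union> {z}) ({..<n} \<union> {n})"
    by (intro bij_betw_combine) (auto simp: bij_betw_def)
  moreover have "(A - {z}) \<union> {z} = A" "{..<n} \<union> {n} = {..<card A}"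
    using z Suc(2) by auto
  ultimately have b: "bij_betw ?p A {..<card A}" by simp
  have "?p x < ?p y" if "x \<in> A" "y \<in> A" "f x < f y" for x y
  proof -
    have "x \<noteq> z" using zmax[of y] that by auto
    have "pos x < n" using bij_betwE[OF pos(1)] \<open>x \<noteq> z\<close> that(1) c by auto
    then show ?thesis using pos(2) that \<open>x \<noteq> z\<close> by auto
  qed
  with b show ?case by blast
qed

lemma finite_simple_graphD:
  assumes "finite_simple_graph V E"
  shows "finite V" "finite E" "\<And>e. e \<in> E \<Longrightarrow> e \<subseteq> V" "\<And>e. e \<in> E \<Longrightarrow> card e = 2"
    "\<And>e. e \<in> E \<Longrightarrow> finite e"
proof -
  show V: "finite V" using assms by (auto simp: finite_simple_graph_def)
  have "E \<subseteq> Pow V" using assms by (auto simp: finite_simple_graph_def)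
  then show "finite E" "\<And>e. e \<in> E \<Longrightarrow> e \<subseteq> V"
    using V by (auto intro: finite_subset)
  show c: "card e = 2" if "e \<in> E" for e
    using assms that by (auto simp: finite_simple_graph_def)
  show "finite e" if "e \<in> E" for e
    using c[OF that] by (intro card_ge_0_finite) auto
qed

text \<open>The edge receives the difference between its position and the sum of its end weights,
  and the two count conditions place this difference in \<open>0..s\<close>. After the shift by one
  of all three weights, the total of an edge is its position plus 3.\<close>

lemma weighting_of_counts:
  fixes w :: "'a \<Rightarrow> nat"
  assumes G: "finite_simple_graph V E"
    and m: "card E \<le> 3 * s + 1"
    and w: "\<And>v. v \<in> V \<Longrightarrow> w v \<le> s"
    and lo: "\<And>i. 1 \<le> i \<Longrightarrow> i \<le> 2 * s \<Longrightarrow> i \<le> card {e \<in> E. sum w e < i}"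
    and hi: "\<And>i. 1 \<le> i \<Longrightarrow> i \<le> 2 * s \<Longrightarrow> card {e \<in> E. sum w e < i} \<le> s + i"
  shows "\<exists>w'. edge_irregular_total_weighting V E (Suc s) w'"
proof -
  note finE = finite_simple_graphD(2)[OF G]
  obtain pos where pos: "bij_betw pos E {..<card E}"
    "\<forall>x\<in>E. \<forall>y\<in>E. sum w x < sum w y \<longrightarrow> pos x < (pos y :: nat)"
    using sorted_position_exists[OF finE, of "sum w"] by blast
  have sum2: "sum w {u, v} = w u + w v" "u \<noteq> v" "u \<in> V" "v \<in> V" if "{u, v} \<in> E" for u v
  proof -
    show "u \<noteq> v" using finite_simple_graphD(4)[OF G that] by auto
    then show "sum w {u, v} = w u + w v" by simp
    show "u \<in> V" "v \<in> V" using finite_simple_graphD(3)[OF G that] by auto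
  qed
  have inj: "inj_on pos E" and im: "pos ` E = {..<card E}"
    using pos(1) by (auto simp: bij_betw_def)
  have card_pos: "card {e \<in> E. pos e < k} = k" if "k \<le> card E" for k
  proof -
    have "pos ` {e \<in> E. pos e < k} = {..<k}" using im that by (auto simp: set_eq_iff image_iff) (metis im imageE lessThan_iff less_le_trans)
    moreover have "inj_on pos {e \<in> E. pos e < k}" using inj by (rule inj_on_subset) auto
    ultimately show ?thesis by (metis card_image card_lessThan)
  qed
  have sum_le: "sum w e \<le> 2 * s" if "e \<in> E" for e
  proof -
    have "sum w e \<le> of_nat (card e) * s"
      using finite_simple_graphD(3)[OF G that] w by (intro sum_bounded_above) auto
    then show ?thesis using finite_simple_graphD(4)[OF G that] by simp
  qed
  have pos_lt: "pos e < card E" if "e \<in> E" for e using im that by auto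
  have lower: "sum w e \<le> pos e" if e: "e \<in> E" for e
  proof (cases "sum w e = 0")
    case False
    have sub: "{e' \<in> E. sum w e' < sum w e} \<subseteq> {e' \<in> E. pos e' < pos e}" using pos(2) e by auto
    have "card {e' \<in> E. sum w e' < sum w e} \<le> pos e"
      using card_mono[OF _ sub] card_pos[of "pos e"] pos_lt[OF e] finE by simp
    moreover have "sum w e \<le> card {e' \<in> E. sum w e' < sum w e}"
      using lo False sum_le[OF e] by auto
    ultimately show ?thesis by simp
  qed simp
  have upper: "pos e \<le> sum w e + s" if e: "e \<in> E" for e
  proof (cases "sum w e = 2 * s")
    case True
    \<comment> \<open>No count condition exists at \<open>2 * s + 1\<close>; here the bound on the
      number of edges takes its place.\<close>
    then show ?thesis using pos_lt[OF e] m by auto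
  next
    case False
    have sub: "{e' \<in> E. pos e' < Suc (pos e)} \<subseteq> {e' \<in> E. sum w e' < Suc (sum w e)}"
    proof safe
      fix e' assume e': "e' \<in> E" "pos e' < Suc (pos e)"
      then have "\<not> pos e < pos e'" by simp
      then have "\<not> sum w e < sum w e'" using pos(2)[rule_format, of e e'] e e' by linarith
      then show "sum w e' < Suc (sum w e)" by simp
    qed
    have "Suc (pos e) \<le> card {e' \<in> E. sum w e' < Suc (sum w e)}"
      using card_mono[OF _ sub] card_pos[of "Suc (pos e)"] pos_lt[OF e] finE by simp
    also have "\<dots> \<le> s + Suc (sum w e)" using hi[of "Suc (sum w e)"] sum_le[OF e] False by simp
    finally show ?thesis by simp
  qed
  define w' where "w' = case_sum (\<lambda>v. Suc (w v)) (\<lambda>e. Suc (pos e - sum w e))"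
  have "edge_irregular_total_weighting V E (Suc s) w'"
    unfolding edge_irregular_total_weighting_def
  proof (intro conjI allI impI)
    show "w' ` (V <+> E) \<subseteq> {1..Suc s}"
      using w upper by (auto simp: w'_def le_diff_conv add.commute)
  next
    fix u v u' v'
    assume e: "{u, v} \<in> E" "{u', v'} \<in> E" "{u, v} \<noteq> {u', v'}"
    have tot: "w' (Inr {x, y}) + w' (Inl x) + w' (Inl y) = pos {x, y} + 3" if "{x, y} \<in> E" for x y
      using lower[OF that] sum2(1)[OF that] by (simp add: w'_def)
    have "pos {u, v} \<noteq> pos {u', v'}" using inj e by (auto dest: inj_onD)
    then show "w' (Inr {u, v}) + w' (Inl u) + w' (Inl v) \<noteq> w' (Inr {u', v'}) + w' (Inl u') + w' (Inl v')"
      using tot[OF e(1)] tot[OF e(2)] by simp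
  qed
  then show ?thesis by blast
qed

text \<open>Total weights are distinct. They lie between 3 and \<open>3 * s\<close>, and at a fixed
  vertex \<open>v\<close> between \<open>w (Inl v) + 2\<close> and
  \<open>w (Inl v) + 2 * s\<close>.\<close>

lemma weighting_lower_bounds:
  assumes G: "finite_simple_graph V E"
    and W: "edge_irregular_total_weighting V E s w"
  shows "E \<noteq> {} \<Longrightarrow> card E + 2 \<le> 3 * s" "degree E v > 0 \<Longrightarrow> degree E v + 1 \<le> 2 * s"
proof -
  note D = finite_simple_graphD[OF G]
  define T where "T e = w (Inr e) + (\<Sum>v\<in>e. w (Inl v))" for e
  have rep: "\<exists>u v. e = {u, v} \<and> u \<noteq> v" if "e \<in> E" for e
    using D(4)[OF that] by (auto simp: card_2_iff)
  have T2: "T {u, v} = w (Inr {u, v}) + w (Inl u) + w (Inl v)" if "u \<noteq> v" for u v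
    using that by (simp add: T_def)
  have W1: "w ` (V <+> E) \<subseteq> {1..s}"
    using W by (simp add: edge_irregular_total_weighting_def)
  have rng: "w (Inr e) \<in> {1..s}" if "e \<in> E" for e
    using W1 that by blast
  have rngv: "w (Inl v) \<in> {1..s}" if "v \<in> V" for v
    using W1 that by blast
  have inj: "inj_on T E"
  proof (rule inj_onI, rule ccontr)
    fix e e' assume e: "e \<in> E" "e' \<in> E" "T e = T e'" "e \<noteq> e'"
    obtain u v where uv: "e = {u, v}" "u \<noteq> v" using rep e by blast
    obtain u' v' where uv': "e' = {u', v'}" "u' \<noteq> v'" using rep e by blast
    have "w (Inr {u, v}) + w (Inl u) + w (Inl v) \<noteq> w (Inr {u', v'}) + w (Inl u') + w (Inl v')"
      using W e uv uv' unfolding edge_irregular_total_weighting_def by blast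
    then show False using e T2 uv uv' by simp
  qed
  have "T ` E \<subseteq> {3..3*s}"
  proof safe
    fix e assume e: "e \<in> E"
    obtain u v where uv: "e = {u, v}" "u \<noteq> v" using rep e by blast
    have "u \<in> V" "v \<in> V" using D(3)[OF e] uv by auto
    then show "T e \<in> {3..3*s}" using rng[OF e] rngv[of u] rngv[of v] uv T2 by auto
  qed
  then have "card E \<le> card {3..3*s}"
    using card_image[OF inj] card_mono[of "{3..3*s}" "T ` E"] by auto
  then show "card E + 2 \<le> 3 * s" if "E \<noteq> {}"
  proof -
    have "card E > 0" using that D(2) by (simp add: card_gt_0_iff)
    then show ?thesis using \<open>card E \<le> card {3..3*s}\<close> by simp
  qed
  let ?S = "{e \<in> E. v \<in> e}"
  have inj': "inj_on T ?S" using inj by (rule inj_on_subset) auto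
  have "T ` ?S \<subseteq> {w (Inl v) + 2..w (Inl v) + 2*s}"
  proof safe
    fix e assume e: "e \<in> E" "v \<in> e"
    obtain u where uv: "e = {u, v}" "u \<noteq> v" using rep e by blast
    have "u \<in> V" using D(3)[OF e(1)] uv by auto
    then show "T e \<in> {w (Inl v) + 2..w (Inl v) + 2*s}" using rng[OF e(1)] rngv[of u] uv T2 by auto
  qed
  then have "card ?S \<le> card {w (Inl v) + 2..w (Inl v) + 2*s}"
    using card_image[OF inj'] card_mono[of "{w (Inl v) + 2..w (Inl v) + 2*s}" "T ` ?S"] by auto
  then show "degree E v + 1 \<le> 2 * s" if "degree E v > 0"
    using that by (simp add: degree_def)
qed

section \<open>Weight zero on a small core\<close>

text \<open>With weight 0 on \<open>B0\<close>, an edge from \<open>B0\<close> to \<open>u\<close>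
  has sum \<open>w u\<close>, at most \<open>s\<close>. The touching edges therefore carry the
  counts up to \<open>s\<close>, and beyond \<open>s\<close> only the avoiding edges still
  vary.\<close>

locale zero_core =
  fixes V :: "'a set" and E :: "'a set set" and B0 :: "'a set"
  assumes graph: "finite_simple_graph V E" and B0_sub: "B0 \<subseteq> V"
begin

definition "avoiding = {e \<in> E. e \<inter> B0 = {}}"
definition "touching = {e \<in> E. e \<inter> B0 \<noteq> {}}"
definition "core_edges = {e \<in> E. e \<subseteq> B0}"
definition "mult u = card {b \<in> B0. {b, u} \<in> E}"

lemmas graphD = finite_simple_graphD[OF graph]

lemma finite_core: "finite B0" "finite avoiding" "finite touching" "finite core_edges"
  using graphD B0_sub by (auto simp: avoiding_def touching_def core_edges_def intro: finite_subset)

lemma card_split: "card E = card touching + card avoiding"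
proof -
  have "E = touching \<union> avoiding" "touching \<inter> avoiding = {}"
    by (auto simp: touching_def avoiding_def)
  then show ?thesis using card_Un_disjoint[of touching avoiding] finite_core by simp
qed

lemma edge_pair:
  assumes "e \<in> E" "b \<in> e" "u \<in> e" "b \<noteq> u"
  shows "e = {b, u}"
proof -
  obtain x y where "e = {x, y}" using graphD(4)[OF assms(1)] by (auto simp: card_2_iff)
  then show ?thesis using assms by auto
qed

lemma card_mult:
  assumes "U \<subseteq> V - B0"
  shows "card {e \<in> E. e \<inter> B0 \<noteq> {} \<and> e \<inter> U \<noteq> {}} = (\<Sum>u\<in>U. mult u)"
proof -
  have fU: "finite U" using assms graphD(1) by (auto intro: finite_subset)
  let ?A = "\<lambda>u. (\<lambda>b. {b, u}) ` {b \<in> B0. {b, u} \<in> E}"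
  have "{e \<in> E. e \<inter> B0 \<noteq> {} \<and> e \<inter> U \<noteq> {}} = (\<Union>u\<in>U. ?A u)"
  proof (intro equalityI subsetI)
    fix e assume "e \<in> {e \<in> E. e \<inter> B0 \<noteq> {} \<and> e \<inter> U \<noteq> {}}"
    then obtain b u where bu: "e \<in> E" "b \<in> e" "b \<in> B0" "u \<in> e" "u \<in> U" by auto
    then have "e = {b, u}" using edge_pair[of e b u] assms by auto
    then show "e \<in> (\<Union>u\<in>U. ?A u)" using bu by auto
  qed auto
  also have "card \<dots> = (\<Sum>u\<in>U. card (?A u))"
  proof (rule card_UN_disjoint)
    show "\<forall>i\<in>U. \<forall>j\<in>U. i \<noteq> j \<longrightarrow> ?A i \<inter> ?A j = {}"
    proof (intro ballI impI)
      fix i j assume ij: "i \<in> U" "j \<in> U" "i \<noteq> j"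
      show "?A i \<inter> ?A j = {}" using ij assms by (auto simp: doubleton_eq_iff)
    qed
  qed (use fU finite_core in auto)
  also have "\<dots> = (\<Sum>u\<in>U. mult u)"
  proof (rule sum.cong)
    fix u assume "u \<in> U"
    then have "inj_on (\<lambda>b. {b, u}) {b \<in> B0. {b, u} \<in> E}"
      using assms by (auto simp: inj_on_def doubleton_eq_iff)
    then show "card (?A u) = mult u" unfolding mult_def by (rule card_image)
  qed simp
  finally show ?thesis .
qed

lemma card_touching: "card touching = card core_edges + (\<Sum>u\<in>V - B0. mult u)"
proof -
  let ?X = "{e \<in> E. e \<inter> B0 \<noteq> {} \<and> e \<inter> (V - B0) \<noteq> {}}"
  have "e \<inter> B0 \<noteq> {}" if "e \<in> E" "e \<subseteq> B0" for e
    using graphD(4)[OF that(1)] that(2) by (auto simp: inf_absorb1)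
  then have 1: "touching = core_edges \<union> ?X" and 2: "core_edges \<inter> ?X = {}"
    using graphD(3) by (auto simp: touching_def core_edges_def)
  have "finite ?X" using graphD by auto
  then have "card touching = card core_edges + card ?X"
    unfolding 1 by (rule card_Un_disjoint[OF finite_core(4) _ 2])
  then show ?thesis using card_mult[OF subset_refl] by linarith
qed

lemma card_sum_less:
  fixes w :: "'a \<Rightarrow> nat"
  assumes w0: "\<And>v. v \<in> B0 \<Longrightarrow> w v = 0" and i: "1 \<le> i"
  shows "card {e \<in> E. sum w e < i} =
    card core_edges + (\<Sum>u | u \<in> V - B0 \<and> w u < i. mult u) + card {e \<in> avoiding. sum w e < i}"
proof -
  let ?U = "{u \<in> V - B0. w u < i}"
  let ?X = "{e \<in> E. e \<inter> B0 \<noteq> {} \<and> e \<inter> ?U \<noteq> {}}" and ?Y = "{e \<in> avoiding. sum w e < i}"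
  have s: "sum w e = w u" if "e \<in> E" "b \<in> e" "u \<in> e" "b \<in> B0" "u \<notin> B0" for e b u
  proof -
    have "b \<noteq> u" using that by auto
    then have e: "e = {b, u}" using edge_pair[of e b u] that by blast
    show ?thesis unfolding e using that(4) w0 \<open>b \<noteq> u\<close> by simp
  qed
  have ne: "e \<inter> B0 \<noteq> {}" if "e \<in> E" "e \<subseteq> B0" for e
    using graphD(4)[OF that(1)] that(2) by (auto simp: inf_absorb1)
  have 1: "{e \<in> E. sum w e < i} = (core_edges \<union> ?X) \<union> ?Y"
  proof (intro equalityI subsetI)
    fix e assume e: "e \<in> {e \<in> E. sum w e < i}"
    show "e \<in> (core_edges \<union> ?X) \<union> ?Y"
    proof (cases "e \<inter> B0 = {} \<or> e \<subseteq> B0")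
      case True then show ?thesis using e by (auto simp: avoiding_def core_edges_def)
    next
      case False
      then obtain b u where "b \<in> e" "u \<in> e" "b \<in> B0" "u \<notin> B0" by auto
      then show ?thesis using e s[of e b u] graphD(3)[of e] by auto
    qed
  next
    fix e assume "e \<in> (core_edges \<union> ?X) \<union> ?Y"
    then consider "e \<in> core_edges" | "e \<in> ?X" | "e \<in> ?Y" by auto
    then show "e \<in> {e \<in> E. sum w e < i}"
    proof cases
      case 1
      then have "sum w e = 0" using w0 by (intro sum.neutral) (auto simp: core_edges_def)
      then show ?thesis using 1 i by (auto simp: core_edges_def)
    next
      case 2
      then obtain b u where "b \<in> e" "u \<in> e" "b \<in> B0" "u \<notin> B0" "w u < i" "e \<in> E" by auto
      then show ?thesis using s[of e b u] by auto
    qed (auto simp: avoiding_def)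
  qed
  have 2: "core_edges \<inter> ?X = {}" by (auto simp: core_edges_def)
  have 3: "(core_edges \<union> ?X) \<inter> ?Y = {}" using ne by (auto simp: core_edges_def avoiding_def)
  have f: "finite ?X" "finite ?Y" using graphD finite_core by auto
  have "card {e \<in> E. sum w e < i} = card core_edges + card ?X + card ?Y"
    unfolding 1 using card_Un_disjoint[OF _ f(2) 3] card_Un_disjoint[OF finite_core(4) f(1) 2] f finite_core by simp
  moreover have "?U \<subseteq> V - B0" by auto
  ultimately show ?thesis using card_mult[of ?U] by simp
qed

text \<open>Here \<open>t\<close> is what the touching edges lack to \<open>2 * s + 1\<close>. At
  \<open>s + j\<close> all touching edges are counted, so the two required bounds turn into bounds
  on the avoiding edges, expressed by \<open>t\<close> and \<open>j\<close>. Up to \<open>s\<close>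
  the lower bound is asked of the touching edges alone.\<close>

lemma weighting_of_core_counts:
  fixes w :: "'a \<Rightarrow> nat"
  assumes m: "card E \<le> 3 * s + 1" and t: "card touching + t = 2 * s + 1"
    and w0: "\<And>v. v \<in> B0 \<Longrightarrow> w v = 0" and ws: "\<And>v. v \<in> V \<Longrightarrow> w v \<le> s"
    and lo1: "\<And>i. 1 \<le> i \<Longrightarrow> i \<le> s \<Longrightarrow>
      i \<le> card core_edges + (\<Sum>u | u \<in> V - B0 \<and> w u < i. mult u)"
    and hi1: "\<And>i. 1 \<le> i \<Longrightarrow> i \<le> s \<Longrightarrow>
      card core_edges + (\<Sum>u | u \<in> V - B0 \<and> w u < i. mult u) + card {e \<in> avoiding. sum w e < i} \<le> s + i"
    and lo2: "\<And>j. 1 \<le> j \<Longrightarrow> j \<le> s \<Longrightarrow> j + t \<le> s + 1 + card {e \<in> avoiding. sum w e < s + j}"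
    and hi2: "\<And>j. 1 \<le> j \<Longrightarrow> j \<le> s \<Longrightarrow> card {e \<in> avoiding. sum w e < s + j} + 1 \<le> t + j"
  shows "\<exists>w'. edge_irregular_total_weighting V E (Suc s) w'"
proof -
  have cs: "card {e \<in> E. sum w e < i} =
    card core_edges + (\<Sum>u | u \<in> V - B0 \<and> w u < i. mult u) + card {e \<in> avoiding. sum w e < i}" if "1 \<le> i" for i
    by (rule card_sum_less) (use w0 that in auto)
  have big: "card {e \<in> E. sum w e < s + j} = card touching + card {e \<in> avoiding. sum w e < s + j}" if "1 \<le> j" for j
  proof -
    have "w u < s + j" if "u \<in> V" for u using ws[OF that] \<open>1 \<le> j\<close> by linarith
    then have U: "{u. u \<in> V - B0 \<and> w u < s + j} = V - B0" by auto
    have "1 \<le> s + j" using that by simp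
    from cs[OF this] show ?thesis unfolding U card_touching .
  qed
  have lo: "i \<le> card {e \<in> E. sum w e < i}" if i: "1 \<le> i" "i \<le> 2 * s" for i
  proof (cases "i \<le> s")
    case True then show ?thesis using lo1[OF i(1) True] cs[OF i(1)] by linarith
  next
    case False
    define j where "j = i - s"
    have "i = s + j" "1 \<le> j" using False by (auto simp: j_def)
    have j: "j \<le> s" using i \<open>i = s + j\<close> by linarith
    then show ?thesis using big[OF \<open>1 \<le> j\<close>] lo2[OF \<open>1 \<le> j\<close> j] t unfolding \<open>i = s + j\<close> by linarith
  qed
  have hi: "card {e \<in> E. sum w e < i} \<le> s + i" if i: "1 \<le> i" "i \<le> 2 * s" for i
  proof (cases "i \<le> s")
    case True then show ?thesis using hi1[OF i(1) True] cs[OF i(1)] by linarith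
  next
    case False
    define j where "j = i - s"
    have "i = s + j" "1 \<le> j" using False by (auto simp: j_def)
    have j: "j \<le> s" using i \<open>i = s + j\<close> by linarith
    then show ?thesis using big[OF \<open>1 \<le> j\<close>] hi2[OF \<open>1 \<le> j\<close> j] t unfolding \<open>i = s + j\<close> by linarith
  qed
  show ?thesis
    by (rule weighting_of_counts[where w = w, OF graph m]) (rule ws lo hi; assumption)+
qed

section \<open>Edges avoiding the core, by the way they meet a vertex set\<close>

definition "inner I = {e \<in> avoiding. e \<subseteq> I}"
definition "outs I u = {e \<in> avoiding. e \<inter> I = {u}}"

lemma avoidingD:
  assumes "e \<in> avoiding"
  shows "e \<in> E" "e \<subseteq> V - B0" "card e = 2" "finite e"
  using assms graphD by (auto simp: avoiding_def)

lemma finite_inner: "finite (inner I)" "finite (outs I u)"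
  using finite_core by (auto simp: inner_def outs_def)

lemma outsD:
  assumes "e \<in> outs I u"
  shows "\<exists>v. e = {u, v} \<and> u \<noteq> v \<and> v \<in> V - B0 - I"
proof -
  have e: "e \<in> avoiding" "e \<inter> I = {u}" using assms by (auto simp: outs_def)
  have "u \<in> e" using e by auto
  then have "card (e - {u}) = 1" using avoidingD[OF e(1)] by simp
  then obtain v where "e - {u} = {v}" by (auto simp: card_1_singleton_iff)
  then have "e = {u, v}" "u \<noteq> v" using \<open>u \<in> e\<close> by auto
  moreover have "v \<notin> I" using e(2) \<open>e - {u} = {v}\<close> by auto
  moreover have "v \<in> V - B0" using \<open>e - {u} = {v}\<close> avoidingD(2)[OF e(1)] by auto
  ultimately show ?thesis by blast
qed

lemma avoiding_cases:
  assumes "e \<in> avoiding" "e \<inter> I \<noteq> {}" "e \<notin> inner I"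
  shows "\<exists>u\<in>I. e \<in> outs I u"
proof -
  obtain x y where e: "e = {x, y}" "x \<noteq> y"
    using avoidingD(3)[OF assms(1)] by (auto simp: card_2_iff)
  have "\<not> e \<subseteq> I" using assms by (auto simp: inner_def)
  then consider "x \<in> I" "y \<notin> I" | "y \<in> I" "x \<notin> I" using assms(2) e by auto
  then show ?thesis
  proof cases
    case 1
    then have "e \<inter> I = {x}" using e by auto
    then show ?thesis using assms(1) 1 by (auto simp: outs_def)
  next
    case 2
    then have "e \<inter> I = {y}" using e by auto
    then show ?thesis using assms(1) 2 by (auto simp: outs_def)
  qed
qed

lemma card_outs:
  assumes "U \<subseteq> I" "finite U"
  shows "card (\<Union>u\<in>U. outs I u) = (\<Sum>u\<in>U. card (outs I u))"
  using assms finite_inner by (intro card_UN_disjoint) (auto simp: outs_def)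

lemma inner_outs_disjoint: "inner I \<inter> (\<Union>u\<in>U. outs I u) = {}"
proof -
  have False if e: "e \<in> inner I" "e \<in> outs I u" for e u
  proof -
    obtain v where "e = {u, v}" "v \<notin> I" using outsD[OF e(2)] by auto
    then show False using e(1) by (auto simp: inner_def)
  qed
  then show ?thesis by blast
qed

lemma card_inner_outs:
  assumes "U \<subseteq> I" "finite U"
  shows "card (inner I \<union> (\<Union>u\<in>U. outs I u)) = card (inner I) + (\<Sum>u\<in>U. card (outs I u))"
proof -
  have "finite (\<Union>u\<in>U. outs I u)" using assms finite_inner by auto
  then have "card (inner I \<union> (\<Union>u\<in>U. outs I u)) = card (inner I) + card (\<Union>u\<in>U. outs I u)"
    by (intro card_Un_disjoint) (use finite_inner inner_outs_disjoint in auto)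
  then show ?thesis using card_outs[OF assms] by simp
qed

lemma card_touched:
  assumes "finite I"
  shows "card {e \<in> avoiding. e \<inter> I \<noteq> {}} = card (inner I) + (\<Sum>u\<in>I. card (outs I u))"
proof -
  have ne: "e \<inter> I \<noteq> {}" if "e \<in> inner I" for e
    using that avoidingD(3)[of e] by (auto simp: inner_def inf_absorb1)
  have "{e \<in> avoiding. e \<inter> I \<noteq> {}} = inner I \<union> (\<Union>u\<in>I. outs I u)"
  proof (intro equalityI subsetI)
    fix e assume "e \<in> {e \<in> avoiding. e \<inter> I \<noteq> {}}"
    then show "e \<in> inner I \<union> (\<Union>u\<in>I. outs I u)" using avoiding_cases[of e I] by auto
  next
    fix e assume e: "e \<in> inner I \<union> (\<Union>u\<in>I. outs I u)"
    show "e \<in> {e \<in> avoiding. e \<inter> I \<noteq> {}}"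
    proof (cases "e \<in> inner I")
      case True then show ?thesis using ne by (auto simp: inner_def)
    next
      case False then show ?thesis using e by (auto simp: outs_def)
    qed
  qed
  then show ?thesis using card_inner_outs[of I I] assms by simp
qed

end

text \<open>In the order of increasing \<open>b / c\<close>, a prefix has at most the average ratio.
  For \<open>v\<close> in the prefix and \<open>x\<close> after it,
  \<open>b v * c x \<le> b x * c v\<close>, and summing over all such pairs compares the prefix with
  the rest.\<close>

lemma ratio_order_exists:
  fixes c b :: "'b \<Rightarrow> nat"
  assumes "finite I" and pos: "\<And>u. u \<in> I \<Longrightarrow> c u > 0"
  shows "\<exists>ps :: 'b \<Rightarrow> nat. inj_on ps I \<and>
    (\<forall>u\<in>I. (\<Sum>v | v \<in> I \<and> ps v \<le> ps u. b v) * sum c I \<le> sum b I * (\<Sum>v | v \<in> I \<and> ps v \<le> ps u. c v))"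
proof -
  define key where "key u = real (b u) / real (c u)" for u
  obtain ps where ps: "bij_betw ps I {..<card I}"
    and mono: "\<forall>x\<in>I. \<forall>y\<in>I. key x < key y \<longrightarrow> ps x < (ps y :: nat)"
    using sorted_position_exists[OF assms(1), of key] by blast
  have "(\<Sum>v | v \<in> I \<and> ps v \<le> ps u. b v) * sum c I \<le> sum b I * (\<Sum>v | v \<in> I \<and> ps v \<le> ps u. c v)"
    if "u \<in> I" for u
  proof -
    let ?J = "{v \<in> I. ps v \<le> ps u}" and ?K = "{v \<in> I. \<not> ps v \<le> ps u}"
    have cross: "b v * c x \<le> b x * c v" if "v \<in> ?J" "x \<in> ?K" for v x
    proof -
      have "\<not> key x < key v" using mono that by force
      then have "real (b v) * real (c x) \<le> real (b x) * real (c v)"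
        using pos[of v] pos[of x] that by (simp add: key_def field_simps)
      then show ?thesis by (simp flip: of_nat_mult)
    qed
    have "sum b ?J * sum c ?K = (\<Sum>v\<in>?J. \<Sum>x\<in>?K. b v * c x)" by (simp add: sum_product)
    also have "\<dots> \<le> (\<Sum>v\<in>?J. \<Sum>x\<in>?K. b x * c v)" by (intro sum_mono cross)
    also have "\<dots> = sum b ?K * sum c ?J"
      by (subst sum.swap) (simp add: sum_product)
    finally have le: "sum b ?J * sum c ?K \<le> sum b ?K * sum c ?J" .
    have split: "sum f I = sum f ?J + sum f ?K" for f :: "'b \<Rightarrow> nat"
    proof -
      have "sum f (?J \<union> ?K) = sum f ?J + sum f ?K"
        using assms(1) by (intro sum.union_disjoint) auto
      moreover have "?J \<union> ?K = I" by auto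
      ultimately show ?thesis by simp
    qed
    show ?thesis unfolding split[of c] split[of b] using le by (simp add: algebra_simps)
  qed
  then show ?thesis using ps by (auto simp: bij_betw_def)
qed

lemma finite_arg_extremum:
  fixes f :: "'b \<Rightarrow> 'c::linorder"
  assumes "finite X" "X \<noteq> {}"
  shows "\<exists>u\<in>X. \<forall>v\<in>X. f u \<le> f v" "\<exists>u\<in>X. \<forall>v\<in>X. f v \<le> f u"
proof -
  have *: "Min (f ` X) \<in> f ` X" "Max (f ` X) \<in> f ` X" using assms by (auto intro!: Min_in Max_in)
  obtain u where "u \<in> X" "f u = Min (f ` X)" using *(1) by auto
  then show "\<exists>u\<in>X. \<forall>v\<in>X. f u \<le> f v" using assms(1) by (intro bexI[of _ u]) auto
  obtain u where "u \<in> X" "f u = Max (f ` X)" using *(2) by auto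
  then show "\<exists>u\<in>X. \<forall>v\<in>X. f v \<le> f u" using assms(1) by (intro bexI[of _ u]) auto
qed

context zero_core
begin

text \<open>The vertices of \<open>I\<close> are handled in order of increasing ratio of \<open>outs\<close> to \<open>mult\<close>. A weight of at most
  \<open>l u\<close> keeps the counts below \<open>s\<close> large enough, a weight of at least \<open>p u\<close> keeps those above \<open>s\<close> small
  enough, and the order makes \<open>p u \<le> l u\<close>. Raising the weight towards \<open>h\<close> protects the counts below \<open>s\<close>
  from growing too much.\<close>

lemma weighting_of_ratio_order:
  assumes m: "card E \<le> 3 * s + 1" and t: "card touching + t = 2 * s + 1"
    and I: "I \<subseteq> V - B0"
    and cm: "\<And>u. u \<in> I \<Longrightarrow> 1 \<le> mult u \<and> mult u \<le> cm"
    and C: "s + cm \<le> sum mult I" "sum mult I \<le> s + 2 * cm"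
    and inn: "card (inner I) + cm \<le> t + card core_edges + 1" "card (inner I) \<le> t"
    and b: "\<And>u. u \<in> I \<Longrightarrow> card (outs I u) + card (inner I) \<le> s + 1"
    and h: "2 * h \<le> s" "t \<le> h" "card (inner I) + card core_edges + 2 * cm \<le> h + 1"
    and a: "t \<le> card {e \<in> avoiding. e \<inter> I \<noteq> {}} + 1"
  shows "\<exists>w'. edge_irregular_total_weighting V E (Suc s) w'"
proof -
  have fI: "finite I" using I graphD(1) by (auto intro: finite_subset)
  define i0 e0 where "i0 = card (inner I)" and "e0 = card core_edges"
  define b where "b u = card (outs I u)" for u
  have "\<exists>ps :: 'a \<Rightarrow> nat. inj_on ps I \<and>
    (\<forall>u\<in>I. (\<Sum>v | v \<in> I \<and> ps v \<le> ps u. b v) * sum mult I \<le> sum b I * (\<Sum>v | v \<in> I \<and> ps v \<le> ps u. mult v))"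
    by (rule ratio_order_exists[OF fI]) (use cm in force)
  then obtain ps :: "'a \<Rightarrow> nat" where inj: "inj_on ps I" and
    ratio: "\<forall>u\<in>I. (\<Sum>v | v \<in> I \<and> ps v \<le> ps u. b v) * sum mult I \<le> sum b I * (\<Sum>v | v \<in> I \<and> ps v \<le> ps u. mult v)"
    by blast
  define pre upt where "pre u = {v \<in> I. ps v < ps u}" and "upt u = {v \<in> I. ps v \<le> ps u}" for u
  have fin: "finite (pre u)" "finite (upt u)" for u using fI by (auto simp: pre_def upt_def)
  have sub: "pre u \<subseteq> I" "upt u \<subseteq> I" for u by (auto simp: pre_def upt_def)
  have upt_sum: "sum f (upt u) = f u + sum f (pre u)" if "u \<in> I" for u and f :: "'a \<Rightarrow> nat"
  proof -
    have "upt u = insert u (pre u)" using that inj by (auto simp: pre_def upt_def inj_on_def le_less)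
    moreover have "u \<notin> pre u" by (simp add: pre_def)
    ultimately show ?thesis using fin by simp
  qed
  \<comment> \<open>All inner edges are treated as counted from the start, hence \<open>i0\<close>
    in \<open>p u\<close>. The truncated subtraction gives \<open>p u = 0\<close> as long as the
    edges up to \<open>u\<close> do not exceed \<open>t\<close>.\<close>
  define l p wI where "l u = e0 + sum mult (pre u)" and "p u = i0 + sum b (upt u) - t"
    and "wI u = min (l u) (max (p u) h)" for u
  have wI_alt: "wI u = min (l u) (max (p u) h)" "l u = e0 + sum mult (pre u)" "p u = i0 + sum b (upt u) - t" for u
    by (auto simp: wI_def l_def p_def)
  have touched: "card {e \<in> avoiding. e \<inter> I \<noteq> {}} = i0 + sum b I"
    using card_touched[OF fI] by (simp add: i0_def b_def)
  have H: "i0 + sum b I \<le> s + t"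
  proof -
    have "card {e \<in> avoiding. e \<inter> I \<noteq> {}} \<le> card avoiding"
      using finite_core by (intro card_mono) auto
    then show ?thesis using touched card_split m t by linarith
  qed
  have p_le_l: "p u \<le> l u" if u: "u \<in> I" for u
  proof -
    let ?S = "sum b (upt u)" and ?X = "sum mult (upt u)" and ?C = "sum mult I"
    have r: "?S * ?C \<le> sum b I * ?X" using ratio u by (simp add: upt_def)
    have X: "?X = mult u + sum mult (pre u)" using upt_sum[OF u] .
    have XC: "?X \<le> ?C" using sub fI by (intro sum_mono2) auto
    have c: "1 \<le> mult u" "mult u \<le> cm" using cm[OF u] by auto
    \<comment> \<open>If the average ratio is below 1, the order gives \<open>?S < ?X\<close>.
      Otherwise \<open>?S\<close> exceeds \<open>?X\<close> by at most \<open>d\<close>, because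
      \<open>?X \<le> ?C\<close>. This excess is affordable: \<open>H\<close> bounds
      \<open>i0 + ?C + d\<close> by \<open>s + t\<close>, and \<open>?C\<close> is at least
      \<open>s + cm\<close>. The term \<open>cm\<close> covers the step from \<open>upt u\<close>
      back to \<open>pre u\<close>.\<close>
    have "i0 + ?S + cm \<le> t + e0 + ?X"
    proof (cases "sum b I < ?C")
      case True
      have "?X > 0" using X c by simp
      then have "sum b I * ?X < ?C * ?X" using True by (intro mult_strict_right_mono)
      from le_less_trans[OF r this] have "?S < ?X"
        by (subst (asm) mult.commute) (rule mult_less_cancel1[THEN iffD1, THEN conjunct2])
      then show ?thesis using inn(1) by (simp add: i0_def e0_def)
    next
      case False
      define d where "d = sum b I - ?C"
      have d: "sum b I = ?C + d" using False by (simp add: d_def)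
      have "?S * ?C \<le> ?C * ?X + d * ?X" using r unfolding d by (simp add: algebra_simps)
      also have "\<dots> \<le> ?C * ?X + d * ?C" using XC by simp
      also have "\<dots> = (?X + d) * ?C" by (simp add: algebra_simps)
      finally have "?S \<le> ?X + d" using C cm[OF u] by simp
      then show ?thesis using d H C(1) by linarith
    qed
    then show ?thesis using X c unfolding wI_alt(2,3) by linarith
  qed
  have p_le_w: "p u \<le> wI u" if "u \<in> I" for u using p_le_l[OF that] by (simp add: wI_def)
  have ps_sub: "sum f (upt u) \<le> sum f I" for u and f :: "'a \<Rightarrow> nat"
    using sub fI by (intro sum_mono2) auto
  have wI_s: "wI u \<le> s" for u
  proof -
    have "p u \<le> s" using ps_sub[of b u] H unfolding wI_alt by linarith
    then show ?thesis using h(1) by (auto simp: wI_def)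
  qed
  have l_mono: "l v \<le> l u" if "ps v \<le> ps u" for u v
    unfolding wI_alt(2) using that fin by (intro add_left_mono sum_mono2) (auto simp: pre_def)
  define w where "w v = (if v \<in> B0 then 0 else if v \<in> I then wI v else s)" for v
  have wI: "w u = wI u" if "u \<in> I" for u using I that by (auto simp: w_def)
  have set1: "{u. u \<in> V - B0 \<and> w u < i} = {u \<in> I. wI u < i}" if "i \<le> s" for i
    using I that by (auto simp: w_def)
  have outs_sum: "sum w e = s + wI u" if e: "e \<in> outs I u" and u: "u \<in> I" for e u
  proof -
    obtain v where v: "e = {u, v}" "u \<noteq> v" "v \<in> V - B0 - I" using outsD[OF e] by blast
    have "w v = s" using v(3) by (simp add: w_def)
    then show ?thesis unfolding v(1) using v(2) wI[OF u] by simp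
  qed
  have rest_sum: "sum w e = 2 * s" if e: "e \<in> avoiding" "e \<inter> I = {}" for e
  proof -
    obtain x y where xy: "e = {x, y}" "x \<noteq> y"
      using avoidingD(3)[OF e(1)] by (auto simp: card_2_iff)
    have "w x = s" "w y = s" using xy e avoidingD(2)[OF e(1)] by (auto simp: w_def)
    then show ?thesis unfolding xy(1) using xy(2) by simp
  qed
  \<comment> \<open>The sums of inner edges are not tracked: this upper estimate counts all of them,
    the lower estimate \<open>Klo\<close> none.\<close>
  have Kup: "card {e \<in> avoiding. sum w e < s + j} \<le> i0 + sum b {u \<in> I. wI u < j}" if "j \<le> s" for j
  proof -
    have "{e \<in> avoiding. sum w e < s + j} \<subseteq> inner I \<union> (\<Union>u\<in>{u \<in> I. wI u < j}. outs I u)"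
    proof
      fix e assume "e \<in> {e \<in> avoiding. sum w e < s + j}"
      then have e: "e \<in> avoiding" "sum w e < s + j" by auto
      show "e \<in> inner I \<union> (\<Union>u\<in>{u \<in> I. wI u < j}. outs I u)"
      proof (cases "e \<in> inner I")
        case False
        have "e \<inter> I \<noteq> {}" using rest_sum[OF e(1)] e(2) \<open>j \<le> s\<close> by auto
        then obtain u where "u \<in> I" "e \<in> outs I u" using avoiding_cases[OF e(1)] False by blast
        then show ?thesis using outs_sum e(2) by auto
      qed simp
    qed
    then have "card {e \<in> avoiding. sum w e < s + j} \<le> card (inner I \<union> (\<Union>u\<in>{u \<in> I. wI u < j}. outs I u))"
      using fI finite_inner by (intro card_mono) auto
    also have "\<dots> = i0 + sum b {u \<in> I. wI u < j}"
      using card_inner_outs[of "{u \<in> I. wI u < j}" I] fI by (simp add: i0_def b_def)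
    finally show ?thesis .
  qed
  have Klo: "sum b U \<le> card {e \<in> avoiding. sum w e < s + j}" if U: "U \<subseteq> {u \<in> I. wI u < j}" for j U
  proof -
    have UI: "U \<subseteq> I" using U by auto
    have "sum b U = card (\<Union>u\<in>U. outs I u)"
      using card_outs[OF UI finite_subset[OF UI fI]] by (simp add: b_def)
    also have "\<dots> \<le> card {e \<in> avoiding. sum w e < s + j}"
    proof (intro card_mono subsetI)
      fix e assume "e \<in> (\<Union>u\<in>U. outs I u)"
      then obtain u where "u \<in> I" "wI u < j" "e \<in> outs I u" using U by auto
      then show "e \<in> {e \<in> avoiding. sum w e < s + j}" using outs_sum by (auto simp: outs_def)
    qed (use finite_core in auto)
    finally show ?thesis .
  qed
  have K1: "card {e \<in> avoiding. sum w e < i} \<le> i0" if i: "i \<le> s" for i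
  proof -
    have "{e \<in> avoiding. sum w e < i} \<subseteq> {e \<in> avoiding. sum w e < s + 0}" using i by auto
    then have "card {e \<in> avoiding. sum w e < i} \<le> card {e \<in> avoiding. sum w e < s + 0}"
      using finite_core by (intro card_mono) auto
    also have "\<dots> \<le> i0" using Kup[of 0] by simp
    finally show ?thesis .
  qed
  show ?thesis
  proof (rule weighting_of_core_counts[OF m t, of w])
    show "w v = 0" if "v \<in> B0" for v using that by (simp add: w_def)
    show "w v \<le> s" if "v \<in> V" for v using wI_s by (simp add: w_def)
  next
    fix i assume i: "1 \<le> i" "i \<le> s"
    show "i \<le> card core_edges + (\<Sum>u | u \<in> V - B0 \<and> w u < i. mult u)"
      unfolding set1[OF i(2)] e0_def[symmetric]
    proof (cases "{u \<in> I. i \<le> l u} = {}")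
      case True
      then have "{u \<in> I. wI u < i} = I" by (auto simp: wI_def not_le min_less_iff_disj)
      then show "i \<le> e0 + sum mult {u \<in> I. wI u < i}" using C(1) i by simp
    next
      case False
      then obtain u where u: "u \<in> I" "i \<le> l u" "\<forall>v\<in>{u \<in> I. i \<le> l u}. ps u \<le> ps v"
        using finite_arg_extremum(1)[of "{u \<in> I. i \<le> l u}" ps] fI by auto
      have "pre u \<subseteq> {u \<in> I. wI u < i}"
      proof
        fix v assume "v \<in> pre u"
        then have "v \<in> I" "\<not> ps u \<le> ps v" by (auto simp: pre_def)
        then have "\<not> i \<le> l v" using u(3) by blast
        then show "v \<in> {u \<in> I. wI u < i}" using \<open>v \<in> I\<close> by (auto simp: wI_def)
      qed
      then have "sum mult (pre u) \<le> sum mult {u \<in> I. wI u < i}"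
        using fI by (intro sum_mono2) auto
      then show "i \<le> e0 + sum mult {u \<in> I. wI u < i}" using u(2) unfolding wI_alt(2) by linarith
    qed
    have "e0 + sum mult {u \<in> I. wI u < i} + i0 \<le> s + i"
    proof (cases "i \<le> h")
      case True
      \<comment> \<open>Below \<open>h\<close> the floor in \<open>wI\<close> is decisive: a weight
        under \<open>i\<close> must come from \<open>l u\<close>. The counted vertices then stay
        within one prefix, whose last vertex adds at most \<open>cm\<close>.\<close>
      have l: "l u < i" if "wI u < i" for u using that True by (auto simp: wI_def min_less_iff_disj)
      show ?thesis
      proof (cases "{u \<in> I. wI u < i} = {}")
        case True
        show ?thesis using i h unfolding True i0_def e0_def by simp
      next
        case False
        then obtain u where u: "u \<in> I" "wI u < i" "\<forall>v\<in>{u \<in> I. wI u < i}. ps v \<le> ps u"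
          using finite_arg_extremum(2)[of "{u \<in> I. wI u < i}" ps] fI by auto
        have "sum mult {u \<in> I. wI u < i} \<le> sum mult (upt u)"
          using u(3) fin by (intro sum_mono2) (auto simp: upt_def)
        also have "\<dots> = mult u + sum mult (pre u)" by (rule upt_sum[OF u(1)])
        finally show ?thesis using l[OF u(2)] cm[OF u(1)] h i unfolding wI_alt(2) i0_def e0_def by linarith
      qed
    next
      case False
      have "sum mult {u \<in> I. wI u < i} \<le> sum mult I" using fI by (intro sum_mono2) auto
      then show ?thesis using False C(2) h unfolding i0_def e0_def by linarith
    qed
    then show "card core_edges + (\<Sum>u | u \<in> V - B0 \<and> w u < i. mult u) + card {e \<in> avoiding. sum w e < i} \<le> s + i"
      unfolding set1[OF i(2)] e0_def[symmetric] using K1[OF i(2)] by linarith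
  next
    fix j assume j: "1 \<le> j" "j \<le> s"
    let ?K = "card {e \<in> avoiding. sum w e < s + j}"
    show "j + t \<le> s + 1 + ?K"
    proof (cases "j + t \<le> s + 1")
      case False
      \<comment> \<open>From \<open>t \<le> h\<close> and \<open>2 * h \<le> s\<close>. A weight of
        at least \<open>j\<close> is therefore forced by \<open>p\<close>, not by the floor
        \<open>h\<close>.\<close>
      have jh: "h < j" using False h by linarith
      show ?thesis
      proof (cases "{u \<in> I. j \<le> wI u} = {}")
        case True
        then have all: "{u \<in> I. wI u < j} = I" by (auto simp: not_le)
        show ?thesis
        \<comment> \<open>If no weight exceeds \<open>h\<close>, even inner edges have sum at most
          \<open>2 * h \<le> s\<close>, so every avoiding edge at \<open>I\<close> is counted. If
          some weight exceeds \<open>h\<close>, then \<open>p\<close> does so there, and this alone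
          shows that \<open>I\<close> has enough outgoing edges.\<close>
        proof (cases "\<forall>u\<in>I. wI u \<le> h")
          case True
          have "{e \<in> avoiding. e \<inter> I \<noteq> {}} \<subseteq> {e \<in> avoiding. sum w e < s + j}"
          proof safe
            fix e x assume e: "e \<in> avoiding" "x \<in> e" "x \<in> I"
            show "sum w e < s + j"
            proof (cases "e \<in> inner I")
              case in': True
              have "sum w e \<le> of_nat (card e) * h"
                using in' True wI by (intro sum_bounded_above) (auto simp: inner_def)
              then show ?thesis using avoidingD(3)[OF e(1)] h(1) j by simp
            next
              case False
              then obtain u where "u \<in> I" "e \<in> outs I u" using avoiding_cases[OF e(1)] e by blast
              then show ?thesis using outs_sum[of e u] True jh by fastforce
            qed
          qed
          then have "card {e \<in> avoiding. e \<inter> I \<noteq> {}} \<le> ?K"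
            using finite_core by (intro card_mono) auto
          then show ?thesis using a j by linarith
        next
          case False
          then obtain u where u: "u \<in> I" "h < wI u" by auto
          then have "h < p u" by (auto simp: wI_def)
          then have "h + t < i0 + sum b (upt u)" unfolding wI_alt(3) by linarith
          also have "sum b (upt u) \<le> sum b I" by (rule ps_sub)
          also have "sum b I \<le> ?K" using Klo[of I j] all by simp
          finally show ?thesis using inn(2) h j unfolding i0_def by linarith
        qed
      next
        case False
        then obtain u where u: "u \<in> I" "j \<le> wI u" "\<forall>v\<in>{u \<in> I. j \<le> wI u}. ps u \<le> ps v"
          using finite_arg_extremum(1)[of "{u \<in> I. j \<le> wI u}" ps] fI by auto
        have "pre u \<subseteq> {u \<in> I. wI u < j}"
        proof
          fix v assume "v \<in> pre u"
          then have "v \<in> I" "\<not> ps u \<le> ps v" by (auto simp: pre_def)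
          then show "v \<in> {u \<in> I. wI u < j}" using u(3) by force
        qed
        then have K: "sum b (pre u) \<le> ?K" by (rule Klo)
        have "j \<le> p u" using u(2) jh by (auto simp: wI_def)
        then have "j + t \<le> i0 + sum b (upt u)" using j unfolding wI_alt(3) by linarith
        also have "sum b (upt u) = b u + sum b (pre u)" by (rule upt_sum[OF u(1)])
        finally show ?thesis using b[OF u(1)] K unfolding i0_def b_def by linarith
      qed
    qed simp
    show "?K + 1 \<le> t + j"
    proof (cases "{u \<in> I. wI u < j} = {}")
      case True
      have "?K \<le> i0" using Kup[OF j(2)] unfolding True by simp
      then show ?thesis using inn(2) j unfolding i0_def by linarith
    next
      case False
      then obtain u where u: "u \<in> I" "wI u < j" "\<forall>v\<in>{u \<in> I. wI u < j}. ps v \<le> ps u"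
        using finite_arg_extremum(2)[of "{u \<in> I. wI u < j}" ps] fI by auto
      have "sum b {u \<in> I. wI u < j} \<le> sum b (upt u)"
        using u(3) fin by (intro sum_mono2) (auto simp: upt_def)
      moreover have "i0 + sum b (upt u) \<le> t + p u" unfolding wI_alt(3) by linarith
      ultimately show ?thesis using Kup[OF j(2)] p_le_w[OF u(1)] u(2) by linarith
    qed
  qed
qed

text \<open>If \<open>I\<close> meets too few of the edges that avoid the core, the missing ones are supplied by vertices \<open>Y\<close> of
  small degree, whose weight \<open>y0\<close> is slightly more than half of \<open>s\<close>: then edges between them only count
  beyond \<open>s + D\<close>.\<close>

lemma weighting_of_ratio_order_extended:
  assumes m: "card E \<le> 3 * s + 1" and t: "card touching + t = 2 * s + 1"
    and I: "I \<subseteq> V - B0" and Y: "Y \<subseteq> V - B0 - I"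
    and cm: "\<And>u. u \<in> I \<union> Y \<Longrightarrow> mult u \<le> cm"
    and C: "s \<le> sum mult I" "sum mult I \<le> s + 2 * cm"
    and a: "card {e \<in> avoiding. e \<inter> I \<noteq> {}} = a" "a \<le> t"
    and aY: "t \<le> card {e \<in> avoiding. e \<inter> (I \<union> Y) \<noteq> {}} + 1" "card {e \<in> avoiding. e \<inter> (I \<union> Y) \<noteq> {}} + 1 \<le> t + D"
    and h: "2 * h \<le> s" "t + card core_edges + 2 * cm \<le> h + 1"
    and y: "h \<le> y0" "y0 \<le> s" "s + D + 1 \<le> 2 * y0" "y0 + t \<le> s + 1"
      "card core_edges + 2 * cm + cm * card Y + a \<le> y0"
  shows "\<exists>w'. edge_irregular_total_weighting V E (Suc s) w'"
proof -
  have fI: "finite I" using I graphD(1) by (auto intro: finite_subset)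
  have fY: "finite Y" using Y graphD(1) by (auto intro: finite_subset)
  define e0 where "e0 = card core_edges"
  \<comment> \<open>A constant key: any order serves. Since \<open>I\<close> meets at most
    \<open>t\<close> avoiding edges, no weight has to be raised to delay them, and only prefix sums
    of \<open>mult\<close> matter.\<close>
  obtain ps :: "'a \<Rightarrow> nat" where "bij_betw ps I {..<card I}"
    using sorted_position_exists[OF fI, of "\<lambda>_. 0 :: nat"] by blast
  then have inj: "inj_on ps I" by (simp add: bij_betw_def)
  define pre where "pre u = {v \<in> I. ps v < ps u}" for u
  have fin: "finite (pre u)" for u using fI by (auto simp: pre_def)
  define l where "l u = e0 + sum mult (pre u)" for u
  define w where "w v = (if v \<in> B0 then 0 else if v \<in> I then min (l v) h else if v \<in> Y then y0 else s)" for v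
  have wI: "w u = min (l u) h" if "u \<in> I" for u using I that by (auto simp: w_def)
  have wY: "w u = y0" if "u \<in> Y" for u using Y that by (auto simp: w_def)
  have ws: "w u \<le> s" for u using y h by (auto simp: w_def)
  have wJ: "w u \<le> y0" if "u \<in> I \<union> Y" for u using that wI wY y(1) by auto
  have wout: "w u = s" if "u \<in> V - B0 - I - Y" for u using that by (auto simp: w_def)
  have wnI: "y0 \<le> w u" if "u \<in> V - B0 - I" for u using that y by (auto simp: w_def)
  let ?TI = "{e \<in> avoiding. e \<inter> I \<noteq> {}}" and ?TJ = "{e \<in> avoiding. e \<inter> (I \<union> Y) \<noteq> {}}"
  have notI: "s + D + 1 \<le> sum w e" if e: "e \<in> avoiding" "e \<inter> I = {}" for e
  proof -
    obtain x z where xz: "e = {x, z}" "x \<noteq> z"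
      using avoidingD(3)[OF e(1)] by (auto simp: card_2_iff)
    have "y0 \<le> w x" "y0 \<le> w z" using xz e avoidingD(2)[OF e(1)] by (auto intro!: wnI)
    then show ?thesis unfolding xz(1) using xz(2) y by simp
  qed
  have notJ: "sum w e = 2 * s" if e: "e \<in> avoiding" "e \<inter> (I \<union> Y) = {}" for e
  proof -
    obtain x z where xz: "e = {x, z}" "x \<noteq> z"
      using avoidingD(3)[OF e(1)] by (auto simp: card_2_iff)
    have "w x = s" "w z = s" using xz e avoidingD(2)[OF e(1)] by (auto intro!: wout)
    then show ?thesis unfolding xz(1) using xz(2) by simp
  qed
  have inJ: "sum w e \<le> s + y0" if e: "e \<in> avoiding" "e \<inter> (I \<union> Y) \<noteq> {}" for e
  proof -
    obtain x z where xz: "e = {x, z}" "x \<noteq> z"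
      using avoidingD(3)[OF e(1)] by (auto simp: card_2_iff)
    have "w x \<le> y0 \<or> w z \<le> y0" using xz e wJ by auto
    then show ?thesis unfolding xz(1) using xz(2) ws[of x] ws[of z] by auto
  qed
  have fTI: "finite ?TI" "finite ?TJ" using finite_core by auto
  have KI: "card {e \<in> avoiding. sum w e < i} \<le> a" if "i \<le> s + D" for i
  proof -
    have "{e \<in> avoiding. sum w e < i} \<subseteq> ?TI" using notI that by force
    then show ?thesis using card_mono[OF fTI(1)] a(1) by blast
  qed
  show ?thesis
  proof (rule weighting_of_core_counts[OF m t, of w])
    show "w v = 0" if "v \<in> B0" for v using that by (simp add: w_def)
    show "w v \<le> s" if "v \<in> V" for v by (rule ws)
  next
    fix i assume i: "1 \<le> i" "i \<le> s"
    let ?W = "{u. u \<in> V - B0 \<and> w u < i}"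
    have fW: "finite ?W" using graphD(1) by auto
    show "i \<le> card core_edges + sum mult ?W"
      unfolding e0_def[symmetric]
    proof (cases "{u \<in> I. i \<le> l u} = {}")
      case True
      then have "I \<subseteq> ?W" using I wI by (force simp: not_le min_less_iff_disj)
      then have "sum mult I \<le> sum mult ?W" by (intro sum_mono2 fW) auto
      then show "i \<le> e0 + sum mult ?W" using C(1) i by linarith
    next
      case False
      then obtain u where u: "u \<in> I" "i \<le> l u" "\<forall>v\<in>{u \<in> I. i \<le> l u}. ps u \<le> ps v"
        using finite_arg_extremum(1)[of "{u \<in> I. i \<le> l u}" ps] fI by auto
      have "pre u \<subseteq> ?W"
      proof
        fix v assume "v \<in> pre u"
        then have v: "v \<in> I" "\<not> ps u \<le> ps v" by (auto simp: pre_def)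
        then have "\<not> i \<le> l v" using u(3) by blast
        then show "v \<in> ?W" using v(1) wI[OF v(1)] I by auto
      qed
      then have "sum mult (pre u) \<le> sum mult ?W" by (intro sum_mono2 fW) auto
      then show "i \<le> e0 + sum mult ?W" using u(2) unfolding l_def by linarith
    qed
    have "e0 + sum mult ?W + a \<le> s + i"
    proof (cases "i \<le> h")
      case True
      have W: "?W = {u \<in> I. l u < i}" using I wI wnI True y(1) by (force simp: min_less_iff_disj)
      show ?thesis
      proof (cases "{u \<in> I. l u < i} = {}")
        case True
        show ?thesis using i h a unfolding W True e0_def by simp
      next
        case False
        then obtain u where u: "u \<in> I" "l u < i" "\<forall>v\<in>{u \<in> I. l u < i}. ps v \<le> ps u"
          using finite_arg_extremum(2)[of "{u \<in> I. l u < i}" ps] fI by auto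
        have "{u \<in> I. l u < i} \<subseteq> insert u (pre u)"
          using u inj by (auto simp: pre_def le_less inj_on_def)
        then have "sum mult {u \<in> I. l u < i} \<le> sum mult (insert u (pre u))"
          using fin by (intro sum_mono2) auto
        also have "\<dots> = mult u + sum mult (pre u)" using fin by (subst sum.insert) (auto simp: pre_def)
        finally have "e0 + sum mult ?W \<le> l u + mult u" unfolding W l_def by linarith
        then show ?thesis using cm[of u] u h i a(2) by simp
      qed
    next
      case False
      show ?thesis
      proof (cases "i \<le> y0")
        case True
        have "?W \<subseteq> I" using wnI True by (fastforce simp: not_le)
        then have "sum mult ?W \<le> sum mult I" using fI by (intro sum_mono2) auto
        then show ?thesis using False C(2) h a(2) unfolding e0_def by linarith
      next
        case False
        have "?W \<subseteq> I \<union> Y" using wout i(2) by (fastforce simp: not_le)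
        then have "sum mult ?W \<le> sum mult (I \<union> Y)" using fI fY by (intro sum_mono2) auto
        also have "\<dots> = sum mult I + sum mult Y" using fI fY Y by (intro sum.union_disjoint) auto
        also have "sum mult Y \<le> of_nat (card Y) * cm" using cm by (intro sum_bounded_above) auto
        finally show ?thesis using False C(2) y(5) unfolding e0_def by (simp add: mult.commute)
      qed
    qed
    then show "card core_edges + sum mult ?W + card {e \<in> avoiding. sum w e < i} \<le> s + i"
      using KI[of i] i(2) unfolding e0_def by linarith
  next
    fix j assume j: "1 \<le> j" "j \<le> s"
    let ?K = "card {e \<in> avoiding. sum w e < s + j}"
    show "j + t \<le> s + 1 + ?K"
    proof (cases "j + t \<le> s + 1")
      case False
      have "sum w e < s + j" if "e \<in> ?TJ" for e
        using inJ[of e] that False y(4) by auto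
      then have "?TJ \<subseteq> {e \<in> avoiding. sum w e < s + j}" by auto
      then have "card ?TJ \<le> ?K" using finite_core by (intro card_mono) auto
      then show ?thesis using aY(1) j by linarith
    qed simp
    \<comment> \<open>Up to \<open>s + D\<close> only the edges at \<open>I\<close> can be counted,
      at most \<open>t\<close> of them. Afterwards the allowance \<open>t + j\<close> has grown by
      more than \<open>D\<close>, which pays for the overshoot caused by \<open>Y\<close>.\<close>
    show "?K + 1 \<le> t + j"
    proof (cases "j \<le> D")
      case True
      then show ?thesis using KI[of "s + j"] a(2) j by linarith
    next
      case False
      have "{e \<in> avoiding. sum w e < s + j} \<subseteq> ?TJ" using notJ j by force
      then have "?K \<le> card ?TJ" using card_mono[OF fTI(2)] by blast
      then show ?thesis using aY(2) False by linarith
    qed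
  qed
qed

end

section \<open>Degree sums, and missing edges supplied by vertices of small degree\<close>

lemma sum_degree:
  assumes "finite E" "finite X"
  shows "(\<Sum>v\<in>X. degree E v) = (\<Sum>e\<in>E. card (e \<inter> X))"
proof -
  have "(\<Sum>v\<in>X. degree E v) = (\<Sum>v\<in>X. \<Sum>e\<in>E. if v \<in> e then 1 else 0)"
    using assms by (simp add: degree_def sum.If_cases Int_def)
  also have "\<dots> = (\<Sum>e\<in>E. \<Sum>v\<in>X. if v \<in> e then 1 else 0)" by (rule sum.swap)
  also have "\<dots> = (\<Sum>e\<in>E. card (e \<inter> X))"
    using assms by (simp add: sum.If_cases Int_def conj_commute)
  finally show ?thesis .
qed

lemma sum_degree_le:
  assumes G: "finite_simple_graph V E" and X: "X \<subseteq> V"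
  shows "(\<Sum>v\<in>X. degree E v) \<le> 2 * card E"
proof -
  note D = finite_simple_graphD[OF G]
  have "finite X" using X D(1) by (rule finite_subset)
  have "(\<Sum>e\<in>E. card (e \<inter> X)) \<le> of_nat (card E) * 2"
  proof (rule sum_bounded_above)
    fix e assume "e \<in> E"
    then show "card (e \<inter> X) \<le> 2" using card_mono[of e "e \<inter> X"] D(4,5)[of e] by auto
  qed
  then show ?thesis using sum_degree[OF D(2) \<open>finite X\<close>] by simp
qed

lemma card_edges_within:
  assumes G: "finite_simple_graph V E" and X: "finite X"
  shows "2 * card {e \<in> E. e \<subseteq> X} \<le> card X * card X"
proof -
  note D = finite_simple_graphD[OF G]
  have "card {e \<in> E. e \<subseteq> X} \<le> card {e. e \<subseteq> X \<and> card e = 2}"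
    using X D(4) by (intro card_mono) auto
  also have "\<dots> = card X choose 2" by (rule n_subsets[OF X])
  also have "\<dots> = card X * (card X - 1) div 2" by (rule choose_two)
  finally have "2 * card {e \<in> E. e \<subseteq> X} \<le> card X * (card X - 1)" by linarith
  also have "\<dots> \<le> card X * card X" by simp
  finally show ?thesis .
qed

context zero_core
begin

text \<open>Take \<open>Y\<close> of least cardinality among the sets that reach the target.
  Dropping any vertex misses the target, so the overshoot is at most one degree. Each vertex of
  \<open>Y\<close> also has a private edge, met by nothing else in \<open>I \<union> Y\<close>;
  hence every vertex of \<open>Y\<close> brings a new edge, which bounds
  \<open>card Y\<close>.\<close>

lemma touching_extension_exists:
  assumes I: "I \<subseteq> V - B0" and a: "card {e \<in> avoiding. e \<inter> I \<noteq> {}} + 1 < t"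
    and big: "t \<le> card {e \<in> avoiding. e \<inter> (I \<union> {v \<in> V - B0 - I. degree E v \<le> D}) \<noteq> {}} + 1"
  shows "\<exists>Y \<subseteq> V - B0 - I. t \<le> card {e \<in> avoiding. e \<inter> (I \<union> Y) \<noteq> {}} + 1 \<and>
    card {e \<in> avoiding. e \<inter> (I \<union> Y) \<noteq> {}} + 1 \<le> t + D \<and> card {e \<in> avoiding. e \<inter> I \<noteq> {}} + card Y \<le> t"
proof -
  define N where "N Y = card {e \<in> avoiding. e \<inter> (I \<union> Y) \<noteq> {}}" for Y
  let ?L = "{v \<in> V - B0 - I. degree E v \<le> D}"
  let ?S = "{Y \<in> Pow ?L. t \<le> N Y + 1}"
  have fL: "finite ?L" using graphD(1) by auto
  have "?L \<in> ?S" using big by (simp add: N_def)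
  then have "finite ?S" "?S \<noteq> {}" using fL by auto
  then obtain Y where Y: "Y \<in> ?S" "\<forall>Z\<in>?S. card Y \<le> card Z"
    using finite_arg_extremum(1)[of ?S card] by blast
  have YL: "Y \<subseteq> ?L" and YN: "t \<le> N Y + 1" using Y(1) by auto
  have fY: "finite Y" using YL fL by (rule finite_subset)
  have small: "N (Y - {y}) + 1 < t" if "y \<in> Y" for y
  proof (rule ccontr)
    assume "\<not> N (Y - {y}) + 1 < t"
    then have "Y - {y} \<in> ?S" using YL by auto
    then have "card Y \<le> card (Y - {y})" using Y(2) by blast
    then show False using card_Diff1_less[OF fY that] by linarith
  qed
  have N0: "N {} + 1 < t" using a by (simp add: N_def)
  have priv: "\<exists>e\<in>avoiding. e \<inter> (I \<union> Y) \<noteq> {} \<and> e \<inter> (I \<union> (Y - {y})) = {}" if "y \<in> Y" for y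
  proof (rule ccontr)
    assume "\<not> ?thesis"
    then have "{e \<in> avoiding. e \<inter> (I \<union> Y) \<noteq> {}} \<subseteq> {e \<in> avoiding. e \<inter> (I \<union> (Y - {y})) \<noteq> {}}" by blast
    then have "N Y \<le> N (Y - {y})" unfolding N_def using finite_core by (intro card_mono) auto
    then show False using small[OF that] YN by linarith
  qed
  have grow: "N {} + card Z \<le> N Z" if "Z \<subseteq> Y" for Z
    using finite_subset[OF that fY] that
  proof (induction Z rule: finite_induct)
    case empty
    then show ?case by simp
  next
    case (insert z Z)
    obtain e where e: "e \<in> avoiding" "e \<inter> (I \<union> Y) \<noteq> {}" "e \<inter> (I \<union> (Y - {z})) = {}"
      using priv[of z] insert.prems by blast
    have "{e \<in> avoiding. e \<inter> (I \<union> Z) \<noteq> {}} \<subset> {e \<in> avoiding. e \<inter> (I \<union> insert z Z) \<noteq> {}}"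
    proof
      show "{e \<in> avoiding. e \<inter> (I \<union> Z) \<noteq> {}} \<subseteq> {e \<in> avoiding. e \<inter> (I \<union> insert z Z) \<noteq> {}}" by blast
      have "e \<inter> (I \<union> Z) = {}" using e(3) insert by auto
      moreover have "e \<inter> (I \<union> insert z Z) \<noteq> {}" using e(2,3) insert.prems by auto
      ultimately show "{e \<in> avoiding. e \<inter> (I \<union> Z) \<noteq> {}} \<noteq> {e \<in> avoiding. e \<inter> (I \<union> insert z Z) \<noteq> {}}"
        using e(1) by blast
    qed
    then have "N Z < N (insert z Z)" unfolding N_def using finite_core by (intro psubset_card_mono) auto
    then show ?case using insert by simp
  qed
  have "Y \<noteq> {}" using N0 YN by auto
  then obtain y where y: "y \<in> Y" by blast
  have "card Y = Suc (card (Y - {y}))" by (rule card.remove[OF fY y])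
  then have 1: "N {} + card Y \<le> t" using grow[of "Y - {y}"] small[OF y] by auto
  have "{e \<in> avoiding. e \<inter> (I \<union> Y) \<noteq> {}} \<subseteq> {e \<in> avoiding. e \<inter> (I \<union> (Y - {y})) \<noteq> {}} \<union> {e \<in> E. y \<in> e}"
    by (auto simp: avoiding_def)
  then have "N Y \<le> card ({e \<in> avoiding. e \<inter> (I \<union> (Y - {y})) \<noteq> {}} \<union> {e \<in> E. y \<in> e})"
    unfolding N_def using finite_core graphD(2) by (intro card_mono) auto
  also have "\<dots> \<le> N (Y - {y}) + degree E y" unfolding N_def degree_def by (rule card_Un_le)
  finally have 2: "N Y + 1 \<le> t + D" using small[OF y] y YL by force
  have N00: "N {} = card {e \<in> avoiding. e \<inter> I \<noteq> {}}" by (simp add: N_def)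
  have "Y \<subseteq> V - B0 - I" using YL by auto
  then show ?thesis using 1 2 YN unfolding N00 unfolding N_def by (intro exI[of _ Y]) simp
qed

text \<open>When \<open>I\<close> meets too few avoiding edges, \<open>t\<close> is at least 2, so
  \<open>m'\<close> yields at least \<open>s + t - 2\<close> avoiding edges. At most 6001 vertices
  have degree above \<open>s / 1000\<close>, and they span fewer than 2 * 10^7 edges, a negligible
  number beside \<open>s\<close>. Enough avoiding edges thus meet \<open>I\<close> or a vertex of
  small degree, and \<open>Y\<close> can be chosen among the latter.\<close>

lemma weighting_of_sparse_neighbours:
  assumes s: "10000000000 \<le> s"
    and m: "card E \<le> 3 * s + 1" and t: "card touching + t = 2 * s + 1"
    and m': "3 * s \<le> card E + 1 \<or> t \<le> 1"
    and I: "I \<subseteq> V - B0"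
    and e0: "card core_edges \<le> 1"
    and cm1: "\<And>u. u \<in> V - B0 \<Longrightarrow> mult u \<le> cm" and cm0: "\<And>u. u \<in> I \<Longrightarrow> 1 \<le> mult u" and cm2: "1 \<le> cm" "cm \<le> 2"
    and C: "s + cm \<le> sum mult I" "sum mult I \<le> s + 2 * cm"
    and inn: "card (inner I) + cm \<le> t + card core_edges + 1" and innt: "card (inner I) \<le> t"
    and b: "\<And>u. u \<in> I \<Longrightarrow> card (outs I u) + card (inner I) \<le> s + 1"
    and t1: "1000 * t \<le> 498 * s" and t2: "cm = 2 \<Longrightarrow> 1000 * t \<le> 331 * s"
  shows "\<exists>w'. edge_irregular_total_weighting V E (Suc s) w'"
proof (cases "t \<le> card {e \<in> avoiding. e \<inter> I \<noteq> {}} + 1")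
  case True
  show ?thesis
  proof (rule weighting_of_ratio_order[OF m t I _ C inn _ b])
    show "2 * (s div 2) \<le> s" by simp
    show "t \<le> s div 2" using t1 by linarith
    show "card (inner I) + card core_edges + 2 * cm \<le> s div 2 + 1" using t1 inn e0 cm2 s by linarith
    show "1 \<le> mult u \<and> mult u \<le> cm" if "u \<in> I" for u using cm1[of u] cm0[OF that] I that by auto
  qed (use C inn innt True in simp_all)
next
  case False
  define D where "D = s div 1000"
  define X where "X = {v \<in> V. D < degree E v}"
  let ?J = "I \<union> {v \<in> V - B0 - I. degree E v \<le> D}"
  have D: "s \<le> 1000 * D + 999" "1000 * D \<le> s" unfolding D_def by linarith+
  have "card X * Suc D \<le> (\<Sum>v\<in>X. degree E v)"
    using sum_bounded_below[of X "Suc D" "degree E"] by (auto simp: X_def)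
  also have "\<dots> \<le> 2 * card E" by (rule sum_degree_le[OF graph]) (auto simp: X_def)
  finally have k: "card X * Suc D \<le> 6 * s + 2" using m by linarith
  have k2: "card X \<le> 6001"
  proof (rule ccontr)
    assume "\<not> card X \<le> 6001"
    then have "6002 * Suc D \<le> card X * Suc D" by (intro mult_right_mono) auto
    then have "6002 * Suc D \<le> 6 * s + 2" using k by (rule le_trans)
    then have "6002 * D + 6002 \<le> 6 * s + 2" by simp
    then show False using D s by linarith
  qed
  have fX: "finite X" using graphD(1) by (auto simp: X_def)
  have "avoiding \<subseteq> {e \<in> avoiding. e \<inter> ?J \<noteq> {}} \<union> {e \<in> E. e \<subseteq> X}"
  proof
    fix e assume e: "e \<in> avoiding"
    show "e \<in> {e \<in> avoiding. e \<inter> ?J \<noteq> {}} \<union> {e \<in> E. e \<subseteq> X}"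
    proof (cases "e \<inter> ?J = {}")
      case True
      then have "e \<subseteq> X" using avoidingD(2)[OF e] by (auto simp: X_def)
      then show ?thesis using avoidingD(1)[OF e] by auto
    qed (use e in auto)
  qed
  then have "card avoiding \<le> card ({e \<in> avoiding. e \<inter> ?J \<noteq> {}} \<union> {e \<in> E. e \<subseteq> X})"
    using finite_core graphD(2) by (intro card_mono) auto
  also have "\<dots> \<le> card {e \<in> avoiding. e \<inter> ?J \<noteq> {}} + card {e \<in> E. e \<subseteq> X}" by (rule card_Un_le)
  finally have "card avoiding \<le> card {e \<in> avoiding. e \<inter> ?J \<noteq> {}} + card {e \<in> E. e \<subseteq> X}" .
  moreover have "2 * card {e \<in> E. e \<subseteq> X} \<le> 6001 * 6001"
    using card_edges_within[OF graph fX] mult_mono[OF k2 k2] by linarith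
  moreover have "s + t \<le> card avoiding + 2" using m' card_split t False by linarith
  ultimately have "t \<le> card {e \<in> avoiding. e \<inter> ?J \<noteq> {}} + 1" using s by linarith
  then obtain Y where Y: "Y \<subseteq> V - B0 - I" "t \<le> card {e \<in> avoiding. e \<inter> (I \<union> Y) \<noteq> {}} + 1"
    "card {e \<in> avoiding. e \<inter> (I \<union> Y) \<noteq> {}} + 1 \<le> t + D" "card {e \<in> avoiding. e \<inter> I \<noteq> {}} + card Y \<le> t"
    using touching_extension_exists[OF I, of t D] False by auto
  define a where "a = card {e \<in> avoiding. e \<inter> I \<noteq> {}}"
  have aY: "a + card Y \<le> t" using Y(4) by (simp add: a_def)
  \<comment> \<open>\<open>y0\<close> must exceed \<open>(s + D) / 2\<close>, stay below
    \<open>s - t\<close>, and exceed \<open>cm * card Y + a\<close>, which is at most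
    \<open>cm * t\<close>, each up to a small constant. For \<open>cm = 1\<close> a value just above
    \<open>s / 2\<close> works. For \<open>cm = 2\<close> the window from \<open>2 * t\<close> to
    \<open>s - t\<close> contains two thirds of \<open>s\<close> because \<open>t\<close> is below
    \<open>s / 3\<close>.\<close>
  define y0 where "y0 = (if cm = 1 then s div 2 + D else 2 * s div 3)"
  show ?thesis
  proof (rule weighting_of_ratio_order_extended[OF m t I Y(1) _ _ C(2) a_def[symmetric] _ Y(2,3)])
    show "2 * (s div 2) \<le> s" by simp
    show "a \<le> t" using aY by simp
    show "t + card core_edges + 2 * cm \<le> s div 2 + 1" using t1 e0 cm2 s by linarith
    show "s div 2 \<le> y0" by (auto simp: y0_def)
    show "y0 \<le> s" using D s by (auto simp: y0_def)
    show "s + D + 1 \<le> 2 * y0" using D s by (auto simp: y0_def)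
    show "y0 + t \<le> s + 1" using D s t1 t2 cm2 by (auto simp: y0_def)
    show "card core_edges + 2 * cm + cm * card Y + a \<le> y0"
    proof (cases "cm = 1")
      case True
      then show ?thesis using aY e0 t1 D s by (simp add: y0_def)
    next
      case False
      then have "cm = 2" using cm2 by simp
      then show ?thesis using aY e0 t2 s by (simp add: y0_def)
    qed
    show "s \<le> sum mult I" using C(1) by simp
    show "mult u \<le> cm" if "u \<in> I \<union> Y" for u using cm1[of u] that I Y(1) by auto
  qed
qed

end

section \<open>A vertex of large degree\<close>

text \<open>As long as an edge is left, the next vertex is taken from it and removes at least that
  edge. Once none is left, arbitrary vertices fill up the size, and the truncated difference is
  harmless.\<close>

lemma hitting_set_greedy:
  fixes U :: "'a set" and M :: "'a set set"
  assumes U: "finite U" and M: "finite M" "\<And>e. e \<in> M \<Longrightarrow> e \<subseteq> U" "\<And>e. e \<in> M \<Longrightarrow> e \<noteq> {}"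
  shows "j \<le> card U \<Longrightarrow> \<exists>W \<subseteq> U. card W = j \<and> card {e \<in> M. e \<inter> W = {}} \<le> card M - j"
proof (induction j)
  case 0
  show ?case using M(1) by (intro exI[of _ "{}"]) (auto intro!: card_mono)
next
  case (Suc j)
  then obtain W where W: "W \<subseteq> U" "card W = j" "card {e \<in> M. e \<inter> W = {}} \<le> card M - j" by auto
  have fW: "finite W" using W(1) U by (rule finite_subset)
  show ?case
  proof (cases "{e \<in> M. e \<inter> W = {}} = {}")
    case True
    have "W \<noteq> U" using W(2) Suc.prems by auto
    then obtain v where v: "v \<in> U" "v \<notin> W" using W(1) by blast
    have "{e \<in> M. e \<inter> insert v W = {}} = {}" using True by blast
    then have "card {e \<in> M. e \<inter> insert v W = {}} \<le> card M - Suc j" by (metis card.empty le0)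
    then show ?thesis using v W fW by (intro exI[of _ "insert v W"] conjI) auto
  next
    case False
    then obtain e where e: "e \<in> M" "e \<inter> W = {}" by blast
    then obtain v where v: "v \<in> e" using M(3) by blast
    have "{e \<in> M. e \<inter> insert v W = {}} \<subset> {e \<in> M. e \<inter> W = {}}" using e v by blast
    then have "card {e \<in> M. e \<inter> insert v W = {}} < card {e \<in> M. e \<inter> W = {}}"
      using M(1) by (intro psubset_card_mono) auto
    moreover have "v \<in> U" "v \<notin> W" using e v M(2) by auto
    ultimately show ?thesis using W fW by (intro exI[of _ "insert v W"]) auto
  qed
qed

text \<open>Up to \<open>s + t\<close> edges have to shrink to \<open>t\<close>, although only
  \<open>s - t\<close> vertices may be deleted. A vertex on two edges pays double. When no such
  vertex is left, the edges form a matching on the remaining vertices, and there are too few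
  vertices for a large one. Vertices of degree above \<open>s / 2\<close> are deleted in any case,
  to bound the degrees in \<open>I\<close>.\<close>

lemma sparse_subset_exists:
  fixes N :: "'a set" and H :: "'a set set"
  assumes H: "finite H" "\<And>e. e \<in> H \<Longrightarrow> card e = 2" "card H \<le> s + t"
    and N: "finite N" "card N + t = 2 * s + 1"
    and t: "1000 * t \<le> 498 * s" and s: "100 \<le> s"
  shows "\<exists>I \<subseteq> N. card I = s + 1 \<and> card {e \<in> H. e \<subseteq> I} \<le> t \<and> (\<forall>u\<in>I. 2 * degree H u \<le> s)"
proof -
  define X where "X = {u \<in> N. s < 2 * degree H u}"
  define av where "av Z = {e \<in> H. e \<inter> Z = {}}" for Z
  have fav: "finite (av Z)" for Z using H(1) by (simp add: av_def)
  have fX: "finite X" using N(1) by (simp add: X_def)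
  have int2: "card (e \<inter> Y) \<le> 2" if "e \<in> H" for e Y
    using H(2)[OF that] card_mono[of e "e \<inter> Y"] by (simp add: card_ge_0_finite)
  have X6: "card X \<le> 6"
  proof (rule ccontr)
    assume *: "\<not> card X \<le> 6"
    have "of_nat (card X) * (s + 1) \<le> (\<Sum>v\<in>X. 2 * degree H v)"
      by (rule sum_bounded_below) (auto simp: X_def)
    also have "\<dots> = 2 * (\<Sum>e\<in>H. card (e \<inter> X))"
      using sum_degree[OF H(1) fX] by (simp flip: sum_distrib_left)
    also have "(\<Sum>e\<in>H. card (e \<inter> X)) \<le> of_nat (card H) * 2"
      by (rule sum_bounded_above) (rule int2)
    finally have "card X * (s + 1) \<le> 4 * (s + t)" using H(3) by simp
    moreover have "7 * (s + 1) \<le> card X * (s + 1)" using * by (intro mult_right_mono) auto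
    ultimately have "7 * (s + 1) \<le> 4 * (s + t)" by (meson le_trans)
    then show False using t s by simp
  qed
  define r where "r = s - t"
  have r: "r + t = s" using t by (simp add: r_def)
  \<comment> \<open>Delete vertices of degree at least 2 as long as possible; the rest is a matching.\<close>
  let ?S = "{Z \<in> Pow N. X \<subseteq> Z \<and> card Z \<le> r \<and> card (av Z) + 2 * card Z \<le> s + t}"
  \<comment> \<open>Deleting \<open>X\<close> costs at most 6 vertices; if it is nonempty, one of
    its vertices alone removes more than \<open>s / 2\<close> edges, far more than the 12 that are
    required.\<close>
  have "X \<in> ?S"
  proof -
    have "card (av X) + 2 * card X \<le> s + t"
    proof (cases "X = {}")
      case True then show ?thesis using H(3) by (simp add: av_def)
    next
      case False
      then obtain x where x: "x \<in> X" by blast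
      have "card (av X \<union> {e \<in> H. x \<in> e}) = card (av X) + card {e \<in> H. x \<in> e}"
        using x H(1) by (intro card_Un_disjoint) (auto simp: av_def)
      moreover have "card (av X \<union> {e \<in> H. x \<in> e}) \<le> card H"
        using H(1) by (intro card_mono) (auto simp: av_def)
      moreover have "s < 2 * card {e \<in> H. x \<in> e}" using x by (simp add: X_def degree_def)
      ultimately show ?thesis using H(3) X6 s by linarith
    qed
    then show ?thesis using X6 r t s by (auto simp: X_def)
  qed
  then have "finite ?S" "?S \<noteq> {}" using N(1) by auto
  then obtain Z where Z: "Z \<in> ?S" "\<forall>Z'\<in>?S. card Z' \<le> card Z"
    using finite_arg_extremum(2)[of ?S card] by blast
  have ZN: "Z \<subseteq> N" "X \<subseteq> Z" "card Z \<le> r" "card (av Z) + 2 * card Z \<le> s + t" using Z(1) by auto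
  have fZ: "finite Z" using ZN(1) N(1) by (rule finite_subset)
  define U where "U = N - Z"
  have fU: "finite U" using N(1) by (simp add: U_def)
  have cU: "card U + card Z = card N" using ZN(1) N(1) fZ
    by (simp add: U_def card_Diff_subset card_mono)
  define M where "M = {e \<in> av Z. e \<subseteq> U}"
  have fM: "finite M" using fav by (simp add: M_def)
  have M2: "card e = 2" if "e \<in> M" for e using that H(2) by (auto simp: M_def av_def)
  have "card M \<le> card (av Z)" using fav by (intro card_mono) (auto simp: M_def)
  then have q1: "card M + 2 * card Z \<le> s + t" using ZN(4) by simp
  have "\<exists>W \<subseteq> U. card W = r - card Z \<and> card {e \<in> M. e \<inter> W = {}} \<le> card M - (r - card Z)"
  proof (rule hitting_set_greedy[OF fU fM])
    show "r - card Z \<le> card U" using cU N(2) r by linarith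
    show "e \<noteq> {}" if "e \<in> M" for e using M2[OF that] by auto
  qed (auto simp: M_def)
  then obtain W where W: "W \<subseteq> U" "card W = r - card Z"
    "card {e \<in> M. e \<inter> W = {}} \<le> card M - (r - card Z)" by blast
  have bound: "card M - (r - card Z) \<le> t"
  proof (cases "card Z = r")
    case True
    \<comment> \<open>All deletions were double: \<open>card M\<close> is at most
      \<open>s + t - 2 * (s - t) = 3 * t - s\<close>, which is at most \<open>t\<close>.\<close>
    then show ?thesis using q1 r t by linarith
  next
    case False
    have deg1: "degree M v \<le> 1" if v: "v \<in> U" for v
    proof (rule ccontr)
      assume "\<not> degree M v \<le> 1"
      then have d: "2 \<le> card {e \<in> M. v \<in> e}" by (simp add: degree_def)
      have "card (av (insert v Z) \<union> {e \<in> M. v \<in> e}) = card (av (insert v Z)) + card {e \<in> M. v \<in> e}"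
        by (rule card_Un_disjoint[OF fav]) (use fM in \<open>auto simp: av_def\<close>)
      moreover have "card (av (insert v Z) \<union> {e \<in> M. v \<in> e}) \<le> card (av Z)"
        using fav by (intro card_mono) (auto simp: av_def M_def)
      moreover have "card (insert v Z) = Suc (card Z)" using v fZ by (simp add: U_def)
      ultimately have "insert v Z \<in> ?S" using ZN False d v by (auto simp: U_def)
      then have "card (insert v Z) \<le> card Z" using Z(2) by blast
      then show False using \<open>card (insert v Z) = Suc (card Z)\<close> by simp
    qed
    have "(\<Sum>v\<in>U. degree M v) \<le> of_nat (card U) * 1"
      by (rule sum_bounded_above) (rule deg1)
    moreover have "(\<Sum>v\<in>U. degree M v) = (\<Sum>e\<in>M. card (e \<inter> U))" by (rule sum_degree[OF fM fU])
    moreover have "(\<Sum>e\<in>M. card (e \<inter> U)) = (\<Sum>e\<in>M. 2)"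
      using M2 by (intro sum.cong) (auto simp: M_def inf_absorb1)
    ultimately have "2 * card M \<le> card U" by simp
    \<comment> \<open>Adding \<open>2 * card M \<le> 2 * s + 1 - t - card Z\<close> and
      \<open>card M + 2 * card Z \<le> s + t\<close> gives
      \<open>3 * (card M + card Z) \<le> 3 * s + 1\<close>. By integrality
      \<open>card M + card Z \<le> s\<close>, exactly what is needed.\<close>
    then show ?thesis using q1 cU N(2) r ZN(3) by linarith
  qed
  define I where "I = U - W"
  have fW: "finite W" using W(1) fU by (rule finite_subset)
  have "card I + card W = card U" using W(1) fU fW by (simp add: I_def card_Diff_subset card_mono)
  then have cI: "card I = s + 1" using W(2) cU N(2) ZN(3) r by linarith
  have "{e \<in> H. e \<subseteq> I} \<subseteq> {e \<in> M. e \<inter> W = {}}"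
    by (auto simp: I_def M_def av_def U_def)
  then have "card {e \<in> H. e \<subseteq> I} \<le> card {e \<in> M. e \<inter> W = {}}" using fM by (intro card_mono) auto
  then have "card {e \<in> H. e \<subseteq> I} \<le> t" using W(3) bound by linarith
  moreover have "\<forall>u\<in>I. 2 * degree H u \<le> s" using ZN(2) by (auto simp: I_def U_def X_def not_less)
  moreover have "I \<subseteq> N" by (auto simp: I_def U_def)
  ultimately show ?thesis using cI by blast
qed

text \<open>The core is \<open>b\<close> alone, its neighbours have multiplicity 1, and
  \<open>t = 2 * s + 1 - degree E b\<close> is at most \<open>0.496 * s + 1\<close>. The alternative
  \<open>2 * s \<le> degree E b\<close> serves graphs in which the degree determines
  \<open>s\<close> and the edges may be far fewer than \<open>3 * s\<close>; then
  \<open>t \<le> 1\<close>.\<close>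

lemma weighting_star:
  assumes G: "finite_simple_graph V E" and b: "b \<in> V"
    and s: "10000000000 \<le> s" and m: "card E \<le> 3 * s + 1"
    and m': "3 * s \<le> card E + 1 \<or> 2 * s \<le> degree E b"
    and d: "degree E b \<le> 2 * s + 1" "1504 * s \<le> 1000 * degree E b"
  shows "\<exists>w'. edge_irregular_total_weighting V E (Suc s) w'"
proof -
  interpret zero_core V E "{b}" by unfold_locales (use G b in auto)
  have core: "core_edges = {}"
  proof -
    have "\<not> e \<subseteq> {b}" if "e \<in> E" for e
      using graphD(4)[OF that] card_mono[of "{b}" e] by auto
    then show ?thesis by (auto simp: core_edges_def)
  qed
  have T: "card touching = degree E b" 
  proof -
    have "touching = {e \<in> E. b \<in> e}" by (auto simp: touching_def)
    then show ?thesis by (simp add: degree_def)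
  qed
  define N where "N = {u \<in> V - {b}. {b, u} \<in> E}"
  have mult: "mult u = (if {b, u} \<in> E then 1 else 0)" for u
    by (simp add: mult_def) (auto simp: card_1_singleton_iff)
  have fN: "finite N" using graphD(1) by (simp add: N_def)
  have "(\<Sum>u\<in>V - {b}. mult u) = card N"
    using graphD(1) by (simp add: mult sum.If_cases N_def Int_def)
  then have cN: "card N = degree E b" using card_touching core T by simp
  define t where "t = 2 * s + 1 - degree E b"
  have t: "card N + t = 2 * s + 1" "card touching + t = 2 * s + 1" using d(1) cN T by (auto simp: t_def)
  have t1: "1000 * t \<le> 498 * s" using d(2) t(1) cN s by linarith
  have av: "card avoiding \<le> s + t" using card_split m t(2) by linarith
  obtain I where I: "I \<subseteq> N" "card I = s + 1" "card {e \<in> avoiding. e \<subseteq> I} \<le> t"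
    "\<forall>u\<in>I. 2 * degree avoiding u \<le> s"
    using sparse_subset_exists[OF finite_core(2) avoidingD(3) av fN t(1) t1] s by auto
  have IV: "I \<subseteq> V - {b}" using I(1) by (auto simp: N_def)
  have mI: "mult u = 1" if "u \<in> I" for u using that I(1) by (auto simp: mult N_def)
  have sI: "sum mult I = s + 1" using mI I(2) by simp
  have inn: "card (inner I) \<le> t" using I(3) by (simp add: inner_def)
  show ?thesis
  proof (rule weighting_of_sparse_neighbours[OF s m t(2) _ IV, of 1])
    show "3 * s \<le> card E + 1 \<or> t \<le> 1" using m' t(2) T by linarith
    show "card (outs I u) + card (inner I) \<le> s + 1" if "u \<in> I" for u
    proof -
      have "card (outs I u) \<le> degree avoiding u"
        unfolding degree_def outs_def using finite_core by (intro card_mono) auto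
      then show ?thesis using bspec[OF I(4) that] inn t1 by linarith
    qed
  qed (use core mI sI inn t1 in \<open>auto simp: mult\<close>)
qed

section \<open>Three vertices with large cuts\<close>

text \<open>The shortest prefix of the ratio order whose \<open>c\<close>-mass reaches
  \<open>q\<close>; its last element overshoots by less than \<open>k\<close>.\<close>

lemma ratio_prefix_exists:
  fixes c b :: "'b \<Rightarrow> nat"
  assumes N: "finite N" and c: "\<And>u. u \<in> N \<Longrightarrow> 1 \<le> c u \<and> c u \<le> k" and q: "1 \<le> q" "q \<le> sum c N"
  shows "\<exists>I \<subseteq> N. q \<le> sum c I \<and> sum c I < q + k \<and> sum b I * sum c N \<le> sum b N * sum c I"
proof -
  have "\<exists>ps :: 'b \<Rightarrow> nat. inj_on ps N \<and>
    (\<forall>u\<in>N. (\<Sum>v | v \<in> N \<and> ps v \<le> ps u. b v) * sum c N \<le> sum b N * (\<Sum>v | v \<in> N \<and> ps v \<le> ps u. c v))"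
    by (rule ratio_order_exists[OF N]) (use c in force)
  then obtain ps :: "'b \<Rightarrow> nat" where inj: "inj_on ps N" and
    ratio: "\<forall>u\<in>N. (\<Sum>v | v \<in> N \<and> ps v \<le> ps u. b v) * sum c N \<le> sum b N * (\<Sum>v | v \<in> N \<and> ps v \<le> ps u. c v)"
    by blast
  define upt where "upt u = {v \<in> N. ps v \<le> ps u}" for u
  have fin: "finite (upt u)" for u using N by (simp add: upt_def)
  have "N \<noteq> {}" using q by auto
  then obtain z where z: "z \<in> N" "\<forall>v\<in>N. ps v \<le> ps z"
    using finite_arg_extremum(2)[OF N, of ps] by blast
  have "upt z = N" using z by (auto simp: upt_def)
  then have "z \<in> {u \<in> N. q \<le> sum c (upt u)}" using z q by simp
  then have "{u \<in> N. q \<le> sum c (upt u)} \<noteq> {}" "finite {u \<in> N. q \<le> sum c (upt u)}" using N by auto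
  then obtain u where "u \<in> {u \<in> N. q \<le> sum c (upt u)}" and
    umin: "\<forall>v\<in>{u \<in> N. q \<le> sum c (upt u)}. ps u \<le> ps v"
    using finite_arg_extremum(1)[of "{u \<in> N. q \<le> sum c (upt u)}" ps] by blast
  then have u: "u \<in> N" "q \<le> sum c (upt u)" by auto
  have ins: "upt u = insert u {v \<in> N. ps v < ps u}"
    using u(1) inj by (auto simp: upt_def inj_on_def le_less)
  have pre: "sum c {v \<in> N. ps v < ps u} < q"
  proof (cases "{v \<in> N. ps v < ps u} = {}")
    case True
    then show ?thesis unfolding True using q by simp
  next
    case False
    have "finite {v \<in> N. ps v < ps u}" using N by simp
    then obtain y where y: "y \<in> {v \<in> N. ps v < ps u}" "\<forall>v\<in>{v \<in> N. ps v < ps u}. ps v \<le> ps y"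
      using finite_arg_extremum(2)[OF _ False, of ps] by blast
    have "upt y = {v \<in> N. ps v < ps u}" using y by (auto simp: upt_def)
    moreover have "\<not> q \<le> sum c (upt y)" using umin y(1) by force
    ultimately show ?thesis by simp
  qed
  have "sum c (upt u) = c u + sum c {v \<in> N. ps v < ps u}"
    unfolding ins using N by (subst sum.insert) auto
  then have "sum c (upt u) < q + k" using pre c[OF u(1)] by linarith
  moreover have "upt u \<subseteq> N" by (auto simp: upt_def)
  moreover have "sum b (upt u) * sum c N \<le> sum b N * sum c (upt u)"
    using ratio u(1) by (simp add: upt_def)
  ultimately show ?thesis using u(2) by blast
qed

definition cut :: "'a set set \<Rightarrow> 'a \<Rightarrow> 'a \<Rightarrow> nat" where
  "cut E x y = card {e \<in> E. (x \<in> e) \<noteq> (y \<in> e)}"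

lemma cut_commute: "cut E x y = cut E y x"
  by (auto simp: cut_def intro: arg_cong[where f = card])

text \<open>The core is the pair with the smallest cut. Then
  \<open>2 * card O3 + 3 * cut E b1 b2 \<le> 2 * card E\<close> leaves at most 3/2 of
  \<open>tau\<close> edges off the triple. \<open>I\<close> takes about \<open>s\<close> of the at
  least \<open>1.67 * s - 2\<close> units of multiplicity, a fraction below 2/3, with least degree
  in \<open>O3\<close> per unit, so it spans fewer than \<open>tau\<close> edges. Leaving
  \<open>b3\<close> out of \<open>I\<close> makes its inner edges avoid the whole triple.\<close>

lemma weighting_triple_min:
  assumes G: "finite_simple_graph V E" and bV: "b1 \<in> V" "b2 \<in> V" "b3 \<in> V"
    and ne: "b1 \<noteq> b2" "b1 \<noteq> b3" "b2 \<noteq> b3"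
    and s: "10000000000 \<le> s" and m: "card E \<le> 3 * s + 1" and m': "3 * s \<le> card E + 1"
    and x: "1670 * s \<le> 1000 * cut E b1 b2" "cut E b1 b2 \<le> cut E b1 b3" "cut E b1 b2 \<le> cut E b2 b3"
  shows "\<exists>w'. edge_irregular_total_weighting V E (Suc s) w'"
proof -
  interpret zero_core V E "{b1, b2}" by unfold_locales (use G bV in auto)
  define O3 where "O3 = {e \<in> E. e \<inter> {b1, b2, b3} = {}}"
  have fO: "finite O3" using graphD(2) by (simp add: O3_def)
  have O2: "card e = 2" if "e \<in> O3" for e using that graphD(4) by (auto simp: O3_def)
  have "{e \<in> E. e \<subseteq> {b1, b2}} \<subseteq> {{b1, b2}}"
  proof
    fix e assume e: "e \<in> {e \<in> E. e \<subseteq> {b1, b2}}"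
    then have "card e = card {b1, b2}" using graphD(4) ne by auto
    then show "e \<in> {{b1, b2}}" using e card_subset_eq[of "{b1, b2}" e] by auto
  qed
  then have e0: "card core_edges \<le> 1"
    unfolding core_edges_def using card_mono[of "{{b1, b2}}"] by fastforce
  have T: "card touching = cut E b1 b2 + card core_edges"
  proof -
    have sub: "{b1, b2} = e" if "e \<in> E" "b1 \<in> e" "b2 \<in> e" for e
      using edge_pair[OF that(1) that(2,3) ne(1)] by simp
    have nsub: "\<not> e \<subseteq> {b}" if "e \<in> E" for e b
      using graphD(4)[OF that] card_mono[of "{b}" e] by auto
    have 1: "touching = {e \<in> E. (b1 \<in> e) \<noteq> (b2 \<in> e)} \<union> core_edges"
    proof (intro equalityI subsetI)
      fix e assume e: "e \<in> touching"
      then have eE: "e \<in> E" by (simp add: touching_def)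
      show "e \<in> {e \<in> E. (b1 \<in> e) \<noteq> (b2 \<in> e)} \<union> core_edges"
      proof (cases "b1 \<in> e \<and> b2 \<in> e")
        case True
        then have "e \<subseteq> {b1, b2}" using sub[OF eE] by auto
        then show ?thesis using eE by (simp add: core_edges_def)
      next
        case False then show ?thesis using e by (auto simp: touching_def)
      qed
    next
      fix e assume e: "e \<in> {e \<in> E. (b1 \<in> e) \<noteq> (b2 \<in> e)} \<union> core_edges"
      then have eE: "e \<in> E" by (auto simp: core_edges_def)
      have "e \<noteq> {}" using graphD(4)[OF eE] by auto
      then show "e \<in> touching" using e by (auto simp: touching_def core_edges_def)
    qed
    have "{e \<in> E. (b1 \<in> e) \<noteq> (b2 \<in> e)} \<inter> core_edges = {}"
    proof -
      have False if "e \<in> E" "e \<subseteq> {b1, b2}" "(b1 \<in> e) \<noteq> (b2 \<in> e)" for e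
        using nsub[OF that(1), of b1] nsub[OF that(1), of b2] that by auto
      then show ?thesis by (auto simp: core_edges_def)
    qed
    then show ?thesis unfolding 1 cut_def using graphD(2) finite_core by (intro card_Un_disjoint) auto
  qed
  \<comment> \<open>An edge that meets the triple lies in exactly two of the three cuts.\<close>
  have OX: "2 * card O3 + 3 * cut E b1 b2 \<le> 2 * card E"
  proof -
    have ind: "card {e \<in> E. P e} = (\<Sum>e\<in>E. of_bool (P e))" for P
      using graphD(2) by (simp add: of_bool_def sum.If_cases Int_def)
    have "2 * card O3 + (cut E b1 b2 + cut E b1 b3 + cut E b2 b3) =
      (\<Sum>e\<in>E. 2 * of_bool (e \<inter> {b1, b2, b3} = {}) + (of_bool ((b1 \<in> e) \<noteq> (b2 \<in> e)) +
         of_bool ((b1 \<in> e) \<noteq> (b3 \<in> e)) + of_bool ((b2 \<in> e) \<noteq> (b3 \<in> e))))"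
      unfolding O3_def cut_def ind by (simp only: sum.distrib sum_distrib_left)
    also have "\<dots> \<le> of_nat (card E) * 2"
      by (rule sum_bounded_above) (auto simp: of_bool_def)
    finally show ?thesis using x by simp
  qed
  define tau where "tau = 2 * s + 1 - cut E b1 b2"
  have tau: "cut E b1 b2 + tau = 2 * s + 1" "1 \<le> tau" using OX m by (auto simp: tau_def)
  have tau1: "1000 * tau \<le> 330 * s + 1000" using tau(1) x(1) by linarith
  have O: "2 * card O3 + 1 \<le> 3 * tau" using OX m tau(1) by linarith
  define t where "t = tau - card core_edges"
  have t: "t + card core_edges = tau" using e0 tau(2) by (simp add: t_def)
  have Tt: "card touching + t = 2 * s + 1" using T t tau(1) by linarith
  have mult2: "mult u \<le> 2" for u
  proof -
    have "mult u \<le> card {b1, b2}" unfolding mult_def by (intro card_mono) auto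
    then show ?thesis using ne by simp
  qed
  define N where "N = {u \<in> V - {b1, b2, b3}. 1 \<le> mult u}"
  have fN: "finite N" using graphD(1) by (simp add: N_def)
  have cN: "cut E b1 b2 \<le> sum mult N + 2"
  proof -
    have "cut E b1 b2 = (\<Sum>u\<in>V - {b1, b2}. mult u)" using T card_touching by simp
    also have "\<dots> = mult b3 + (\<Sum>u\<in>V - {b1, b2} - {b3}. mult u)"
      using graphD(1) bV ne by (intro sum.remove) auto
    also have "(\<Sum>u\<in>V - {b1, b2} - {b3}. mult u) = sum mult N"
      using graphD(1) by (intro sum.mono_neutral_right) (auto simp: N_def)
    finally show ?thesis using mult2[of b3] by linarith
  qed
  have "\<exists>I \<subseteq> N. s + 2 \<le> sum mult I \<and> sum mult I < s + 2 + 2 \<and>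
    sum (degree O3) I * sum mult N \<le> sum (degree O3) N * sum mult I"
    by (rule ratio_prefix_exists[OF fN]) (use mult2 cN x(1) s in \<open>auto simp: N_def\<close>)
  then obtain I where I: "I \<subseteq> N" "s + 2 \<le> sum mult I" "sum mult I < s + 2 + 2"
    "sum (degree O3) I * sum mult N \<le> sum (degree O3) N * sum mult I" by blast
  have fI: "finite I" using I(1) fN by (rule finite_subset)
  have IV: "I \<subseteq> V - {b1, b2}" using I(1) by (auto simp: N_def)
  have b3I: "b3 \<notin> I" using I(1) by (auto simp: N_def)
  have innO: "inner I = {e \<in> O3. e \<subseteq> I}"
    using b3I by (auto simp: inner_def avoiding_def O3_def)
  have inn2: "2 * card (inner I) \<le> sum (degree O3) I"
  proof -
    have "(\<Sum>e\<in>inner I. 2) = (\<Sum>e\<in>inner I. card (e \<inter> I))"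
      unfolding innO using O2 by (intro sum.cong) (auto simp: inf_absorb1)
    also have "\<dots> \<le> (\<Sum>e\<in>O3. card (e \<inter> I))"
      unfolding innO using fO by (intro sum_mono2) auto
    also have "\<dots> = sum (degree O3) I" by (rule sum_degree[OF fO fI, symmetric])
    finally show ?thesis by simp
  qed
  have degN: "sum (degree O3) N \<le> 2 * card O3"
  proof -
    have "sum (degree O3) N = (\<Sum>e\<in>O3. card (e \<inter> N))" by (rule sum_degree[OF fO fN])
    also have "\<dots> \<le> of_nat (card O3) * 2"
    proof (rule sum_bounded_above)
      fix e assume "e \<in> O3"
      then show "card (e \<inter> N) \<le> 2" using O2[of e] card_mono[of e "e \<inter> N"] by (simp add: card_ge_0_finite)
    qed
    finally show ?thesis by simp
  qed
  have inn: "card (inner I) < tau"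
  proof (rule ccontr)
    assume "\<not> card (inner I) < tau"
    then have "2 * tau * sum mult N \<le> 2 * card (inner I) * sum mult N" by simp
    also have "\<dots> \<le> sum (degree O3) I * sum mult N" using inn2 by (rule mult_right_mono) simp
    also have "\<dots> \<le> sum (degree O3) N * sum mult I" by (rule I(4))
    also have "\<dots> \<le> (2 * card O3) * (s + 3)" using degN I(3) by (intro mult_mono) auto
    also have "\<dots> \<le> 3 * tau * (s + 3)" using O by (intro mult_right_mono) auto
    finally have "tau * (2 * sum mult N) \<le> tau * (3 * (s + 3))" by (simp add: algebra_simps)
    then have "2 * sum mult N \<le> 3 * (s + 3)" using tau(2) by simp
    then have "2 * sum mult N \<le> 3 * s + 9" by simp
    then show False using cN tau(1) tau1 s by linarith
  qed
  show ?thesis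
  proof (rule weighting_of_sparse_neighbours[OF s m Tt _ IV e0, of 2])
    show "card (inner I) + 2 \<le> t + card core_edges + 1" using inn t by linarith
    show "card (inner I) \<le> t" using inn t e0 by linarith
    show "1000 * t \<le> 498 * s" "1000 * t \<le> 331 * s" using t tau1 s by linarith+
    show "card (outs I u) + card (inner I) \<le> s + 1" if u: "u \<in> I" for u
    proof -
      have "outs I u \<subseteq> O3 \<union> {{b3, u}}"
      proof
        fix e assume "e \<in> outs I u"
        then have e: "e \<in> avoiding" "u \<in> e" by (auto simp: outs_def)
        show "e \<in> O3 \<union> {{b3, u}}"
        proof (cases "b3 \<in> e")
          case True
          have "b3 \<noteq> u" using u b3I by auto
          then have "e = {b3, u}" using edge_pair[OF avoidingD(1)[OF e(1)] True e(2)] by blast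
          then show ?thesis by blast
        next
          case False
          then show ?thesis using e(1) by (auto simp: O3_def avoiding_def)
        qed
      qed
      then have "card (outs I u) \<le> card (O3 \<union> {{b3, u}})" using fO by (intro card_mono) auto
      also have "\<dots> \<le> card O3 + card {{b3, u}}" by (rule card_Un_le)
      finally have "card (outs I u) \<le> card O3 + 1" by simp
      then show ?thesis using O inn tau1 s by linarith
    qed
  qed (use m' mult2 I N_def in auto)
qed

lemma weighting_triple:
  assumes G: "finite_simple_graph V E" and bV: "b1 \<in> V" "b2 \<in> V" "b3 \<in> V"
    and ne: "b1 \<noteq> b2" "b1 \<noteq> b3" "b2 \<noteq> b3"
    and s: "10000000000 \<le> s" and m: "card E \<le> 3 * s + 1" and m': "3 * s \<le> card E + 1"
    and x: "1670 * s \<le> 1000 * cut E b1 b2" "1670 * s \<le> 1000 * cut E b1 b3" "1670 * s \<le> 1000 * cut E b2 b3"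
  shows "\<exists>w'. edge_irregular_total_weighting V E (Suc s) w'"
proof -
  consider "cut E b1 b2 \<le> cut E b1 b3" "cut E b1 b2 \<le> cut E b2 b3"
    | "cut E b1 b3 \<le> cut E b1 b2" "cut E b1 b3 \<le> cut E b2 b3"
    | "cut E b2 b3 \<le> cut E b1 b2" "cut E b2 b3 \<le> cut E b1 b3" by linarith
  then show ?thesis
  proof cases
    case 1
    then show ?thesis by (intro weighting_triple_min[OF G bV ne s m m' x(1)])
  next
    case 2
    show ?thesis
      by (rule weighting_triple_min[OF G bV(1,3,2) ne(2,1) ne(3)[symmetric] s m m' x(2)])
        (use 2 cut_commute[of E b3 b2] in simp_all)
  next
    case 3
    show ?thesis
      by (rule weighting_triple_min[OF G bV(2,3,1) ne(3) ne(1,2)[symmetric] s m m' x(3)])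
        (use 3 cut_commute[of E b2 b1] cut_commute[of E b3 b1] in simp_all)
  qed
qed

section \<open>Rounding random levels\<close>

text \<open>Level \<open>j\<close> stands for the weight \<open>j * s / 12\<close>, rounded down.
  Between neighbouring multiples of \<open>s / 12\<close> the count of level sums is constant, so
  the lower bound is needed at the upper end of each step and the upper bound at the lower end;
  hence \<open>K + 1\<close> in \<open>lo\<close> and \<open>K\<close> in \<open>hi\<close>. The 24
  in \<open>hi\<close> pays for rounding.\<close>

lemma weighting_of_levels:
  fixes lev :: "'a \<Rightarrow> nat"
  assumes G: "finite_simple_graph V E" and s: "0 < s" and m: "card E \<le> 3 * s + 1"
    and lev: "\<And>v. v \<in> V \<Longrightarrow> lev v \<le> 12"
    and lo: "\<And>K. K < 24 \<Longrightarrow> (K + 1) * s \<le> 12 * card {e \<in> E. sum lev e \<le> K}"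
    and hi: "\<And>K. K < 24 \<Longrightarrow> 12 * card {e \<in> E. sum lev e \<le> K} + 24 \<le> 12 * s + K * s"
  shows "\<exists>w'. edge_irregular_total_weighting V E (Suc s) w'"
proof -
  note D = finite_simple_graphD[OF G]
  define w where "w v = lev v * s div 12" for v
  have w12: "12 * w v \<le> lev v * s" "lev v * s \<le> 12 * w v + 11" for v
    unfolding w_def by linarith+
  have sums: "12 * sum w e \<le> sum lev e * s" "sum lev e * s \<le> 12 * sum w e + 22" if "e \<in> E" for e
  proof -
    obtain x y where e: "e = {x, y}" "x \<noteq> y" using D(4)[OF \<open>e \<in> E\<close>] by (auto simp: card_2_iff)
    have "sum lev e * s = lev x * s + lev y * s" "sum w e = w x + w y"
      unfolding e(1) using e(2) by (simp_all add: algebra_simps)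
    then show "12 * sum w e \<le> sum lev e * s" "sum lev e * s \<le> 12 * sum w e + 22"
      using w12[of x] w12[of y] by linarith+
  qed
  have top: "sum lev e \<le> 23" if e: "e \<in> E" "sum w e < 2 * s" for e
  proof (rule ccontr)
    assume "\<not> sum lev e \<le> 23"
    obtain x y where xy: "e = {x, y}" "x \<noteq> y" using D(4)[OF e(1)] by (auto simp: card_2_iff)
    have "lev x \<le> 12" "lev y \<le> 12" using xy D(3)[OF e(1)] lev by auto
    moreover have "sum lev e = lev x + lev y" unfolding xy(1) using xy(2) by simp
    ultimately have "lev x = 12" "lev y = 12" using \<open>\<not> sum lev e \<le> 23\<close> by linarith+
    then have "w x = s" "w y = s" by (simp_all add: w_def)
    then have "sum w e = 2 * s" unfolding xy(1) using xy(2) by simp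
    then show False using e(2) by simp
  qed
  show ?thesis
  proof (rule weighting_of_counts[OF G m, of w])
    show "w v \<le> s" if "v \<in> V" for v
    proof -
      have "lev v * s \<le> 12 * s" using lev[OF that] by simp
      then show ?thesis using w12[of v] by linarith
    qed
  next
    fix i assume i: "1 \<le> i" "i \<le> 2 * s"
    let ?N = "card {e \<in> E. sum w e < i}"
    define K where "K = (12 * i - 1) div s"
    have K: "K * s \<le> 12 * i - 1" "12 * i - 1 < (K + 1) * s"
      using div_times_less_eq_dividend[of "12 * i - 1" s] dividend_less_div_times[OF s, of "12 * i - 1"]
      unfolding K_def by (simp_all add: algebra_simps)
    have "K < 24"
    proof (rule ccontr)
      assume "\<not> K < 24"
      then have "24 * s \<le> K * s" by (intro mult_right_mono) auto
      then show False using K(1) i s by linarith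
    qed
    have "{e \<in> E. sum lev e \<le> K} \<subseteq> {e \<in> E. sum w e < i}"
    proof safe
      fix e assume e: "e \<in> E" "sum lev e \<le> K"
      then have "sum lev e * s \<le> K * s" by simp
      then show "sum w e < i" using sums(1)[OF e(1)] K(1) i by linarith
    qed
    then have "card {e \<in> E. sum lev e \<le> K} \<le> ?N" using D(2) by (intro card_mono) auto
    then show "i \<le> ?N" using lo[OF \<open>K < 24\<close>] K(2) by linarith
  next
    fix i assume i: "1 \<le> i" "i \<le> 2 * s"
    let ?N = "card {e \<in> E. sum w e < i}"
    \<comment> \<open>Rounding both ends loses at most 22 twelfths, so
      \<open>sum w e \<le> i - 1\<close> gives
      \<open>sum lev e * s \<le> 12 * (i - 1) + 22\<close>.\<close>
    define K where "K = (12 * i + 10) div s"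
    have K: "K * s \<le> 12 * i + 10" "12 * i + 10 < (K + 1) * s"
      using div_times_less_eq_dividend[of "12 * i + 10" s] dividend_less_div_times[OF s, of "12 * i + 10"]
      unfolding K_def by (simp_all add: algebra_simps)
    have le: "sum lev e \<le> K" if e: "e \<in> E" "sum w e < i" for e
    proof (rule ccontr)
      assume "\<not> sum lev e \<le> K"
      then have "(K + 1) * s \<le> sum lev e * s" by (intro mult_right_mono) auto
      then show False using K(2) sums(2)[OF e(1)] e(2) by linarith
    qed
    show "?N \<le> s + i"
    proof (cases "K < 24")
      case True
      have "?N \<le> card {e \<in> E. sum lev e \<le> K}" using D(2) le by (intro card_mono) auto
      then show ?thesis using hi[OF True] K(1) by linarith
    next
      case False
      \<comment> \<open>This happens only at \<open>i = 2 * s\<close>. Two ends of level 12 have sum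
        exactly \<open>2 * s\<close> and are not counted there, so the bound for
        \<open>K = 23\<close> applies.\<close>
      then have "24 * s \<le> K * s" by (intro mult_right_mono) auto
      then have "i = 2 * s" using K(1) i by linarith
      have "?N \<le> card {e \<in> E. sum lev e \<le> 23}"
        using D(2) top unfolding \<open>i = 2 * s\<close> by (intro card_mono) auto
      then show ?thesis using hi[of 23] unfolding \<open>i = 2 * s\<close> by linarith
    qed
  qed
qed

section \<open>Laws of random levels and their derandomised rounding\<close>

definition distribution :: "nat \<Rightarrow> (nat \<Rightarrow> real) \<Rightarrow> bool" where
  "distribution n p \<longleftrightarrow> (\<forall>j. 0 \<le> p j) \<and> (\<Sum>j\<le>n. p j) = 1"

definition point :: "nat \<Rightarrow> nat \<Rightarrow> real" where
  "point i j = of_bool (j = i)"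

lemma distribution_point: "i \<le> n \<Longrightarrow> distribution n (point i)"
  by (simp add: distribution_def point_def)

lemma sum_point: "i \<le> n \<Longrightarrow> (\<Sum>j\<le>n. point i j * f j) = f i"
  by (simp add: point_def)

text \<open>Popoviciu's inequality: values within an interval of length \<open>d\<close> have
  variance at most \<open>d\<^sup>2 / 4\<close>, seen by comparison with the second moment about the
  midpoint \<open>e\<close>. The mean square about \<open>c\<close> is the variance plus the squared
  distance of the mean from \<open>c\<close>.\<close>

lemma variance_bound:
  fixes x :: "nat \<Rightarrow> real"
  assumes p: "distribution n p" and d: "\<And>j k. j \<le> n \<Longrightarrow> k \<le> n \<Longrightarrow> \<bar>x j - x k\<bar> \<le> d"
  shows "(\<Sum>j\<le>n. p j * (x j - c)\<^sup>2) \<le> ((\<Sum>j\<le>n. p j * x j) - c)\<^sup>2 + d\<^sup>2 / 4"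
proof -
  have p0: "0 \<le> p j" for j using p by (simp add: distribution_def)
  have p1: "(\<Sum>j\<le>n. p j) = 1" using p by (simp add: distribution_def)
  define a where "a = Min (x ` {..n})"
  have "a \<in> x ` {..n}" unfolding a_def by (intro Min_in) auto
  then obtain k where k: "k \<le> n" "x k = a" by auto
  have range: "a \<le> x j" "x j \<le> a + d" if "j \<le> n" for j
  proof -
    show "a \<le> x j" using that unfolding a_def by (intro Min_le) auto
    show "x j \<le> a + d" using d[OF that k(1)] k(2) by linarith
  qed
  define e where "e = a + d / 2"
  define X where "X = (\<Sum>j\<le>n. p j * x j)"
  define Q where "Q = (\<Sum>j\<le>n. p j * (x j)\<^sup>2)"
  have expand: "(\<Sum>j\<le>n. p j * (x j - y)\<^sup>2) = Q - 2 * y * X + y\<^sup>2" for y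
  proof -
    have "(\<Sum>j\<le>n. p j * (x j - y)\<^sup>2) = (\<Sum>j\<le>n. p j * (x j)\<^sup>2 - 2 * y * (p j * x j) + y\<^sup>2 * p j)"
      by (intro sum.cong) (auto simp: power2_eq_square algebra_simps)
    also have "\<dots> = Q - 2 * y * X + y\<^sup>2 * (\<Sum>j\<le>n. p j)"
      by (simp add: sum.distrib sum_subtractf sum_distrib_left Q_def X_def)
    finally show ?thesis using p1 by simp
  qed
  have "(\<Sum>j\<le>n. p j * (x j - e)\<^sup>2) \<le> (\<Sum>j\<le>n. p j * (d / 2)\<^sup>2)"
  proof (intro sum_mono mult_left_mono p0)
    fix j assume "j \<in> {..n}"
    then have "x j - e \<le> d / 2" "- (x j - e) \<le> d / 2" using range[of j] by (auto simp: e_def)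
    then have "\<bar>x j - e\<bar> \<le> d / 2" by (rule abs_leI)
    then have "\<bar>x j - e\<bar>\<^sup>2 \<le> (d / 2)\<^sup>2" by (intro power_mono) auto
    then show "(x j - e)\<^sup>2 \<le> (d / 2)\<^sup>2" by simp
  qed
  also have "\<dots> = d\<^sup>2 / 4" unfolding sum_distrib_right[symmetric] p1 by (simp add: power_divide)
  finally have "Q - 2 * e * X + e\<^sup>2 \<le> d\<^sup>2 / 4" unfolding expand .
  moreover have "0 \<le> (X - e)\<^sup>2" by simp
  ultimately show ?thesis unfolding expand X_def[symmetric] by (simp add: power2_eq_square algebra_simps)
qed

text \<open>A derandomised second moment argument: fixing the coordinates one at a time, each one can be
  chosen so that the weighted sum of squared deviations grows by no more than in expectation.\<close>

lemma greedy_rounding: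
  fixes F :: "('a \<Rightarrow> nat \<Rightarrow> real) \<Rightarrow> 'k \<Rightarrow> real"
  assumes X: "finite X" and lam: "\<And>K. K \<in> Ks \<Longrightarrow> 0 \<le> lam K"
    and mu0: "\<And>v. distribution n (mu0 v)"
    and affine: "\<And>mu v K. (\<And>u. distribution n (mu u)) \<Longrightarrow> F mu K = (\<Sum>j\<le>n. mu v j * F (mu(v := point j)) K)"
    and range: "\<And>mu v K j k. (\<And>u. distribution n (mu u)) \<Longrightarrow> j \<le> n \<Longrightarrow> k \<le> n \<Longrightarrow>
      \<bar>F (mu(v := point j)) K - F (mu(v := point k)) K\<bar> \<le> d v"
  shows "\<exists>f. (\<forall>v\<in>X. f v \<le> n) \<and>
    (\<Sum>K\<in>Ks. lam K * (F (\<lambda>v. if v \<in> X then point (f v) else mu0 v) K - F mu0 K)\<^sup>2) \<le> sum lam Ks * (\<Sum>v\<in>X. (d v)\<^sup>2) / 4"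
  using X
proof (induction X rule: finite_induct)
  case empty
  then show ?case by simp
next
  case (insert v X)
  then obtain f where f: "\<forall>v\<in>X. f v \<le> n" and
    Phi: "(\<Sum>K\<in>Ks. lam K * (F (\<lambda>v. if v \<in> X then point (f v) else mu0 v) K - F mu0 K)\<^sup>2) \<le> sum lam Ks * (\<Sum>v\<in>X. (d v)\<^sup>2) / 4"
    by blast
  define mu where "mu = (\<lambda>v. if v \<in> X then point (f v) else mu0 v)"
  define c where "c = F mu0"
  define Psi where "Psi g = (\<Sum>K\<in>Ks. lam K * (F g K - c K)\<^sup>2)" for g
  have mu: "distribution n (mu u)" for u using mu0 f distribution_point by (auto simp: mu_def)
  have p0: "0 \<le> mu v j" for j using mu[of v] by (simp add: distribution_def)
  have p1: "(\<Sum>j\<le>n. mu v j) = 1" using mu[of v] by (simp add: distribution_def)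
  have "(\<Sum>j\<le>n. mu v j * Psi (mu(v := point j))) =
    (\<Sum>K\<in>Ks. lam K * (\<Sum>j\<le>n. mu v j * (F (mu(v := point j)) K - c K)\<^sup>2))"
    unfolding Psi_def sum_distrib_left by (subst sum.swap) (simp add: algebra_simps)
  also have "\<dots> \<le> (\<Sum>K\<in>Ks. lam K * ((F mu K - c K)\<^sup>2 + (d v)\<^sup>2 / 4))"
  proof (intro sum_mono mult_left_mono lam)
    fix K assume "K \<in> Ks"
    show "(\<Sum>j\<le>n. mu v j * (F (mu(v := point j)) K - c K)\<^sup>2) \<le> (F mu K - c K)\<^sup>2 + (d v)\<^sup>2 / 4"
      unfolding affine[of mu K v, OF mu] by (rule variance_bound[OF mu range[OF mu]])
  qed
  also have "\<dots> = Psi mu + sum lam Ks * ((d v)\<^sup>2 / 4)"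
    by (simp only: Psi_def distrib_left sum.distrib sum_distrib_right)
  finally have avg: "(\<Sum>j\<le>n. mu v j * Psi (mu(v := point j))) \<le> Psi mu + sum lam Ks * ((d v)\<^sup>2 / 4)" .
  have "\<exists>j\<le>n. Psi (mu(v := point j)) \<le> Psi mu + sum lam Ks * ((d v)\<^sup>2 / 4)"
  proof (rule ccontr)
    assume "\<not> ?thesis"
    then have gt: "Psi mu + sum lam Ks * ((d v)\<^sup>2 / 4) < Psi (mu(v := point j))" if "j \<le> n" for j
      using that by force
    have "\<exists>j\<in>{..n}. 0 < mu v j"
    proof (rule ccontr)
      assume "\<not> (\<exists>j\<in>{..n}. 0 < mu v j)"
      then have "(\<Sum>j\<le>n. mu v j) \<le> 0" by (intro sum_nonpos) force
      then show False using p1 by simp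
    qed
    then obtain j where "j \<in> {..n}" "0 < mu v j" by blast
    then have "(\<Sum>j\<le>n. mu v j * (Psi mu + sum lam Ks * ((d v)\<^sup>2 / 4))) < (\<Sum>j\<le>n. mu v j * Psi (mu(v := point j)))"
    proof (intro sum_strict_mono_ex1 ballI)
      fix k assume "k \<in> {..n}"
      then show "mu v k * (Psi mu + sum lam Ks * ((d v)\<^sup>2 / 4)) \<le> mu v k * Psi (mu(v := point k))"
        using gt[of k] by (intro mult_left_mono p0) simp
    next
      show "\<exists>k\<in>{..n}. mu v k * (Psi mu + sum lam Ks * ((d v)\<^sup>2 / 4)) < mu v k * Psi (mu(v := point k))"
        using gt[of j] \<open>j \<in> {..n}\<close> \<open>0 < mu v j\<close> by (intro bexI[of _ j] mult_strict_left_mono) auto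
    qed simp
    then show False using avg p1 by (simp flip: sum_distrib_right)
  qed
  then obtain j where j: "j \<le> n" "Psi (mu(v := point j)) \<le> Psi mu + sum lam Ks * ((d v)\<^sup>2 / 4)" by blast
  have mu_eq: "mu(v := point j) = (\<lambda>u. if u \<in> insert v X then point ((f(v := j)) u) else mu0 u)"
    by (auto simp: mu_def fun_eq_iff)
  have "Psi mu \<le> sum lam Ks * (\<Sum>v\<in>X. (d v)\<^sup>2) / 4" using Phi by (simp add: Psi_def mu_def c_def)
  then have "Psi (mu(v := point j)) \<le> sum lam Ks * (\<Sum>v\<in>insert v X. (d v)\<^sup>2) / 4"
    using j(2) insert.hyps by (simp add: algebra_simps add_divide_distrib)
  then show ?case unfolding mu_eq Psi_def c_def using f j(1) by (intro exI[of _ "f(v := j)"]) auto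
qed

text \<open>The probability that two independent levels with laws \<open>p\<close> and
  \<open>q\<close> add up to at most \<open>K\<close>. It is linear in each law separately, which is
  what the rounding relies on.\<close>

definition conv_cdf :: "nat \<Rightarrow> (nat \<Rightarrow> real) \<Rightarrow> (nat \<Rightarrow> real) \<Rightarrow> nat \<Rightarrow> real" where
  "conv_cdf n p q K = (\<Sum>j\<le>n. \<Sum>k\<le>n. p j * q k * of_bool (j + k \<le> K))"

lemma conv_cdf_commute: "conv_cdf n p q K = conv_cdf n q p K"
  unfolding conv_cdf_def by (subst sum.swap) (simp add: mult.commute add.commute)

lemma conv_cdf_bounds:
  assumes "distribution n p" "distribution n q"
  shows "0 \<le> conv_cdf n p q K" "conv_cdf n p q K \<le> 1"
proof -
  have pq: "0 \<le> p j" "0 \<le> q j" for j using assms by (auto simp: distribution_def)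
  show "0 \<le> conv_cdf n p q K" unfolding conv_cdf_def using pq by (intro sum_nonneg) auto
  have "conv_cdf n p q K \<le> (\<Sum>j\<le>n. \<Sum>k\<le>n. p j * q k)"
    unfolding conv_cdf_def using pq by (intro sum_mono) (auto simp: of_bool_def)
  also have "\<dots> = (\<Sum>j\<le>n. p j) * (\<Sum>k\<le>n. q k)" by (simp add: sum_product)
  finally show "conv_cdf n p q K \<le> 1" using assms by (simp add: distribution_def)
qed

lemma conv_cdf_point:
  assumes "i \<le> n"
  shows "conv_cdf n (point i) q K = (\<Sum>k\<le>n. q k * of_bool (i + k \<le> K))"
proof -
  have "conv_cdf n (point i) q K = (\<Sum>j\<le>n. point i j * (\<Sum>k\<le>n. q k * of_bool (j + k \<le> K)))"
    unfolding conv_cdf_def by (simp only: sum_distrib_left mult.assoc)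
  then show ?thesis using sum_point[OF assms] by simp
qed

lemma conv_cdf_affine: "conv_cdf n p q K = (\<Sum>j\<le>n. p j * conv_cdf n (point j) q K)"
proof -
  have "(\<Sum>j\<le>n. p j * conv_cdf n (point j) q K) = (\<Sum>j\<le>n. p j * (\<Sum>k\<le>n. q k * of_bool (j + k \<le> K)))"
    by (intro sum.cong) (auto simp: conv_cdf_point)
  then show ?thesis unfolding conv_cdf_def[of n p] by (simp only: sum_distrib_left mult.assoc)
qed

lemma conv_cdf_points:
  assumes "i \<le> n" "k \<le> n"
  shows "conv_cdf n (point i) (point k) K = of_bool (i + k \<le> K)"
  using conv_cdf_point[OF assms(1), of "point k" K] sum_point[OF assms(2), of "\<lambda>k. of_bool (i + k \<le> K)"] by simp

text \<open>The expected count is affine in the law of each vertex because an edge has two distinct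
  ends. Changing the law at \<open>v\<close> affects only the edges at \<open>v\<close>, each by at
  most 1, so the range at \<open>v\<close> is its degree.\<close>

lemma level_rounding:
  fixes mu0 :: "'a \<Rightarrow> nat \<Rightarrow> real"
  assumes G: "finite_simple_graph V E"
    and ends: "\<And>e. e \<in> E \<Longrightarrow> e = {a e, b e} \<and> a e \<noteq> b e"
    and X: "X \<subseteq> V" and mu0: "\<And>v. distribution n (mu0 v)"
    and fixed: "\<And>v. v \<in> V - X \<Longrightarrow> g v \<le> n \<and> mu0 v = point (g v)"
    and lam: "\<And>K. K \<in> Ks \<Longrightarrow> 0 \<le> lam K"
  shows "\<exists>f. (\<forall>v\<in>V. f v \<le> n) \<and>
    (\<Sum>K\<in>Ks. lam K * (real (card {e \<in> E. sum f e \<le> K}) - (\<Sum>e\<in>E. conv_cdf n (mu0 (a e)) (mu0 (b e)) K))\<^sup>2)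
      \<le> sum lam Ks * (\<Sum>v\<in>X. (real (degree E v))\<^sup>2) / 4"
proof -
  note D = finite_simple_graphD[OF G]
  have fX: "finite X" using X D(1) by (rule finite_subset)
  define F where "F mu K = (\<Sum>e\<in>E. conv_cdf n (mu (a e)) (mu (b e)) K)" for mu :: "'a \<Rightarrow> nat \<Rightarrow> real" and K
  have "\<exists>f. (\<forall>v\<in>X. f v \<le> n) \<and>
    (\<Sum>K\<in>Ks. lam K * (F (\<lambda>v. if v \<in> X then point (f v) else mu0 v) K - F mu0 K)\<^sup>2)
      \<le> sum lam Ks * (\<Sum>v\<in>X. (real (degree E v))\<^sup>2) / 4"
  proof (rule greedy_rounding[OF fX lam mu0])
    fix mu :: "'a \<Rightarrow> nat \<Rightarrow> real" and v K
    assume mu: "\<And>u. distribution n (mu u)"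
    have one: "conv_cdf n (mu (a e)) (mu (b e)) K =
      (\<Sum>j\<le>n. mu v j * conv_cdf n ((mu(v := point j)) (a e)) ((mu(v := point j)) (b e)) K)" if e: "e \<in> E" for e
    proof -
      consider "a e = v" "b e \<noteq> v" | "a e \<noteq> v" "b e = v" | "a e \<noteq> v" "b e \<noteq> v" using ends[OF e] by auto
      then show ?thesis
      proof cases
        case 1
        then show ?thesis by (simp add: conv_cdf_affine[of n "mu v"])
      next
        case 2
        then show ?thesis using conv_cdf_affine[of n "mu v" "mu (a e)" K]
          by (simp add: conv_cdf_commute[of n "mu (a e)"])
      next
        case 3
        then show ?thesis using mu[of v] by (simp add: distribution_def flip: sum_distrib_right)
      qed
    qed
    have "F mu K = (\<Sum>e\<in>E. \<Sum>j\<le>n. mu v j * conv_cdf n ((mu(v := point j)) (a e)) ((mu(v := point j)) (b e)) K)"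
      unfolding F_def by (rule sum.cong[OF refl one])
    also have "\<dots> = (\<Sum>j\<le>n. mu v j * F (mu(v := point j)) K)"
      unfolding F_def sum_distrib_left by (rule sum.swap)
    finally show "F mu K = (\<Sum>j\<le>n. mu v j * F (mu(v := point j)) K)" .
  next
    fix mu :: "'a \<Rightarrow> nat \<Rightarrow> real" and v K j k
    assume mu: "\<And>u. distribution n (mu u)" and jk: "j \<le> n" "k \<le> n"
    let ?c = "\<lambda>i e. conv_cdf n ((mu(v := point i)) (a e)) ((mu(v := point i)) (b e)) K"
    have "\<bar>F (mu(v := point j)) K - F (mu(v := point k)) K\<bar> = \<bar>\<Sum>e\<in>E. ?c j e - ?c k e\<bar>"
      unfolding F_def by (simp add: sum_subtractf)
    also have "\<dots> \<le> (\<Sum>e\<in>E. \<bar>?c j e - ?c k e\<bar>)" by (rule sum_abs)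
    also have "\<dots> \<le> (\<Sum>e\<in>E. of_bool (v \<in> e))"
    proof (rule sum_mono)
      fix e assume e: "e \<in> E"
      show "\<bar>?c j e - ?c k e\<bar> \<le> of_bool (v \<in> e)"
      proof (cases "v \<in> e")
        case True
        have d: "distribution n ((mu(v := point i)) u)" if "i \<le> n" for i u
          using mu distribution_point that by auto
        have "0 \<le> ?c j e" "?c j e \<le> 1" "0 \<le> ?c k e" "?c k e \<le> 1"
          using conv_cdf_bounds[OF d d] jk by blast+
        then show ?thesis using True by (simp add: abs_le_iff)
      next
        case False
        then have "a e \<noteq> v" "b e \<noteq> v" using ends[OF e] by auto
        then show ?thesis by simp
      qed
    qed
    also have "\<dots> = real (degree E v)"
      using D(2) by (simp add: degree_def of_bool_def sum.If_cases Int_def)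
    finally show "\<bar>F (mu(v := point j)) K - F (mu(v := point k)) K\<bar> \<le> real (degree E v)" .
  qed
  then obtain f where f: "\<forall>v\<in>X. f v \<le> n" and
    Phi: "(\<Sum>K\<in>Ks. lam K * (F (\<lambda>v. if v \<in> X then point (f v) else mu0 v) K - F mu0 K)\<^sup>2)
      \<le> sum lam Ks * (\<Sum>v\<in>X. (real (degree E v))\<^sup>2) / 4" by blast
  define h where "h v = (if v \<in> X then f v else g v)" for v
  have hn: "h v \<le> n" if "v \<in> V" for v using f fixed[of v] that by (auto simp: h_def)
  have "F (\<lambda>v. if v \<in> X then point (f v) else mu0 v) K = real (card {e \<in> E. sum h e \<le> K})" for K
  proof -
    have "F (\<lambda>v. if v \<in> X then point (f v) else mu0 v) K = (\<Sum>e\<in>E. of_bool (sum h e \<le> K))"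
      unfolding F_def
    proof (rule sum.cong[OF refl])
      fix e assume e: "e \<in> E"
      have ab: "a e \<in> V" "b e \<in> V" using D(3)[OF e] ends[OF e] by auto
      have pt: "(if v \<in> X then point (f v) else mu0 v) = point (h v)" if "v \<in> V" for v
        using fixed[of v] that by (simp add: h_def)
      have "sum h {a e, b e} = h (a e) + h (b e)" using ends[OF e, THEN conjunct2] by simp
      with arg_cong[OF ends[OF e, THEN conjunct1], of "sum h"] have s: "sum h e = h (a e) + h (b e)"
        by (rule trans)
      show "conv_cdf n (if a e \<in> X then point (f (a e)) else mu0 (a e))
          (if b e \<in> X then point (f (b e)) else mu0 (b e)) K = of_bool (sum h e \<le> K)"
        unfolding pt[OF ab(1)] pt[OF ab(2)] s by (rule conv_cdf_points[OF hn[OF ab(1)] hn[OF ab(2)]])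
    qed
    also have "\<dots> = real (card {e \<in> E. sum h e \<le> K})"
      using D(2) by (simp add: of_bool_def sum.If_cases Int_def)
    finally show ?thesis .
  qed
  then have "(\<Sum>K\<in>Ks. lam K * (real (card {e \<in> E. sum h e \<le> K}) - F mu0 K)\<^sup>2)
      \<le> sum lam Ks * (\<Sum>v\<in>X. (real (degree E v))\<^sup>2) / 4" using Phi by simp
  then show ?thesis unfolding F_def using hn by (intro exI[of _ h]) auto
qed

section \<open>Expected level counts\<close>

text \<open>Equal masses on the inner levels leave two free parameters and make the distribution
  function of a sum of two levels quadratic in \<open>K\<close> on each half of its range.\<close>

definition lev_dist :: "real \<Rightarrow> real \<Rightarrow> real \<Rightarrow> nat \<Rightarrow> real" where
  "lev_dist p u r j = (if j = 0 then p else if j < 12 then u else if j = 12 then r else 0)"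

text \<open>The distribution functions of one level and of the sum of two independent levels drawn from
  \<open>lev_dist p u r\<close>, in closed form (the latter for \<open>K < 24\<close>).\<close>

definition cdf1 :: "real \<Rightarrow> real \<Rightarrow> nat \<Rightarrow> real" where
  "cdf1 p u K = (if K < 12 then p + real K * u else 1)"

definition cdf2 :: "real \<Rightarrow> real \<Rightarrow> real \<Rightarrow> nat \<Rightarrow> real" where
  "cdf2 p u r K = (if K < 12 then p\<^sup>2 + 2 * p * u * real K + real K * (real K - 1) / 2 * u\<^sup>2
     else 1 - r\<^sup>2 - 2 * r * u * (23 - real K) - (23 - real K) * (22 - real K) / 2 * u\<^sup>2)"

lemma atMost_12: "{..12::nat} = {0,1,2,3,4,5,6,7,8,9,10,11,12}"
  by (auto simp: eval_nat_numeral le_Suc_eq)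

lemma nat_less_12_cases:
  "(m::nat) < 12 \<Longrightarrow> m = 0 \<or> m = 1 \<or> m = 2 \<or> m = 3 \<or> m = 4 \<or> m = 5 \<or> m = 6 \<or> m = 7 \<or> m = 8 \<or> m = 9 \<or> m = 10 \<or> m = 11"
  by (simp add: eval_nat_numeral less_Suc_eq)

lemma distribution_lev_dist:
  assumes "0 \<le> p" "0 \<le> u" "0 \<le> r" "p + 11 * u + r = 1"
  shows "distribution 12 (lev_dist p u r)"
  using assms by (simp add: distribution_def lev_dist_def atMost_12)

lemma lev_dist_cdf:
  assumes "p + 11 * u + r = 1"
  shows "(\<Sum>k\<le>12. lev_dist p u r k * of_bool (k \<le> m)) = cdf1 p u m"
proof (cases "m < 12")
  case True
  then show ?thesis
    using nat_less_12_cases[OF True] by (elim disjE) (simp_all add: lev_dist_def cdf1_def atMost_12)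
next
  case False
  then show ?thesis using assms by (simp add: lev_dist_def cdf1_def atMost_12)
qed

lemma conv_cdf_point_lev_dist:
  assumes "p + 11 * u + r = 1" "j \<le> 12"
  shows "conv_cdf 12 (point j) (lev_dist p u r) K = (if K < j then 0 else cdf1 p u (K - j))"
proof (cases "K < j")
  case True
  then show ?thesis by (simp add: conv_cdf_point[OF assms(2)])
next
  case False
  then have "(j + k \<le> K) = (k \<le> K - j)" for k by auto
  then show ?thesis using False lev_dist_cdf[OF assms(1), of "K - j"] by (simp add: conv_cdf_point[OF assms(2)])
qed

text \<open>Conditioning on one level leaves 24 polynomial identities. For \<open>K \<ge> 12\<close>
  the closed form counts the complement, so \<open>r\<close> is eliminated before comparing.\<close>

lemma conv_cdf_lev_dist:
  assumes p: "p + 11 * u + r = 1" and K: "K < 24"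
  shows "conv_cdf 12 (lev_dist p u r) (lev_dist p u r) K = cdf2 p u r K"
proof -
  have r: "r = 1 - p - 11 * u" using p by simp
  have "conv_cdf 12 (lev_dist p u r) (lev_dist p u r) K =
    (\<Sum>j\<le>12. lev_dist p u r j * (if K < j then 0 else cdf1 p u (K - j)))"
    by (subst conv_cdf_affine) (intro sum.cong refl, simp add: conv_cdf_point_lev_dist[OF p])
  also have "\<dots> = cdf2 p u r K"
  proof (cases "K < 12")
    case True
    show ?thesis
      using nat_less_12_cases[OF True]
      by (elim disjE) (simp_all add: lev_dist_def cdf1_def cdf2_def atMost_12 power2_eq_square algebra_simps)
  next
    case False
    then obtain i where i: "K = 12 + i" by (metis le_add_diff_inverse not_less)
    then have "i < 12" using K by simp
    from nat_less_12_cases[OF this] show ?thesis unfolding r i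
      by (elim disjE) (simp_all add: lev_dist_def cdf1_def cdf2_def atMost_12 power2_eq_square algebra_simps)
  qed
  finally show ?thesis .
qed

text \<open>\<open>Q\<close> sits at level 0, \<open>B - Q\<close> at level 12, and the other
  vertices follow \<open>lev_dist p u r\<close>. \<open>X K\<close> is the expected count without
  the edges inside \<open>B\<close>, which add between 0 and \<open>\<beta>\<close>. The deviation
  allowed at \<open>K\<close> is \<open>tau K * \<sigma>\<close>, so its square is weighted by
  \<open>1 / (tau K)\<^sup>2\<close>. The squared small degrees sum to at most
  \<open>card E / 40000 * 2 * card E = 9 / 20000 * \<sigma>\<^sup>2\<close>; with the bound 80000/9
  on the sum of the weights, a quarter of the product is exactly \<open>\<sigma>\<^sup>2\<close>, so
  no single deviation is too large. The margin \<open>1 / 10 ^ 8\<close> absorbs the difference of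
  at most 1/3 between \<open>s\<close> and \<open>\<sigma>\<close> and the rounding of
  levels.\<close>

lemma weighting_balanced:
  fixes p u r \<sigma> :: real and tau :: "nat \<Rightarrow> real"
  assumes G: "finite_simple_graph V E"
    and s: "10000000000 \<le> s" and m: "card E \<le> 3 * s + 1" "3 * s \<le> card E + 1"
    and B: "Q \<subseteq> B" "B \<subseteq> V"
    and small: "\<And>v. v \<in> V - B \<Longrightarrow> 40000 * degree E v \<le> card E"
    and p: "0 \<le> p" "0 \<le> u" "0 \<le> r" "p + 11 * u + r = 1"
    and tau: "\<And>K. K < 24 \<Longrightarrow> 0 < tau K" "9 * (\<Sum>K<24. 1 / (tau K)\<^sup>2) \<le> 80000"
    and \<sigma>: "\<sigma> = real (card E) / 3"
    and eq: "DQ = real (card {e \<in> E. e \<inter> Q \<noteq> {} \<and> \<not> e \<subseteq> B})"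
      "DP = real (card {e \<in> E. e \<inter> (B - Q) \<noteq> {} \<and> \<not> e \<subseteq> B})"
      "M = real (card {e \<in> E. e \<inter> B = {}})" "\<beta> = real (card {e \<in> E. e \<subseteq> B})"
    and X: "\<And>K. X K = DQ * cdf1 p u K + DP * (if K < 12 then 0 else cdf1 p u (K - 12)) + M * cdf2 p u r K"
    and lo: "\<And>K. K < 24 \<Longrightarrow> ((real K + 1) / 12 + tau K + 1 / 10 ^ 8) * \<sigma> \<le> X K"
    and hi: "\<And>K. K < 24 \<Longrightarrow> X K + \<beta> \<le> (1 + real K / 12 - tau K - 1 / 10 ^ 8) * \<sigma>"
  shows "\<exists>w'. edge_irregular_total_weighting V E (Suc s) w'"
proof -
  note D = finite_simple_graphD[OF G]
  have "\<exists>a b. \<forall>e\<in>E. e = {a e, b e} \<and> a e \<noteq> b e"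
  proof -
    have "\<forall>e\<in>E. \<exists>x y. e = {x, y} \<and> x \<noteq> y" using D(4) by (simp add: card_2_iff)
    then show ?thesis by metis
  qed
  then obtain a b where ends: "\<And>e. e \<in> E \<Longrightarrow> e = {a e, b e} \<and> a e \<noteq> b e" by blast
  define \<pi> where "\<pi> = lev_dist p u r"
  have \<pi>: "distribution 12 \<pi>" unfolding \<pi>_def by (rule distribution_lev_dist[OF p])
  define g :: "'a \<Rightarrow> nat" where "g v = (if v \<in> Q then 0 else 12)" for v
  define mu0 where "mu0 v = (if v \<in> B then point (g v) else \<pi>)" for v
  have mu0: "distribution 12 (mu0 v)" for v using \<pi> distribution_point by (auto simp: mu0_def g_def)
  define lam where "lam K = 1 / (tau K)\<^sup>2" for K
  define F where "F K = (\<Sum>e\<in>E. conv_cdf 12 (mu0 (a e)) (mu0 (b e)) K)" for K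
  have "\<exists>f. (\<forall>v\<in>V. f v \<le> 12) \<and>
    (\<Sum>K\<in>{..<24}. lam K * (real (card {e \<in> E. sum f e \<le> K}) - (\<Sum>e\<in>E. conv_cdf 12 (mu0 (a e)) (mu0 (b e)) K))\<^sup>2)
      \<le> sum lam {..<24} * (\<Sum>v\<in>V - B. (real (degree E v))\<^sup>2) / 4"
    by (rule level_rounding[OF G ends, of _ 12 mu0 g]) (use mu0 in \<open>auto simp: mu0_def g_def lam_def\<close>)
  then obtain f where f: "\<forall>v\<in>V. f v \<le> 12" and
    Phi: "(\<Sum>K<24. lam K * (real (card {e \<in> E. sum f e \<le> K}) - F K)\<^sup>2)
      \<le> sum lam {..<24} * (\<Sum>v\<in>V - B. (real (degree E v))\<^sup>2) / 4" unfolding F_def by blast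
  have \<sigma>0: "0 < \<sigma>" using \<sigma> m(2) s by simp
  have "(\<Sum>v\<in>V - B. (real (degree E v))\<^sup>2) \<le> (\<Sum>v\<in>V - B. real (card E) / 40000 * real (degree E v))"
  proof (rule sum_mono)
    fix v assume "v \<in> V - B"
    then have "real (40000 * degree E v) \<le> real (card E)" using small[of v] of_nat_mono by blast
    then have "real (degree E v) \<le> real (card E) / 40000" by simp
    then show "(real (degree E v))\<^sup>2 \<le> real (card E) / 40000 * real (degree E v)"
      unfolding power2_eq_square by (rule mult_right_mono) simp
  qed
  also have "\<dots> = real (card E) / 40000 * real (\<Sum>v\<in>V - B. degree E v)"
    by (simp add: sum_distrib_left)
  also have "\<dots> \<le> real (card E) / 40000 * real (2 * card E)"
    using sum_degree_le[OF G, of "V - B"] by (intro mult_left_mono) (auto simp flip: of_nat_sum)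
  finally have deg2: "(\<Sum>v\<in>V - B. (real (degree E v))\<^sup>2) \<le> \<sigma>\<^sup>2 * 9 / 20000"
    by (simp add: \<sigma> power2_eq_square)
  have lam0: "0 \<le> lam K" for K by (simp add: lam_def)
  have "sum lam {..<24} * (\<Sum>v\<in>V - B. (real (degree E v))\<^sup>2) \<le> (80000 / 9) * (\<sigma>\<^sup>2 * 9 / 20000)"
    using tau(2) deg2 by (intro mult_mono) (auto simp: lam_def intro!: sum_nonneg)
  then have Phi': "(\<Sum>K<24. lam K * (real (card {e \<in> E. sum f e \<le> K}) - F K)\<^sup>2) \<le> \<sigma>\<^sup>2" using Phi by simp
  have dev: "\<bar>real (card {e \<in> E. sum f e \<le> K}) - F K\<bar> \<le> tau K * \<sigma>" if K: "K < 24" for K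
  proof -
    let ?d = "real (card {e \<in> E. sum f e \<le> K}) - F K"
    have "lam K * ?d\<^sup>2 \<le> (\<Sum>K<24. lam K * (real (card {e \<in> E. sum f e \<le> K}) - F K)\<^sup>2)"
      using K lam0 by (intro member_le_sum[of K "{..<24}"]) auto
    then have "lam K * ?d\<^sup>2 \<le> \<sigma>\<^sup>2" using Phi' by simp
    then have "?d\<^sup>2 \<le> (tau K * \<sigma>)\<^sup>2"
      using tau(1)[OF K] by (simp add: lam_def power_mult_distrib field_simps)
    then have "\<bar>?d\<bar> \<le> \<bar>tau K * \<sigma>\<bar>" by (rule abs_le_square_iff[THEN iffD2])
    then show ?thesis using tau(1)[OF K] \<sigma>0 by (simp add: abs_mult)
  qed
  have F: "X K \<le> F K \<and> F K \<le> X K + \<beta>" if K: "K < 24" for K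
  proof -
    let ?EQ = "{e \<in> E. e \<inter> Q \<noteq> {} \<and> \<not> e \<subseteq> B}" and ?EP = "{e \<in> E. e \<inter> (B - Q) \<noteq> {} \<and> \<not> e \<subseteq> B}"
    let ?EM = "{e \<in> E. e \<inter> B = {}}" and ?EB = "{e \<in> E. e \<subseteq> B}"
    let ?c = "\<lambda>e. conv_cdf 12 (mu0 (a e)) (mu0 (b e)) K"
    have ne: "e \<noteq> {}" if "e \<in> E" for e using D(4)[OF that] by auto
    have pair: "(a e \<in> S \<and> b e \<notin> B) \<or> (b e \<in> S \<and> a e \<notin> B)" if "e \<in> E" "e \<inter> S \<noteq> {}" "\<not> e \<subseteq> B" "S \<subseteq> B" for e S
    proof -
      have "{a e, b e} \<inter> S \<noteq> {}" "\<not> {a e, b e} \<subseteq> B" using that ends[OF that(1)] by auto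
      then show ?thesis using that(4) by auto
    qed
    have mixed: "?c e = conv_cdf 12 (point i) \<pi> K" if e: "e \<in> E" "e \<inter> S \<noteq> {}" "\<not> e \<subseteq> B" "S \<subseteq> B"
        and S: "\<And>v. v \<in> S \<Longrightarrow> g v = i" for e S i
      using pair[OF e] S e(4) conv_cdf_commute[of 12 \<pi> "point i" K] by (auto simp: mu0_def subset_eq)
    have cQ: "?c e = cdf1 p u K" if e: "e \<in> ?EQ" for e
    proof -
      have "?c e = conv_cdf 12 (point 0) \<pi> K" using e B by (intro mixed[of e Q]) (auto simp: g_def)
      then show ?thesis using conv_cdf_point_lev_dist[OF p(4), of 0 K] by (simp add: \<pi>_def)
    qed
    have cP: "?c e = (if K < 12 then 0 else cdf1 p u (K - 12))" if e: "e \<in> ?EP" for e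
    proof -
      have "?c e = conv_cdf 12 (point 12) \<pi> K" using e B by (intro mixed[of e "B - Q"]) (auto simp: g_def)
      then show ?thesis using conv_cdf_point_lev_dist[OF p(4), of 12 K] by (simp add: \<pi>_def)
    qed
    have cM: "?c e = cdf2 p u r K" if e: "e \<in> ?EM" for e
    proof -
      have "a e \<in> e" "b e \<in> e" using ends[of e] e by blast+
      then have "a e \<notin> B" "b e \<notin> B" using e by blast+
      then show ?thesis using conv_cdf_lev_dist[OF p(4) K] by (simp add: mu0_def \<pi>_def)
    qed
    have fin: "finite ?EQ" "finite ?EP" "finite ?EM" "finite ?EB" using D(2) by auto
    have 1: "E = ((?EQ \<union> ?EP) \<union> ?EM) \<union> ?EB" using B(1) by blast
    have 2: "?EQ \<inter> ?EP = {}"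
    proof -
      have False if e: "e \<in> ?EQ" "e \<in> ?EP" for e
        using pair[of e Q] pair[of e "B - Q"] e B by auto
      then show ?thesis by blast
    qed
    have 3: "(?EQ \<union> ?EP) \<inter> ?EM = {}" using B(1) by blast
    have 4: "((?EQ \<union> ?EP) \<union> ?EM) \<inter> ?EB = {}" using ne by blast
    have "F K = sum ?c (((?EQ \<union> ?EP) \<union> ?EM) \<union> ?EB)" unfolding F_def using 1 by (rule arg_cong)
    also have "\<dots> = ((sum ?c ?EQ + sum ?c ?EP) + sum ?c ?EM) + sum ?c ?EB"
      using sum.union_disjoint[OF fin(1,2) 2, of ?c]
        sum.union_disjoint[OF finite_UnI[OF fin(1,2)] fin(3) 3, of ?c]
        sum.union_disjoint[OF finite_UnI[OF finite_UnI[OF fin(1,2)] fin(3)] fin(4) 4, of ?c] by linarith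
    also have "sum ?c ?EQ = DQ * cdf1 p u K" using cQ by (simp add: eq)
    also have "sum ?c ?EP = DP * (if K < 12 then 0 else cdf1 p u (K - 12))"
      unfolding eq(2) using cP by (subst sum.cong[OF refl cP]) auto
    also have "sum ?c ?EM = M * cdf2 p u r K" using cM by (simp add: eq)
    finally have FX: "F K = X K + sum ?c ?EB" by (simp add: X)
    have "0 \<le> sum ?c ?EB" using conv_cdf_bounds(1)[OF mu0 mu0] by (rule sum_nonneg)
    moreover have "sum ?c ?EB \<le> of_nat (card ?EB) * 1"
      using conv_cdf_bounds(2)[OF mu0 mu0] by (rule sum_bounded_above)
    ultimately show ?thesis using FX by (simp add: eq)
  qed
  have ms: "real s \<le> \<sigma> + 1 / 3" "\<sigma> - 1 / 3 \<le> real s"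
    using m \<sigma> by linarith+
  have \<sigma>big: "10 ^ 9 \<le> \<sigma>" using ms s by simp
  show ?thesis
  proof (rule weighting_of_levels[OF G _ m(1), of f])
    show "0 < s" using s by simp
    show "f v \<le> 12" if "v \<in> V" for v using f that by blast
  next
    fix K :: nat assume K: "K < 24"
    let ?L = "card {e \<in> E. sum f e \<le> K}"
    have "((real K + 1) / 12 + 1 / 10 ^ 8) * \<sigma> \<le> real ?L"
      using dev[OF K] F[OF K] lo[OF K] by (simp add: distrib_right abs_le_iff)
    moreover have "(real K + 1) * \<sigma> + 12 / 10 ^ 8 * \<sigma> = 12 * (((real K + 1) / 12 + 1 / 10 ^ 8) * \<sigma>)"
      by (simp add: field_simps)
    ultimately have L: "(real K + 1) * \<sigma> + 12 / 10 ^ 8 * \<sigma> \<le> 12 * real ?L" by linarith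
    have "(real K + 1) * real s \<le> (real K + 1) * (\<sigma> + 1 / 3)" using ms by (intro mult_left_mono) auto
    also have "\<dots> \<le> (real K + 1) * \<sigma> + 8" using K by (simp add: algebra_simps)
    also have "\<dots> \<le> (real K + 1) * \<sigma> + 12 / 10 ^ 8 * \<sigma>" using \<sigma>big by simp
    also have "\<dots> \<le> 12 * real ?L" by (rule L)
    finally have "real ((K + 1) * s) \<le> real (12 * ?L)" by (simp add: algebra_simps)
    then show "(K + 1) * s \<le> 12 * ?L" by (simp only: of_nat_le_iff)
    have "real ?L \<le> (1 + real K / 12 - 1 / 10 ^ 8) * \<sigma>"
      using dev[OF K] F[OF K] hi[OF K] by (simp add: distrib_right left_diff_distrib abs_le_iff)
    moreover have "(12 + real K) * \<sigma> - 12 / 10 ^ 8 * \<sigma> = 12 * ((1 + real K / 12 - 1 / 10 ^ 8) * \<sigma>)"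
      by (simp add: field_simps)
    ultimately have U: "12 * real ?L + 12 / 10 ^ 8 * \<sigma> \<le> (12 + real K) * \<sigma>" by linarith
    have "12 * real ?L + 24 \<le> (12 + real K) * \<sigma> - 12" using U \<sigma>big by simp
    also have "\<dots> \<le> (12 + real K) * (\<sigma> - 1 / 3)" using K by (simp add: algebra_simps)
    also have "\<dots> \<le> (12 + real K) * real s" using ms by (intro mult_left_mono) auto
    finally have "real (12 * ?L + 24) \<le> real (12 * s + K * s)" by (simp add: algebra_simps)
    then show "12 * ?L + 24 \<le> 12 * s + K * s" by (simp only: of_nat_le_iff)
  qed
qed

section \<open>Balancing the vertices of large degree\<close>

text \<open>\<open>Q\<close> has the least sum among the subsets with at least half of the total. No
  subset sum lies strictly between the sums \<open>P\<close> and \<open>D\<close> of the two parts,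
  so every positive element of \<open>Q\<close> is at least \<open>D - P\<close>. If
  \<open>2 * D > 3 * P\<close>, this exceeds \<open>D / 3\<close>, and at most two such elements fit
  into \<open>Q\<close>.\<close>

lemma balanced_partition:
  fixes f :: "'b \<Rightarrow> nat"
  assumes B: "finite B"
  shows "\<exists>Q \<subseteq> B. sum f (B - Q) \<le> sum f Q \<and>
    (sum f Q = 0 \<or> (\<exists>b\<in>Q. sum f Q = f b) \<or> 2 * sum f Q \<le> 3 * sum f (B - Q) \<or>
     (\<exists>q1\<in>Q. \<exists>q2\<in>Q. \<exists>b\<in>B - Q. q1 \<noteq> q2 \<and> sum f Q = f q1 + f q2 \<and> sum f Q \<le> 2 * sum f (B - Q) \<and>
        f q1 \<le> f b \<and> f q2 \<le> f b))"
proof -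
  let ?S = "{X \<in> Pow B. sum f B \<le> 2 * sum f X}"
  have "B \<in> ?S" by simp
  then have "finite ?S" "?S \<noteq> {}" using B by auto
  then obtain Q where Q: "Q \<in> ?S" "\<forall>X\<in>?S. sum f Q \<le> sum f X"
    using finite_arg_extremum(1)[of ?S "sum f"] by blast
  have QB: "Q \<subseteq> B" using Q(1) by auto
  have fQ: "finite Q" using QB B by (rule finite_subset)
  define D P where "D = sum f Q" and "P = sum f (B - Q)"
  have comp: "sum f X + sum f (B - X) = sum f B" if "X \<subseteq> B" for X
    using sum.subset_diff[OF that B, of f] by simp
  have DP: "D + P = sum f B" using comp[OF QB] by (simp add: D_def P_def)
  have PD: "P \<le> D" using Q(1) DP by (auto simp: D_def)
  \<comment> \<open>Either \<open>X\<close> or its complement competes with the minimal \<open>Q\<close>.\<close>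
  have gap: "D \<le> sum f X \<or> sum f X \<le> P" if "X \<subseteq> B" for X
  proof (cases "sum f B \<le> 2 * sum f X")
    case True
    then show ?thesis using Q(2) that by (auto simp: D_def)
  next
    case False
    then have "B - X \<in> ?S" using comp[OF that] by auto
    then have "D \<le> sum f (B - X)" using Q(2) by (auto simp: D_def)
    then show ?thesis using comp[OF that] DP by linarith
  qed
  have large: "D \<le> P + f q" if q: "q \<in> Q" "0 < f q" for q
  proof -
    have "D = f q + sum f (Q - {q})" unfolding D_def by (rule sum.remove[OF fQ q(1)])
    then show ?thesis using gap[of "Q - {q}"] QB q(2) by auto
  qed
  define R where "R = {q \<in> Q. 0 < f q}"
  have fR: "finite R" using fQ by (simp add: R_def)
  have DR: "D = sum f R" unfolding D_def R_def using fQ by (intro sum.mono_neutral_right) auto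
  have "D = 0 \<or> (\<exists>b\<in>Q. D = f b) \<or> 2 * D \<le> 3 * P \<or>
     (\<exists>q1\<in>Q. \<exists>q2\<in>Q. \<exists>b\<in>B - Q. q1 \<noteq> q2 \<and> D = f q1 + f q2 \<and> D \<le> 2 * P \<and> f q1 \<le> f b \<and> f q2 \<le> f b)"
  proof (cases "2 * D \<le> 3 * P")
    case False
    have cardR: "card R * (D - P) \<le> D"
    proof -
      have "of_nat (card R) * (D - P) \<le> sum f R"
        by (rule sum_bounded_below) (use large in \<open>force simp: R_def\<close>)
      then show ?thesis using DR by simp
    qed
    have "card R \<le> 2"
    proof (rule ccontr)
      assume "\<not> card R \<le> 2"
      then have "3 * (D - P) \<le> card R * (D - P)" by (intro mult_right_mono) auto
      then show False using cardR False PD by linarith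
    qed
    then consider "card R = 0" | "card R = 1" | "card R = 2" by linarith
    then show ?thesis
    proof cases
      case 1
      then show ?thesis using DR fR by simp
    next
      case 2
      then obtain b where "R = {b}" by (auto simp: card_1_singleton_iff)
      then show ?thesis using DR by (auto simp: R_def)
    next
      case 3
      then obtain x y where xy: "R = {x, y}" "x \<noteq> y" by (auto simp: card_2_iff)
      have "\<exists>q1 q2. R = {q1, q2} \<and> q1 \<noteq> q2 \<and> f q2 \<le> f q1"
        using xy by (metis insert_commute nat_le_linear)
      then obtain q1 q2 where q: "R = {q1, q2}" "q1 \<noteq> q2" "f q2 \<le> f q1" by blast
      have qQ: "q1 \<in> Q" "q2 \<in> Q" "0 < f q1" "0 < f q2" using q(1) by (auto simp: R_def set_eq_iff)
      have Dq: "D = f q1 + f q2" using DR q by simp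
      have D2P: "D \<le> 2 * P" using large[OF qQ(1,3)] large[OF qQ(2,4)] Dq by linarith
      \<comment> \<open>Otherwise exchanging \<open>q1\<close> for any \<open>b\<close> gives a sum
        below \<open>D\<close>, hence at most \<open>P\<close>, which forces
        \<open>f b < D - P\<close>. Adding the elements of \<open>B - Q\<close> to \<open>q1\<close>
        one at a time then never jumps over the gap, so \<open>f q1 + P \<le> P\<close>.\<close>
      have "\<exists>b\<in>B - Q. f q1 \<le> f b"
      proof (rule ccontr)
        assume "\<not> ?thesis"
        then have lt: "f b < f q1" if "b \<in> B - Q" for b
          using that by (meson not_le)
        have fb: "f b + P < D" if b: "b \<in> B - Q" for b
        proof -
          have "sum f (insert b (Q - {q1})) = f b + sum f (Q - {q1})"
            using b fQ by (intro sum.insert) auto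
          moreover have "D = f q1 + sum f (Q - {q1})" unfolding D_def by (rule sum.remove[OF fQ qQ(1)])
          moreover have "insert b (Q - {q1}) \<subseteq> B" using b QB by auto
          ultimately have "f b + D \<le> P + f q1" using gap[of "insert b (Q - {q1})"] lt[OF b] by linarith
          then show ?thesis using large[OF qQ(2,4)] Dq False by linarith
        qed
        have "f q1 + sum f S \<le> P" if "S \<subseteq> B - Q" for S
          using finite_subset[OF that finite_Diff[OF B]] that
        proof (induction S rule: finite_induct)
          case empty
          then show ?case using large[OF qQ(2,4)] Dq by simp
        next
          case (insert b S)
          have "q1 \<notin> insert b S" using insert.prems qQ(1) by auto
          then have "sum f (insert q1 (insert b S)) = f q1 + (f b + sum f S)"
            using insert.hyps by simp
          moreover have "insert q1 (insert b S) \<subseteq> B" using insert.prems qQ(1) QB by auto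
          moreover have "f q1 + sum f S \<le> P" using insert by auto
          moreover have "f b + P < D" using fb insert.prems by auto
          ultimately have "f q1 + (f b + sum f S) \<le> P" using gap[of "insert q1 (insert b S)"] by linarith
          then show ?case using insert.hyps by simp
        qed
        from this[OF subset_refl] show False using qQ(3) by (simp add: P_def)
      qed
      then obtain b where "b \<in> B - Q" "f q1 \<le> f b" by blast
      moreover then have "f q2 \<le> f b" using q(3) by linarith
      ultimately show ?thesis using qQ(1,2) q(2) Dq D2P by blast
    qed
  qed blast
  then show ?thesis using QB PD unfolding D_def P_def by blast
qed

text \<open>Two bounds improve each other: \<open>k\<close> vertices span at most
  \<open>k * k / 2\<close> edges, and the degrees give
  \<open>k * card E \<le> 40000 * (card E + x)\<close>, since only the \<open>x\<close> inner edges
  are seen twice.\<close>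

lemma card_within_large_degrees:
  assumes G: "finite_simple_graph V E" and m: "70000000000 \<le> card E"
    and B: "B \<subseteq> V" "\<And>v. v \<in> B \<Longrightarrow> card E \<le> 40000 * degree E v"
  shows "10000 * card {e \<in> E. e \<subseteq> B} \<le> 118 * card E"
proof -
  note D = finite_simple_graphD[OF G]
  have fB: "finite B" using B(1) D(1) by (rule finite_subset)
  define k x where "k = card B" and "x = card {e \<in> E. e \<subseteq> B}"
  have x2: "2 * x \<le> k * k" unfolding k_def x_def by (rule card_edges_within[OF G fB])
  have xm: "x \<le> card E" unfolding x_def using D(2) by (intro card_mono) auto
  have "k * card E \<le> (\<Sum>v\<in>B. 40000 * degree E v)"
    using sum_bounded_below[of B "card E" "\<lambda>v. 40000 * degree E v"] B(2) by (simp add: k_def)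
  also have "\<dots> = 40000 * (\<Sum>e\<in>E. card (e \<inter> B))"
    using sum_degree[OF D(2) fB] by (simp flip: sum_distrib_left)
  also have "(\<Sum>e\<in>E. card (e \<inter> B)) \<le> (\<Sum>e\<in>E. 1 + of_bool (e \<subseteq> B))"
  proof (rule sum_mono)
    fix e assume e: "e \<in> E"
    show "card (e \<inter> B) \<le> 1 + of_bool (e \<subseteq> B)"
    proof (cases "e \<subseteq> B")
      case True then show ?thesis using D(4)[OF e] by (simp add: inf_absorb1)
    next
      case False
      then have "e \<inter> B \<subset> e" by auto
      then have "card (e \<inter> B) < card e" using D(5)[OF e] by (intro psubset_card_mono)
      then show ?thesis using D(4)[OF e] False by simp
    qed
  qed
  also have "\<dots> = card E + x"
    unfolding sum.distrib using D(2) by (simp add: of_bool_def sum.If_cases Int_def x_def)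
  finally have k: "k * card E \<le> 40000 * card E + 40000 * x" by simp
  have step: "k \<le> c" if "40000 * x \<le> d * card E" "c = 40000 + d" for c d
  proof (rule ccontr)
    assume "\<not> k \<le> c"
    then have "(c + 1) * card E \<le> k * card E" by (intro mult_right_mono) auto
    moreover have "c * card E = 40000 * card E + d * card E" using that(2) by (simp add: algebra_simps)
    ultimately show False using k that(1) m by simp
  qed
  have sq: "2 * x \<le> c * c" if "k \<le> c" for c using x2 mult_mono[OF that that] by linarith
  \<comment> \<open>Starting from the trivial \<open>x \<le> card E\<close>, the bound on
    \<open>k\<close> drops to 41829 and 40500. The constants leave little room below 7 * 10^10
    edges.\<close>
  have "k \<le> 80000" using step[of 40000 80000] xm by simp
  from sq[OF this] have "k \<le> 41829" using step[of 1829 41829] m by simp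
  from sq[OF this] have "k \<le> 40500" using step[of 500 40500] m by simp
  from sq[OF this] show ?thesis using m unfolding x_def by simp
qed

section \<open>Choice of the level distribution\<close>

text \<open>All quantities are normalised by a third of the number of edges: \<open>x\<close> and \<open>y\<close> count the edges from the
  two classes of large vertices to the small ones, \<open>z\<close> those between small vertices, \<open>\<beta>\<close> those between
  large vertices.\<close>

definition level_slack :: "real \<Rightarrow> real \<Rightarrow> real \<Rightarrow> (nat \<Rightarrow> real) \<Rightarrow> real \<Rightarrow> real \<Rightarrow> real \<Rightarrow> real \<Rightarrow> bool" where
  "level_slack p u r tau x y z \<beta> \<longleftrightarrow> (\<forall>K<24.
     (real K + 1) / 12 + tau K + 1 / 10 ^ 8 \<le> x * cdf1 p u K + y * (if K < 12 then 0 else cdf1 p u (K - 12)) + z * cdf2 p u r K \<and>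
     x * cdf1 p u K + y * (if K < 12 then 0 else cdf1 p u (K - 12)) + z * cdf2 p u r K + \<beta> \<le> 1 + real K / 12 - tau K - 1 / 10 ^ 8)"

definition feasible :: "real \<Rightarrow> real \<Rightarrow> real \<Rightarrow> real \<Rightarrow> bool" where
  "feasible x y z \<beta> \<longleftrightarrow> (\<exists>p u r tau. 0 \<le> p \<and> 0 \<le> u \<and> 0 \<le> r \<and> p + 11 * u + r = 1 \<and>
     (\<forall>K<24. 0 < tau K) \<and> 9 * (\<Sum>K<24. 1 / (tau K)\<^sup>2) \<le> 80000 \<and> level_slack p u r tau x y z \<beta>)"

text \<open>Masses in fortieths and tolerances in thousandths, given by natural numbers so that they
  can be evaluated. Once they are numerals, the 48 inequalities of \<open>level_slack\<close> are
  linear in \<open>x\<close>, \<open>y\<close>, \<open>z\<close>, \<open>\<beta>\<close>, and linear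
  arithmetic settles a whole polyhedral cell at once.\<close>

lemma feasibleI:
  assumes len: "length ts = 24" and pos: "list_all (\<lambda>t. 0 < t) ts"
    and sum: "9 * (\<Sum>t\<leftarrow>ts. 10 ^ 6 / (real t)\<^sup>2) \<le> 80000" and ab: "a + b \<le> 40"
    and slack: "level_slack (real a / 40) ((40 - real a - real b) / 440) (real b / 40) (\<lambda>K. real (ts ! K) / 1000) x y z \<beta>"
  shows "feasible x y z \<beta>"
proof -
  have "(\<Sum>t\<leftarrow>ts. 10 ^ 6 / (real t)\<^sup>2) = (\<Sum>K<24. 1 / (real (ts ! K) / 1000)\<^sup>2)"
    using len by (simp add: sum_list_sum_nth atLeast0LessThan power_divide)
  moreover have "real a + real b \<le> 40" using ab by linarith
  moreover have "\<forall>K<24. 0 < real (ts ! K) / 1000" using pos len by (simp add: list_all_length)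
  ultimately show ?thesis using sum slack unfolding feasible_def
    by (intro exI[of _ "real a / 40"] exI[of _ "(40 - real a - real b) / 440"] exI[of _ "real b / 40"]
        exI[of _ "\<lambda>K. real (ts ! K) / 1000"]) (simp add: field_simps)
qed

lemma all_less_24:
  "(\<forall>K<24. P K) \<longleftrightarrow> P 0 \<and> P 1 \<and> P 2 \<and> P 3 \<and> P 4 \<and> P 5 \<and> P 6 \<and> P 7 \<and> P 8 \<and> P 9 \<and> P 10 \<and> P 11 \<and>
     P 12 \<and> P 13 \<and> P 14 \<and> P 15 \<and> P 16 \<and> P 17 \<and> P 18 \<and> P 19 \<and> P 20 \<and> P 21 \<and> P 22 \<and> P (23::nat)"
  by (simp add: eval_nat_numeral All_less_Suc conj_ac)

lemmas level_slack_simps = level_slack_def all_less_24 cdf1_def cdf2_def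

text \<open>The boxes and the distributions below were found by a numerical search.\<close>

lemma feasible_cell_1:
  assumes "x + y + z + \<beta> = 3" "0 \<le> z" "0 \<le> \<beta>" "\<beta> \<le> 354 / 10000" "y \<le> x" "0 \<le> y"
    "0 \<le> x" "x \<le> 2 / 5" "0 \<le> y" "y \<le> 8 / 5" "x \<le> 15041 / 10000"
  shows "feasible x y z \<beta>"
  by (rule feasibleI[of "[101, 82, 68, 60, 57, 60, 68, 82, 102, 123, 140, 161, 126, 101, 80, 65, 54, 47, 46, 49, 57, 70, 88, 110]" 10 11])
    (simp_all add: level_slack_simps power2_eq_square, (use assms in \<open>intro conjI; linarith\<close>))

lemma feasible_cell_2:
  assumes "x + y + z + \<beta> = 3" "0 \<le> z" "0 \<le> \<beta>" "\<beta> \<le> 354 / 10000" "y \<le> x" "0 \<le> y"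
    "2 / 5 \<le> x" "x \<le> 4 / 5" "0 \<le> y" "y \<le> 3 / 20" "x \<le> 15041 / 10000"
  shows "feasible x y z \<beta>"
  by (rule feasibleI[of "[128, 106, 87, 73, 63, 56, 54, 56, 61, 71, 85, 103, 61, 50, 43, 40, 40, 44, 52, 63, 78, 97, 119, 145]" 9 13])
    (simp_all add: level_slack_simps power2_eq_square, (use assms in \<open>intro conjI; linarith\<close>))

lemma feasible_cell_3:
  assumes "x + y + z + \<beta> = 3" "0 \<le> z" "0 \<le> \<beta>" "\<beta> \<le> 354 / 10000" "y \<le> x" "0 \<le> y"
    "2 / 5 \<le> x" "x \<le> 4 / 5" "3 / 20 \<le> y" "y \<le> 8 / 5" "x \<le> 15041 / 10000"
  shows "feasible x y z \<beta>"
  by (rule feasibleI[of "[116, 92, 72, 56, 44, 36, 32, 33, 37, 45, 57, 60, 78, 65, 56, 50, 49, 51, 57, 66, 80, 97, 118, 142]" 9 12])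
    (simp_all add: level_slack_simps power2_eq_square, (use assms in \<open>intro conjI; linarith\<close>))

lemma feasible_cell_4:
  assumes "x + y + z + \<beta> = 3" "0 \<le> z" "0 \<le> \<beta>" "\<beta> \<le> 354 / 10000" "y \<le> x" "0 \<le> y"
    "4 / 5 \<le> x" "x \<le> 1" "0 \<le> y" "y \<le> 3 / 10" "x \<le> 15041 / 10000"
  shows "feasible x y z \<beta>"
  by (rule feasibleI[of "[113, 96, 82, 73, 67, 65, 67, 73, 83, 96, 114, 135, 69, 53, 42, 35, 32, 33, 38, 47, 60, 77, 98, 124]" 7 13])
    (simp_all add: level_slack_simps power2_eq_square, (use assms in \<open>intro conjI; linarith\<close>))

lemma feasible_cell_5:
  assumes "x + y + z + \<beta> = 3" "0 \<le> z" "0 \<le> \<beta>" "\<beta> \<le> 354 / 10000" "y \<le> x" "0 \<le> y"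
    "1 \<le> x" "x \<le> 6 / 5" "0 \<le> y" "y \<le> 3 / 10" "x \<le> 15041 / 10000"
  shows "feasible x y z \<beta>"
  by (rule feasibleI[of "[104, 85, 70, 57, 48, 42, 39, 39, 42, 48, 57, 70, 57, 51, 47, 47, 50, 57, 66, 79, 96, 115, 138, 164]" 6 15])
    (simp_all add: level_slack_simps power2_eq_square, (use assms in \<open>intro conjI; linarith\<close>))

lemma feasible_cell_6:
  assumes "x + y + z + \<beta> = 3" "0 \<le> z" "0 \<le> \<beta>" "\<beta> \<le> 354 / 10000" "y \<le> x" "0 \<le> y"
    "4 / 5 \<le> x" "x \<le> 6 / 5" "3 / 10 \<le> y" "y \<le> 1 / 2" "x \<le> 15041 / 10000"
  shows "feasible x y z \<beta>"
  by (rule feasibleI[of "[107, 87, 70, 56, 46, 39, 36, 36, 40, 47, 57, 71, 44, 40, 39, 42, 47, 55, 66, 81, 98, 119, 142, 168]" 7 13])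
    (simp_all add: level_slack_simps power2_eq_square, (use assms in \<open>intro conjI; linarith\<close>))

lemma feasible_cell_7:
  assumes "x + y + z + \<beta> = 3" "0 \<le> z" "0 \<le> \<beta>" "\<beta> \<le> 354 / 10000" "y \<le> x" "0 \<le> y"
    "4 / 5 \<le> x" "x \<le> 6 / 5" "1 / 2 \<le> y" "y \<le> 8 / 5" "x \<le> 15041 / 10000"
  shows "feasible x y z \<beta>"
  by (rule feasibleI[of "[98, 78, 62, 50, 41, 35, 32, 33, 38, 46, 57, 72, 64, 56, 51, 49, 51, 55, 63, 74, 88, 105, 126, 149]" 7 11])
    (simp_all add: level_slack_simps power2_eq_square, (use assms in \<open>intro conjI; linarith\<close>))

lemma feasible_cell_8:
  assumes "x + y + z + \<beta> = 3" "0 \<le> z" "0 \<le> \<beta>" "\<beta> \<le> 354 / 10000" "y \<le> x" "0 \<le> y"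
    "6 / 5 \<le> x" "x \<le> 27 / 20" "0 \<le> y" "y \<le> 1 / 4" "x \<le> 15041 / 10000"
  shows "feasible x y z \<beta>"
  by (rule feasibleI[of "[90, 75, 62, 53, 46, 42, 41, 43, 48, 55, 65, 78, 37, 34, 35, 38, 45, 54, 67, 82, 101, 122, 147, 174]" 5 16])
    (simp_all add: level_slack_simps power2_eq_square, (use assms in \<open>intro conjI; linarith\<close>))

lemma feasible_cell_9:
  assumes "x + y + z + \<beta> = 3" "0 \<le> z" "0 \<le> \<beta>" "\<beta> \<le> 354 / 10000" "y \<le> x" "0 \<le> y"
    "27 / 20 \<le> x" "x \<le> 7 / 5" "0 \<le> y" "y \<le> 1 / 4" "x \<le> 15041 / 10000"
  shows "feasible x y z \<beta>"
  by (rule feasibleI[of "[65, 55, 48, 45, 43, 45, 50, 57, 67, 80, 96, 115, 53, 48, 45, 45, 49, 56, 67, 80, 97, 117, 140, 166]" 4 16])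
    (simp_all add: level_slack_simps power2_eq_square, (use assms in \<open>intro conjI; linarith\<close>))

lemma feasible_cell_10:
  assumes "x + y + z + \<beta> = 3" "0 \<le> z" "0 \<le> \<beta>" "\<beta> \<le> 354 / 10000" "y \<le> x" "0 \<le> y"
    "7 / 5 \<le> x" "x \<le> 29 / 20" "0 \<le> y" "y \<le> 1 / 4" "x \<le> 15041 / 10000"
  shows "feasible x y z \<beta>"
  by (rule feasibleI[of "[69, 58, 49, 42, 38, 36, 37, 40, 46, 54, 64, 77, 40, 39, 42, 47, 55, 66, 79, 96, 115, 137, 162, 190]" 4 17])
    (simp_all add: level_slack_simps power2_eq_square, (use assms in \<open>intro conjI; linarith\<close>))

lemma feasible_cell_11:
  assumes "x + y + z + \<beta> = 3" "0 \<le> z" "0 \<le> \<beta>" "\<beta> \<le> 354 / 10000" "y \<le> x" "0 \<le> y"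
    "29 / 20 \<le> x" "x \<le> 59 / 40" "0 \<le> y" "y \<le> 1 / 10" "x \<le> 15041 / 10000"
  shows "feasible x y z \<beta>"
  by (rule feasibleI[of "[75, 63, 53, 45, 40, 37, 36, 38, 42, 49, 57, 69, 42, 45, 51, 60, 71, 84, 100, 119, 140, 163, 189, 218]" 4 18])
    (simp_all add: level_slack_simps power2_eq_square, (use assms in \<open>intro conjI; linarith\<close>))

lemma feasible_cell_12:
  assumes "x + y + z + \<beta> = 3" "0 \<le> z" "0 \<le> \<beta>" "\<beta> \<le> 354 / 10000" "y \<le> x" "0 \<le> y"
    "59 / 40 \<le> x" "x \<le> 3 / 2" "0 \<le> y" "y \<le> 1 / 40" "x \<le> 15041 / 10000"
  shows "feasible x y z \<beta>"
  by (rule feasibleI[of "[78, 67, 59, 53, 49, 48, 49, 53, 59, 67, 78, 92, 24, 29, 36, 46, 58, 73, 90, 110, 132, 156, 183, 213]" 4 18])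
    (simp_all add: level_slack_simps power2_eq_square, (use assms in \<open>intro conjI; linarith\<close>))

lemma feasible_cell_13:
  assumes "x + y + z + \<beta> = 3" "0 \<le> z" "0 \<le> \<beta>" "\<beta> \<le> 354 / 10000" "y \<le> x" "0 \<le> y"
    "3 / 2 \<le> x" "x \<le> 8 / 5" "0 \<le> y" "y \<le> 1 / 40" "x \<le> 15041 / 10000"
  shows "feasible x y z \<beta>"
  by (rule feasibleI[of "[81, 70, 63, 57, 54, 54, 56, 60, 66, 76, 87, 101, 21, 26, 34, 44, 56, 71, 89, 108, 131, 155, 182, 212]" 4 18])
    (simp_all add: level_slack_simps power2_eq_square, (use assms in \<open>intro conjI; linarith\<close>))

lemma feasible_cell_14:
  assumes "x + y + z + \<beta> = 3" "0 \<le> z" "0 \<le> \<beta>" "\<beta> \<le> 354 / 10000" "y \<le> x" "0 \<le> y"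
    "59 / 40 \<le> x" "x \<le> 8 / 5" "1 / 40 \<le> y" "y \<le> 1 / 10" "x \<le> 15041 / 10000"
  shows "feasible x y z \<beta>"
  by (rule feasibleI[of "[78, 66, 57, 50, 45, 43, 43, 45, 50, 57, 66, 78, 26, 32, 39, 50, 62, 77, 95, 115, 137, 162, 189, 218]" 4 18])
    (simp_all add: level_slack_simps power2_eq_square, (use assms in \<open>intro conjI; linarith\<close>))

lemma feasible_cell_15:
  assumes "x + y + z + \<beta> = 3" "0 \<le> z" "0 \<le> \<beta>" "\<beta> \<le> 354 / 10000" "y \<le> x" "0 \<le> y"
    "29 / 20 \<le> x" "x \<le> 8 / 5" "1 / 10 \<le> y" "y \<le> 1 / 4" "x \<le> 15041 / 10000"
  shows "feasible x y z \<beta>"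
  by (rule feasibleI[of "[74, 64, 57, 51, 49, 48, 50, 55, 61, 70, 82, 96, 24, 28, 34, 43, 54, 68, 84, 103, 125, 149, 175, 204]" 4 17])
    (simp_all add: level_slack_simps power2_eq_square, (use assms in \<open>intro conjI; linarith\<close>))

lemma feasible_cell_16:
  assumes "x + y + z + \<beta> = 3" "0 \<le> z" "0 \<le> \<beta>" "\<beta> \<le> 354 / 10000" "y \<le> x" "0 \<le> y"
    "6 / 5 \<le> x" "x \<le> 7 / 5" "1 / 4 \<le> y" "y \<le> 1 / 2" "x \<le> 15041 / 10000"
  shows "feasible x y z \<beta>"
  by (rule feasibleI[of "[86, 71, 60, 50, 44, 40, 39, 40, 44, 50, 59, 71, 45, 45, 48, 54, 62, 73, 86, 102, 121, 143, 168, 195]" 5 15])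
    (simp_all add: level_slack_simps power2_eq_square, (use assms in \<open>intro conjI; linarith\<close>))

lemma feasible_cell_17:
  assumes "x + y + z + \<beta> = 3" "0 \<le> z" "0 \<le> \<beta>" "\<beta> \<le> 354 / 10000" "y \<le> x" "0 \<le> y"
    "7 / 5 \<le> x" "x \<le> 8 / 5" "1 / 4 \<le> y" "y \<le> 1 / 2" "x \<le> 15041 / 10000"
  shows "feasible x y z \<beta>"
  by (rule feasibleI[of "[67, 57, 49, 43, 40, 39, 40, 43, 48, 56, 66, 78, 40, 43, 48, 56, 67, 80, 95, 113, 133, 156, 182, 210]" 4 16])
    (simp_all add: level_slack_simps power2_eq_square, (use assms in \<open>intro conjI; linarith\<close>))

lemma feasible_cell_18:
  assumes "x + y + z + \<beta> = 3" "0 \<le> z" "0 \<le> \<beta>" "\<beta> \<le> 354 / 10000" "y \<le> x" "0 \<le> y"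
    "6 / 5 \<le> x" "x \<le> 8 / 5" "1 / 2 \<le> y" "y \<le> 7 / 10" "x \<le> 15041 / 10000"
  shows "feasible x y z \<beta>"
  by (rule feasibleI[of "[83, 69, 58, 50, 44, 40, 39, 40, 44, 50, 58, 69, 28, 33, 41, 51, 63, 77, 94, 112, 133, 156, 181, 209]" 5 14])
    (simp_all add: level_slack_simps power2_eq_square, (use assms in \<open>intro conjI; linarith\<close>))

lemma feasible_cell_19:
  assumes "x + y + z + \<beta> = 3" "0 \<le> z" "0 \<le> \<beta>" "\<beta> \<le> 354 / 10000" "y \<le> x" "0 \<le> y"
    "6 / 5 \<le> x" "x \<le> 8 / 5" "7 / 10 \<le> y" "y \<le> 8 / 5" "x \<le> 15041 / 10000"
  shows "feasible x y z \<beta>"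
  by (rule feasibleI[of "[75, 65, 56, 49, 44, 41, 39, 39, 41, 44, 49, 55, 45, 45, 47, 51, 57, 66, 77, 90, 106, 124, 144, 166]" 5 11])
    (simp_all add: level_slack_simps power2_eq_square, (use assms in \<open>intro conjI; linarith\<close>))

text \<open>For splits whose larger class consists of two vertices that are too light for the triple
  construction; hence the bound just above 1.67.\<close>

lemma feasible_cell_20:
  assumes "x + y + z + \<beta> = 3" "0 \<le> z" "0 \<le> \<beta>" "\<beta> \<le> 354 / 10000" "y \<le> x" "0 \<le> y"
    "3 / 2 \<le> x" "x \<le> 16701 / 10000" "7 / 10 \<le> y" "y \<le> 3 / 2" "x \<le> 2 * y"
  shows "feasible x y z \<beta>"
  by (rule feasibleI[of "[29, 41, 53, 65, 77, 89, 101, 113, 126, 138, 150, 162, 42, 41, 41, 43, 47, 53, 61, 70, 82, 94, 106, 121]" 3 9])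
    (simp_all add: level_slack_simps power2_eq_square, (use assms in \<open>intro conjI; linarith\<close>))

text \<open>For nearly even splits with two heavy classes: they take at least 5/2 of the 3 units, so
  little mass is left to the edges between small vertices.\<close>

lemma feasible_cell_21:
  assumes "x + y + z + \<beta> = 3" "0 \<le> z" "0 \<le> \<beta>" "\<beta> \<le> 354 / 10000" "y \<le> x" "0 \<le> y"
    "3 / 2 \<le> x" "x \<le> 9 / 5" "1 \<le> y" "y \<le> 3 / 2" "2 * x \<le> 3 * y"
  shows "feasible x y z \<beta>"
  by (rule feasibleI[of "[29, 51, 73, 96, 118, 140, 163, 185, 207, 230, 252, 274, 96, 96, 96, 96, 96, 93, 84, 78, 74, 73, 74, 77]" 3 6])
    (simp_all add: level_slack_simps power2_eq_square, (use assms in \<open>intro conjI; linarith\<close>))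

text \<open>A decision tree over the cells, which get narrower towards large \<open>x\<close> and
  small \<open>y\<close>, the most uneven splits. The limit 1.5041 instead of 1.504 allows for
  \<open>s\<close> exceeding a third of \<open>card E\<close> slightly.\<close>

lemma feasible_small:
  assumes "x + y + z + \<beta> = 3" "0 \<le> z" "0 \<le> \<beta>" "\<beta> \<le> 354 / 10000" "y \<le> x" "0 \<le> y" "x \<le> 15041 / 10000"
  shows "feasible x y z \<beta>"
proof (cases "x \<le> 2 / 5")
  case h1: True
  show ?thesis
    by (rule feasible_cell_1) (use assms h1 in linarith)+
next
  case h1: False
  show ?thesis
    proof (cases "x \<le> 4 / 5")
      case h2: True
      show ?thesis
        proof (cases "y \<le> 3 / 20")
          case h3: True
          show ?thesis
            by (rule feasible_cell_2) (use assms h1 h2 h3 in linarith)+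
        next
          case h3: False
          show ?thesis
            by (rule feasible_cell_3) (use assms h1 h2 h3 in linarith)+
        qed
    next
      case h2: False
      show ?thesis
        proof (cases "x \<le> 6 / 5")
          case h3: True
          show ?thesis
            proof (cases "y \<le> 3 / 10")
              case h4: True
              show ?thesis
                proof (cases "x \<le> 1")
                  case h5: True
                  show ?thesis
                    by (rule feasible_cell_4) (use assms h1 h2 h3 h4 h5 in linarith)+
                next
                  case h5: False
                  show ?thesis
                    by (rule feasible_cell_5) (use assms h1 h2 h3 h4 h5 in linarith)+
                qed
            next
              case h4: False
              show ?thesis
                proof (cases "y \<le> 1 / 2")
                  case h5: True
                  show ?thesis
                    by (rule feasible_cell_6) (use assms h1 h2 h3 h4 h5 in linarith)+
                next
                  case h5: False
                  show ?thesis
                    by (rule feasible_cell_7) (use assms h1 h2 h3 h4 h5 in linarith)+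
                qed
            qed
        next
          case h3: False
          show ?thesis
            proof (cases "y \<le> 1 / 4")
              case h4: True
              show ?thesis
                proof (cases "x \<le> 27 / 20")
                  case h5: True
                  show ?thesis
                    by (rule feasible_cell_8) (use assms h1 h2 h3 h4 h5 in linarith)+
                next
                  case h5: False
                  show ?thesis
                    proof (cases "x \<le> 7 / 5")
                      case h6: True
                      show ?thesis
                        by (rule feasible_cell_9) (use assms h1 h2 h3 h4 h5 h6 in linarith)+
                    next
                      case h6: False
                      show ?thesis
                        proof (cases "x \<le> 29 / 20")
                          case h7: True
                          show ?thesis
                            by (rule feasible_cell_10) (use assms h1 h2 h3 h4 h5 h6 h7 in linarith)+
                        next
                          case h7: False
                          show ?thesis
                            proof (cases "y \<le> 1 / 10")
                              case h8: True
                              show ?thesis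
                                proof (cases "x \<le> 59 / 40")
                                  case h9: True
                                  show ?thesis
                                    by (rule feasible_cell_11) (use assms h1 h2 h3 h4 h5 h6 h7 h8 h9 in linarith)+
                                next
                                  case h9: False
                                  show ?thesis
                                    proof (cases "y \<le> 1 / 40")
                                      case h10: True
                                      show ?thesis
                                        proof (cases "x \<le> 3 / 2")
                                          case h11: True
                                          show ?thesis
                                            by (rule feasible_cell_12) (use assms h1 h2 h3 h4 h5 h6 h7 h8 h9 h10 h11 in linarith)+
                                        next
                                          case h11: False
                                          show ?thesis
                                            by (rule feasible_cell_13) (use assms h1 h2 h3 h4 h5 h6 h7 h8 h9 h10 h11 in linarith)+
                                        qed
                                    next
                                      case h10: False
                                      show ?thesis
                                        by (rule feasible_cell_14) (use assms h1 h2 h3 h4 h5 h6 h7 h8 h9 h10 in linarith)+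
                                    qed
                                qed
                            next
                              case h8: False
                              show ?thesis
                                by (rule feasible_cell_15) (use assms h1 h2 h3 h4 h5 h6 h7 h8 in linarith)+
                            qed
                        qed
                    qed
                qed
            next
              case h4: False
              show ?thesis
                proof (cases "y \<le> 1 / 2")
                  case h5: True
                  show ?thesis
                    proof (cases "x \<le> 7 / 5")
                      case h6: True
                      show ?thesis
                        by (rule feasible_cell_16) (use assms h1 h2 h3 h4 h5 h6 in linarith)+
                    next
                      case h6: False
                      show ?thesis
                        by (rule feasible_cell_17) (use assms h1 h2 h3 h4 h5 h6 in linarith)+
                    qed
                next
                  case h5: False
                  show ?thesis
                    proof (cases "y \<le> 7 / 10")
                      case h6: True
                      show ?thesis
                        by (rule feasible_cell_18) (use assms h1 h2 h3 h4 h5 h6 in linarith)+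
                    next
                      case h6: False
                      show ?thesis
                        by (rule feasible_cell_19) (use assms h1 h2 h3 h4 h5 h6 in linarith)+
                    qed
                qed
            qed
        qed
    qed
qed

lemma feasible_region:
  assumes "x + y + z + \<beta> = 3" "0 \<le> z" "0 \<le> \<beta>" "\<beta> \<le> 354 / 10000" "y \<le> x" "0 \<le> y"
    and "x \<le> 15041 / 10000 \<or> x \<le> 16701 / 10000 \<and> x \<le> 2 * y \<or> 2 * x \<le> 3 * y"
  shows "feasible x y z \<beta>"
proof -
  consider "x \<le> 15041 / 10000" | "15041 / 10000 < x" "x \<le> 16701 / 10000" "x \<le> 2 * y"
    | "15041 / 10000 < x" "2 * x \<le> 3 * y" using assms(7) by linarith
  then show ?thesis
  proof cases
    case 1
    then show ?thesis by (intro feasible_small assms)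
  next
    case 2
    then show ?thesis by (intro feasible_cell_20) (use assms in linarith)+
  next
    case 3
    then show ?thesis by (intro feasible_cell_21) (use assms in linarith)+
  qed
qed

section \<open>The main theorem\<close>

text \<open>If the split fails all alternatives of \<open>feasible_region\<close>, the only
  remaining outcome of \<open>balanced_partition\<close> is a class made up by \<open>q1\<close> and
  \<open>q2\<close>, with a third vertex \<open>b\<close> at least as heavy as each of them. All
  three pairs then have a cut of at least \<open>f q1 + f q2\<close>, which is at least
  \<open>1.67 * s\<close>.\<close>

lemma weighting_moderate:
  assumes G: "finite_simple_graph V E" and m7: "70000000000 \<le> card E"
    and s: "10000000000 \<le> s" and m: "card E \<le> 3 * s + 1" "3 * s \<le> card E + 1"
    and deg: "\<And>v. v \<in> V \<Longrightarrow> 1000 * degree E v \<le> 1504 * s"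
  shows "\<exists>w'. edge_irregular_total_weighting V E (Suc s) w'"
proof -
  note D = finite_simple_graphD[OF G]
  define B where "B = {v \<in> V. card E < 40000 * degree E v}"
  have BV: "B \<subseteq> V" by (auto simp: B_def)
  have fB: "finite B" using BV D(1) by (rule finite_subset)
  \<comment> \<open>Edges inside \<open>B\<close> are left out to make \<open>f\<close> additive: an
    edge leaving \<open>B\<close> has at most one end in it.\<close>
  define f where "f b = card {e \<in> E. b \<in> e \<and> \<not> e \<subseteq> B}" for b
  have disj: "{e \<in> E. b \<in> e \<and> \<not> e \<subseteq> B} \<inter> {e \<in> E. c \<in> e \<and> \<not> e \<subseteq> B} = {}"
    if bc: "b \<in> B" "c \<in> B" "b \<noteq> c" for b c
  proof -
    have "e \<subseteq> B" if e: "e \<in> E" "b \<in> e" "c \<in> e" for e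
    proof -
      obtain y z where "e = {y, z}" using D(4)[OF e(1)] by (auto simp: card_2_iff)
      then show ?thesis using bc e by auto
    qed
    then show ?thesis by blast
  qed
  have sumf: "sum f X = card {e \<in> E. e \<inter> X \<noteq> {} \<and> \<not> e \<subseteq> B}" if X: "X \<subseteq> B" for X
  proof -
    have "{e \<in> E. e \<inter> X \<noteq> {} \<and> \<not> e \<subseteq> B} = (\<Union>b\<in>X. {e \<in> E. b \<in> e \<and> \<not> e \<subseteq> B})" by blast
    also have "card \<dots> = (\<Sum>b\<in>X. card {e \<in> E. b \<in> e \<and> \<not> e \<subseteq> B})"
      by (rule card_UN_disjoint) (use X disj D(2) finite_subset[OF X fB] in \<open>simp_all add: subset_iff\<close>)
    finally show ?thesis by (simp add: f_def)
  qed
  have fdeg: "f b \<le> degree E b" for b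
    unfolding f_def degree_def using D(2) by (intro card_mono) auto
  obtain Q where QB: "Q \<subseteq> B" and PQ: "sum f (B - Q) \<le> sum f Q" and cases:
    "sum f Q = 0 \<or> (\<exists>b\<in>Q. sum f Q = f b) \<or> 2 * sum f Q \<le> 3 * sum f (B - Q) \<or>
     (\<exists>q1\<in>Q. \<exists>q2\<in>Q. \<exists>b\<in>B - Q. q1 \<noteq> q2 \<and> sum f Q = f q1 + f q2 \<and> sum f Q \<le> 2 * sum f (B - Q) \<and>
        f q1 \<le> f b \<and> f q2 \<le> f b)"
    using balanced_partition[OF fB, of f] by blast
  define \<sigma> where "\<sigma> = real (card E) / 3"
  define DQ DP M \<beta> where "DQ = real (card {e \<in> E. e \<inter> Q \<noteq> {} \<and> \<not> e \<subseteq> B})"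
    and "DP = real (card {e \<in> E. e \<inter> (B - Q) \<noteq> {} \<and> \<not> e \<subseteq> B})"
    and "M = real (card {e \<in> E. e \<inter> B = {}})" and "\<beta> = real (card {e \<in> E. e \<subseteq> B})"
  have DQ: "DQ = real (sum f Q)" and DP: "DP = real (sum f (B - Q))"
    using sumf[OF QB] sumf[of "B - Q"] by (auto simp: DQ_def DP_def)
  have \<sigma>: "10 ^ 10 \<le> \<sigma>" using m7 by (simp add: \<sigma>_def)
  have s\<sigma>: "real s \<le> \<sigma> + 1 / 3" using m by (simp add: \<sigma>_def)
  have total: "DQ + DP + M + \<beta> = 3 * \<sigma>"
  proof -
    have ne: "e \<noteq> {}" if "e \<in> E" for e using D(4)[OF that] by auto
    let ?X = "{e \<in> E. e \<inter> B \<noteq> {} \<and> \<not> e \<subseteq> B}" and ?Y = "{e \<in> E. e \<inter> B = {}}" and ?Z = "{e \<in> E. e \<subseteq> B}"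
    have 1: "E = (?X \<union> ?Y) \<union> ?Z" by blast
    have 2: "?X \<inter> ?Y = {}" by blast
    have 3: "(?X \<union> ?Y) \<inter> ?Z = {}" using ne by blast
    have fin: "finite ?X" "finite ?Y" "finite ?Z" using D(2) by auto
    have "card E = card ((?X \<union> ?Y) \<union> ?Z)" using 1 by (rule arg_cong)
    also have "\<dots> = card ?X + card ?Y + card ?Z"
      using card_Un_disjoint[OF fin(1,2) 2] card_Un_disjoint[OF finite_UnI[OF fin(1,2)] fin(3) 3] by linarith
    also have "card ?X = sum f B" using sumf[of B] by simp
    also have "sum f B = sum f (B - Q) + sum f Q" by (rule sum.subset_diff[OF QB fB])
    finally have "real (card E) = real (sum f (B - Q) + sum f Q + card ?Y + card ?Z)" by simp
    then show ?thesis by (simp add: DQ DP M_def \<beta>_def \<sigma>_def)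
  qed
  have \<beta>: "\<beta> \<le> 354 / 10000 * \<sigma>"
  proof -
    have "10000 * card {e \<in> E. e \<subseteq> B} \<le> 118 * card E"
      by (rule card_within_large_degrees[OF G m7 BV]) (auto simp: B_def)
    then have "real (10000 * card {e \<in> E. e \<subseteq> B}) \<le> real (118 * card E)" by (simp only: of_nat_le_iff)
    then show ?thesis by (simp add: \<beta>_def \<sigma>_def)
  qed
  show ?thesis
  proof (cases "DQ \<le> 15041 / 10000 * \<sigma> \<or> DQ \<le> 16701 / 10000 * \<sigma> \<and> DQ \<le> 2 * DP \<or> 2 * DQ \<le> 3 * DP")
    case True
    have "feasible (DQ / \<sigma>) (DP / \<sigma>) (M / \<sigma>) (\<beta> / \<sigma>)"
    proof (rule feasible_region)
      show "DQ / \<sigma> + DP / \<sigma> + M / \<sigma> + \<beta> / \<sigma> = 3"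
        using total \<sigma> by (simp add: field_simps)
      show "0 \<le> M / \<sigma>" "0 \<le> \<beta> / \<sigma>" "0 \<le> DP / \<sigma>" using \<sigma> by (simp_all add: M_def \<beta>_def DP_def)
      show "\<beta> / \<sigma> \<le> 354 / 10000" using \<beta> \<sigma> by (simp add: field_simps)
      show "DP / \<sigma> \<le> DQ / \<sigma>" using PQ \<sigma> by (simp add: DQ DP divide_right_mono flip: of_nat_sum)
      show "DQ / \<sigma> \<le> 15041 / 10000 \<or> DQ / \<sigma> \<le> 16701 / 10000 \<and> DQ / \<sigma> \<le> 2 * (DP / \<sigma>) \<or> 2 * (DQ / \<sigma>) \<le> 3 * (DP / \<sigma>)"
        using True \<sigma> by (simp add: field_simps)
    qed
    then obtain p u r tau where p: "0 \<le> p" "0 \<le> u" "0 \<le> r" "p + 11 * u + r = 1"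
      and tau: "\<And>K. K < 24 \<Longrightarrow> 0 < tau K" "9 * (\<Sum>K<24. 1 / (tau K)\<^sup>2) \<le> 80000"
      and slack: "level_slack p u r tau (DQ / \<sigma>) (DP / \<sigma>) (M / \<sigma>) (\<beta> / \<sigma>)"
      unfolding feasible_def by blast
    define X where "X K = DQ * cdf1 p u K + DP * (if K < 12 then 0 else cdf1 p u (K - 12)) + M * cdf2 p u r K" for K
    have X: "DQ / \<sigma> * cdf1 p u K + DP / \<sigma> * (if K < 12 then 0 else cdf1 p u (K - 12)) + M / \<sigma> * cdf2 p u r K = X K / \<sigma>" for K
      by (simp add: X_def add_divide_distrib)
    have \<sigma>0: "0 < \<sigma>" using \<sigma> by simp
    show ?thesis
    proof (rule weighting_balanced[OF G s m QB BV _ p tau \<sigma>_def DQ_def DP_def M_def \<beta>_def X_def])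
      show "40000 * degree E v \<le> card E" if "v \<in> V - B" for v using that by (auto simp: B_def)
    next
      fix K :: nat assume K: "K < 24"
      from slack K have 1: "(real K + 1) / 12 + tau K + 1 / 10 ^ 8 \<le> X K / \<sigma>"
        and 2: "X K / \<sigma> + \<beta> / \<sigma> \<le> 1 + real K / 12 - tau K - 1 / 10 ^ 8"
        unfolding level_slack_def X by blast+
      show "((real K + 1) / 12 + tau K + 1 / 10 ^ 8) * \<sigma> \<le> X K"
        using 1 \<sigma>0 by (simp only: pos_le_divide_eq)
      have "(X K + \<beta>) / \<sigma> \<le> 1 + real K / 12 - tau K - 1 / 10 ^ 8" using 2 by (simp only: add_divide_distrib)
      then show "X K + \<beta> \<le> (1 + real K / 12 - tau K - 1 / 10 ^ 8) * \<sigma>"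
        using \<sigma>0 by (simp only: pos_divide_le_eq)
    qed
  next
    case False
    have small: "DQ > 15041 / 10000 * \<sigma>" using False by simp
    have n1: "sum f Q \<noteq> 0"
    proof
      assume "sum f Q = 0"
      then have "DQ = 0" using DQ by (simp only: of_nat_0)
      then show False using small \<sigma> by simp
    qed
    have n2: "\<not> (\<exists>b\<in>Q. sum f Q = f b)"
    proof
      assume "\<exists>b\<in>Q. sum f Q = f b"
      then obtain b where b: "b \<in> Q" "sum f Q = f b" by blast
      have "b \<in> V" using QB BV b(1) by auto
      then have "1000 * sum f Q \<le> 1504 * s" using fdeg[of b] deg[of b] b(2) by linarith
      then have "real (1000 * sum f Q) \<le> real (1504 * s)" by (simp only: of_nat_le_iff)
      then have "1000 * DQ \<le> 1504 * real s" by (simp add: DQ)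
      then show False using small s\<sigma> \<sigma> by simp
    qed
    have n3: "\<not> 2 * sum f Q \<le> 3 * sum f (B - Q)"
    proof
      assume "2 * sum f Q \<le> 3 * sum f (B - Q)"
      then have "real (2 * sum f Q) \<le> real (3 * sum f (B - Q))" by (simp only: of_nat_le_iff)
      then show False using False by (simp add: DQ DP)
    qed
    from cases n1 n2 n3 have "\<exists>q1\<in>Q. \<exists>q2\<in>Q. \<exists>b\<in>B - Q. q1 \<noteq> q2 \<and> sum f Q = f q1 + f q2 \<and>
        sum f Q \<le> 2 * sum f (B - Q) \<and> f q1 \<le> f b \<and> f q2 \<le> f b" by argo
    then obtain q1 q2 b where q: "q1 \<in> Q" "q2 \<in> Q" "b \<in> B - Q" "q1 \<noteq> q2" "sum f Q = f q1 + f q2"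
      "sum f Q \<le> 2 * sum f (B - Q)" "f q1 \<le> f b" "f q2 \<le> f b" by blast
    have "real (sum f Q) \<le> real (2 * sum f (B - Q))" using q(6) by (simp only: of_nat_le_iff)
    then have "DQ > 16701 / 10000 * \<sigma>" using False by (simp add: DQ DP)
    then have "1670 * real s \<le> 1000 * DQ" using s\<sigma> \<sigma> by simp
    then have large: "1670 * s \<le> 1000 * f q1 + 1000 * f q2"
    proof -
      have "real (1670 * s) \<le> real (1000 * f q1 + 1000 * f q2)"
        using \<open>1670 * real s \<le> 1000 * DQ\<close> unfolding DQ q(5) by simp
      then show ?thesis by (simp only: of_nat_le_iff)
    qed
    have cutf: "f y + f z \<le> cut E y z" if yz: "y \<in> B" "z \<in> B" "y \<noteq> z" for y z
    proof -
      have "f y + f z = card ({e \<in> E. y \<in> e \<and> \<not> e \<subseteq> B} \<union> {e \<in> E. z \<in> e \<and> \<not> e \<subseteq> B})"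
        unfolding f_def using D(2) disj[OF yz] by (intro card_Un_disjoint[symmetric]) auto
      also have "\<dots> \<le> cut E y z"
        unfolding cut_def using D(2) disj[OF yz] by (intro card_mono) auto
      finally show ?thesis .
    qed
    have B: "q1 \<in> B" "q2 \<in> B" "b \<in> B" "q1 \<noteq> b" "q2 \<noteq> b" using q QB by auto
    show ?thesis
    proof (rule weighting_triple[OF G _ _ _ q(4) B(4,5) s m])
      show "q1 \<in> V" "q2 \<in> V" "b \<in> V" using B BV by auto
      show "1670 * s \<le> 1000 * cut E q1 q2" using large cutf[OF B(1,2) q(4)] by linarith
      show "1670 * s \<le> 1000 * cut E q1 b" using large cutf[OF B(1,3,4)] q(8) by linarith
      show "1670 * s \<le> 1000 * cut E q2 b" using large cutf[OF B(2,3,5)] q(7) by linarith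
    qed
  qed
qed

lemma weighting_exists:
  assumes G: "finite_simple_graph V E" and m7: "70000000000 \<le> card E"
  shows "\<exists>w'. edge_irregular_total_weighting V E (Suc (max ((card E + 1) div 3) (max_degree V E div 2))) w'"
proof -
  note D = finite_simple_graphD[OF G]
  have "E \<noteq> {}" using m7 by auto
  then obtain e where "e \<in> E" by blast
  then have "V \<noteq> {}" using D(3,4)[of e] by auto
  then have "max_degree V E \<in> degree E ` V"
    unfolding max_degree_def using D(1) by (intro Max_in) auto
  then obtain b where b: "b \<in> V" "max_degree V E = degree E b" by auto
  have max: "degree E v \<le> degree E b" if "v \<in> V" for v
    unfolding b(2)[symmetric] max_degree_def using D(1) that by (intro Max_ge) auto
  \<comment> \<open>\<open>Suc s\<close> is the larger of the two ceilings in the theorem.\<close>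
  define s where "s = max ((card E + 1) div 3) (degree E b div 2)"
  have m: "card E \<le> 3 * s + 1" unfolding s_def by linarith
  have d: "degree E b \<le> 2 * s + 1" unfolding s_def by linarith
  have s: "10000000000 \<le> s" using m7 m by linarith
  have "\<exists>w'. edge_irregular_total_weighting V E (Suc s) w'"
  proof (cases "1504 * s \<le> 1000 * degree E b")
    case True
    have "3 * s \<le> card E + 1 \<or> 2 * s \<le> degree E b" unfolding s_def by linarith
    then show ?thesis by (intro weighting_star[OF G b(1) s m _ d True])
  next
    case False
    \<comment> \<open>The maximum degree is too small to determine \<open>s\<close>, so
      \<open>s = (card E + 1) div 3\<close>.\<close>
    then have "3 * s \<le> card E + 1" unfolding s_def by linarith
    then show ?thesis
    proof (intro weighting_moderate[OF G m7 s m])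
      show "1000 * degree E v \<le> 1504 * s" if "v \<in> V" for v using max[OF that] False by linarith
    qed
  qed
  then show ?thesis by (simp add: s_def b(2))
qed

theorem theorem3:
  fixes V :: "'a set" and E :: "'a set set"
  assumes "finite_simple_graph V E"
    and "card E \<ge> 7 * 10 ^ 10"
  shows "int (tes V E) =
    max \<lceil>(real (card E) + 2) / 3\<rceil> \<lceil>(real (max_degree V E) + 1) / 2\<rceil>"
proof -
  note G = assms(1)
  note D = finite_simple_graphD[OF G]
  have m7: "70000000000 \<le> card E" using assms(2) by simp
  define S where "S = Suc (max ((card E + 1) div 3) (max_degree V E div 2))"
  have "E \<noteq> {}" using m7 by auto
  then obtain e where "e \<in> E" by blast
  then have "V \<noteq> {}" using D(3,4)[of e] by auto
  then have "max_degree V E \<in> degree E ` V"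
    unfolding max_degree_def using D(1) by (intro Max_in) auto
  then obtain b where b: "max_degree V E = degree E b" by auto
  have "tes V E = S"
    unfolding tes_def
  proof (rule Least_equality)
    show "0 < S \<and> (\<exists>w. edge_irregular_total_weighting V E S w)"
      using weighting_exists[OF G m7] by (simp add: S_def)
  next
    fix t assume "0 < t \<and> (\<exists>w. edge_irregular_total_weighting V E t w)"
    then obtain w where t: "0 < t" and w: "edge_irregular_total_weighting V E t w" by blast
    have 1: "card E + 2 \<le> 3 * t" by (rule weighting_lower_bounds(1)[OF G w \<open>E \<noteq> {}\<close>])
    have 2: "max_degree V E + 1 \<le> 2 * t"
      using weighting_lower_bounds(2)[OF G w, of b] t b by (cases "degree E b = 0") auto
    have "(card E + 1) div 3 < t" "max_degree V E div 2 < t" using 1 2 by linarith+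
    then show "S \<le> t" unfolding S_def by simp
  qed
  moreover have "\<lceil>(real (card E) + 2) / 3\<rceil> = int (Suc ((card E + 1) div 3))"
  proof -
    have "3 * ((card E + 1) div 3) \<le> card E + 1" "card E + 1 \<le> 3 * ((card E + 1) div 3) + 2" by linarith+
    then have "3 * real ((card E + 1) div 3) \<le> real (card E) + 1"
      "real (card E) + 1 \<le> 3 * real ((card E + 1) div 3) + 2" by linarith+
    then show ?thesis by (intro ceiling_unique) simp_all
  qed
  moreover have "\<lceil>(real (max_degree V E) + 1) / 2\<rceil> = int (Suc (max_degree V E div 2))"
  proof -
    have "2 * (max_degree V E div 2) \<le> max_degree V E" "max_degree V E \<le> 2 * (max_degree V E div 2) + 1" by linarith+
    then have "2 * real (max_degree V E div 2) \<le> real (max_degree V E)"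
      "real (max_degree V E) \<le> 2 * real (max_degree V E div 2) + 1" by linarith+
    then show ?thesis by (intro ceiling_unique) simp_all
  qed
  ultimately show ?thesis by (simp add: S_def max_def)
qed

end
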